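(* Let $A$ be the generalized Weyl algebra determined by $q$ and $p$, with $q$ not a root of unity. Suppose $p\sim z$, i.e. $p=cz$ for some nonzero $c\in k$. Then the Batalin--Vilkovisky algebra $(\mathrm{HH}^*(A),\smile,\Delta)$ has $\{1,\mathfrak s,\mathfrak t,\mathfrak u,\mathfrak v\}$ as a $k$-basis, where $|1|=0$, $|\mathfrak s|=|\mathfrak t|=1$, $|\mathfrak u|=|\mathfrak v|=2$ and $1,\mathfrak s,\mathfrak t,\mathfrak u,\mathfrak v$ are the classes represented by the cocycles $1$, $(x,-y,0)^T$, $(x,y,2z)^T$, $(1,1,0,0)^T$, $(0,\widetilde p,-xz,zy)^T$ of the complex $\mathcal S$, respectively. In addition: 1. $1$ is the identity of $\mathrm{HH}^*(A)$ with respect to the cup product, and the cup products of all other pairs of basis elements are zero except $\mathfrak s\smile\mathfrak t=-\mathfrak t\smile\mathfrak s=-2\mathfrak v$; 2. $\Delta(\mathfrak v)=\mathfrak s$, $\Delta(\mathfrak t)=-2$, and $\Delta$ vanishes on all other basis elements.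
   Context: Algebra. $k$ is a field of characteristic $\neq 2$; $q\in k^\times$ is not a root of unity; $\sigma$ is the automorphism of $k[z]$ with $\sigma(z)=qz$, and $\widetilde\varphi:=\sigma(\varphi)$. $p\in k[z]$ is a polynomial of degree $\ge1$ without multiple roots, $p'$ its derivative; fix $\alpha,\beta\in k[z]$ with $\alpha p+\beta p'=1$ (for $p=cz$ one may take $\alpha=0$, $\beta=c^{-1}$). $A=k\langle x,y,z\mid xz=qzx,\ yz=q^{-1}zy,\ yx=p,\ xy=\widetilde p\rangle$, $\mathbb Z$-graded by $\deg x=1$, $\deg y=-1$, $\deg z=0$. The automorphism $\nu(x)=qx$, $\nu(y)=q^{-1}y$, $\nu(z)=z$ is its Nakayama automorphism ($A$ is skew Calabi--Yau of dimension $2$). Hochschild (co)homology. $\bar A=A/k$. $C^n(A,A)=\mathrm{Hom}_k(\bar A^{\otimes n},A)$ is the normalized Hochschild cochain complex, with cohomology $\mathrm{HH}^*(A)$ and cup product induced by $(f\smile g)(a_1,\dots,a_{m+n})=(-1)^{mn}f(a_1,\dots,a_m)g(a_{m+1},\dots,a_{m+n})$ for $f\in C^m(A,A)$, $g\in C^n(A,A)$. $A^\nu$ is $A$ with bimodule structure $a\cdot m\cdot a'=am\nu(a')$. $C_n(A,A^\nu)=A^\nu\otimes\bar A^{\otimes n}$, elements $m[a_1,\dots,a_n]$, is the normalized Hochschild chain complex with differential $m[a_1,\dots,a_n]\mapsto m\nu(a_1)[a_2,\dots,a_n]+\sum_{i=1}^{n-1}(-1)^im[\dots,a_ia_{i+1},\dots]+(-1)^na_nm[a_1,\dots,a_{n-1}]$,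 and homology $H_*(A,A^\nu)$. Let $C^{(1)}_\bullet(A,A^\nu)$ be the subcomplex spanned by tensors $a_0[a_1,\dots,a_n]$ of homogeneous elements of total $\mathbb Z$-degree $0$; its inclusion is a quasi-isomorphism. The Connes operator on it is $\mathsf B(a_0[a_1,\dots,a_n])=1[a_0,\nu(a_1),\dots,\nu(a_n)]+\sum_{i=1}^n(-1)^{in}1[a_i,\dots,a_n,a_0,\nu(a_1),\dots,\nu(a_{i-1})]$, which induces $\mathsf B\colon H_n(A,A^\nu)\to H_{n+1}(A,A^\nu)$. Small resolution. $\otimes=\otimes_k$; $A^e=A\otimes A^{\mathrm{op}}$, $(a\otimes b)(a'\otimes b')=aa'\otimes b'b$, acting on bimodules by $(a\otimes b)m=amb$. $\mathfrak d\colon k[z]\to k[z]\otimes k[z]$ is linear with $\mathfrak d(1)=0$, $\mathfrak d(z^i)=\sum_{j=1}^iz^{i-j}\otimes z^{j-1}$; write $\mathfrak d(p)=p_1\otimes p_2$ (summation understood); tildes denote $\sigma$ applied to the indicated factor, and $p_2'$ is the derivative of $p_2$. $A$ has the free left $A^e$-resolution $\mathcal F\colon A^e\xleftarrow{d_1}(A^e)^3\xleftarrow{d_2}(A^e)^4\xleftarrow{d_3}(A^e)^4\xleftarrow{d_4}\cdots$ (row vectors, matrices multiply on the right), with augmentation the multiplication $A^e\to A$, where $$d_1=\begin{bmatrix}x\otimes1-1\otimes x\\ y\otimes1-1\otimes y\\ z\otimes1-1\otimes z\end{bmatrix},\quad d_2=\begin{bmatrix}y\otimes1&1\otimes x&-p_1\otimes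 p_2\\ 1\otimes y&x\otimes1&-q\widetilde{p_1}\otimes\widetilde{p_2}\\ \widetilde z\otimes1-1\otimes z&0&q\otimes x-x\otimes1\\ 0&z\otimes1-1\otimes\widetilde z&1\otimes y-y\otimes q\end{bmatrix},$$ $$d_3=\begin{bmatrix}x\otimes1&-1\otimes x&-\widetilde{p_1}\otimes p_2&0\\ -1\otimes y&y\otimes1&0&-p_1\otimes\widetilde{p_2}\\ z\otimes1-1\otimes z&0&-y\otimes1&-1\otimes x\\ 0&\widetilde z\otimes1-1\otimes\widetilde z&-1\otimes y&-x\otimes1\end{bmatrix},$$ $$d_4=\begin{bmatrix}y\otimes1&1\otimes x&-p_1\otimes p_2&0\\ 1\otimes y&x\otimes1&0&-\widetilde{p_1}\otimes\widetilde{p_2}\\ \widetilde z\otimes1-1\otimes z&0&-x\otimes1&1\otimes x\\ 0&z\otimes1-1\otimes\widetilde z&1\otimes y&-y\otimes1\end{bmatrix},\quad d_i=d_{i-2}\ (i\ge5).$$ $\mathcal S=\mathrm{Hom}_{A^e}(\mathcal F,A)$ is $A\to A^3\to A^4\to A^4\to\cdots$ with column-vector cochains and differentials $d^i$ given by the matrices $d_{i+1}$. $\mathcal T=A^\nu\otimes_{A^e}\mathcal F$ is $A\leftarrow A^3\leftarrow A^4\leftarrow A^4\leftarrow\cdots$. A comparison map $\eta$ from $\mathcal F$ to the normalized bar resolution $A\otimes\bar A^{\otimes\bullet}\otimes A$ is given in degrees $\le2$ on the standard basis vectors by $\eta_0\colon e\mapsto1[\,]1$; $\eta_1\colon e_1,e_2,e_3\mapsto1[x]1,1[y]1,1[z]1$;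 $\eta_2\colon e_1\mapsto1[y,x]1-1[p_1,z]p_2$, $e_2\mapsto1[x,y]1-1[\widetilde{p_1},\widetilde z]\widetilde{p_2}$, $e_3\mapsto q[z,x]1-1[x,z]1$, $e_4\mapsto1[z,y]1-q[y,z]1$. It induces isomorphisms $\mathrm{HH}^i(A)\cong H^i(\mathcal S)$ (through which classes in $\mathrm{HH}^i(A)$ are represented by cocycles of $\mathcal S$) and $H_i(\mathcal T)\cong H_i(A,A^\nu)$. Duality and $\Delta$. The Van den Bergh duality $H^i(\mathcal S)\cong H_{2-i}(\mathcal T)$ is induced by the quasi-isomorphism $g$ with components (column vectors) $$g^0=\begin{bmatrix}1\otimes\beta\\ -q^{-1}\otimes\widetilde\beta\\ q^{-1}\otimes\alpha y\\ 0\end{bmatrix},\quad g^1=\begin{bmatrix}0&-q^{-1}\otimes\widetilde\beta&-q^{-1}\otimes\alpha y\\ 1\otimes\beta&0&0\\ 1\otimes\alpha y&0&q\widetilde{p_1}\otimes\widetilde{\beta p_2'}-p_1\otimes\beta p_2'\end{bmatrix},$$ $$g^2=\begin{bmatrix}-1\otimes\beta&q^{-1}\otimes\widetilde\beta&-q^{-1}\otimes\alpha y&0\end{bmatrix}.$$ Let $D\colon\mathrm{HH}^i(A)\cong H^i(\mathcal S)\cong H_{2-i}(\mathcal T)\cong H_{2-i}(A,A^\nu)$ be the composite isomorphism. The BV operator is $\Delta=D^{-1}\circ\mathsf B\circ D\colon\mathrm{HH}^i(A)\to\mathrm{HH}^{i-1}(A)$. A BV algebra is a graded commutative associative algebra with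 an operator $\Delta$ of degree $-1$ and order two with $\Delta^2=0$; $(\mathrm{HH}^*(A),\smile,\Delta)$ is one by a theorem of Kowalzig and Krähmer. *)

theory Defs
  imports
    "HOL-Algebra.QuotRing"
    "HOL-Algebra.Module"
    "HOL-Library.Poly_Mapping"
    "HOL-Computational_Algebra.Polynomial"
begin

section \<open>Algebras over a field\<close>

text \<open>
  A possibly noncommutative \<open>k\<close>-algebra is a record of type \<open>('k, 'a) module\<close>; the field \<open>k\<close> itself
  is the type \<open>'k\<close>.
\<close>

definition field_ring :: "'k::field ring" where
  "field_ring = \<lparr>carrier = UNIV, monoid.mult = (*), one = 1, zero = 0, add = (+)\<rparr>"

definition assoc_algebra :: "('k::field, 'a) module \<Rightarrow> bool" where
  "assoc_algebra M \<longleftrightarrow> ring M \<and> Module.module field_ring M \<and>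
     (\<forall>c. \<forall>x\<in>carrier M. \<forall>y\<in>carrier M.
        (c \<odot>\<^bsub>M\<^esub> x) \<otimes>\<^bsub>M\<^esub> y = c \<odot>\<^bsub>M\<^esub> (x \<otimes>\<^bsub>M\<^esub> y) \<and> x \<otimes>\<^bsub>M\<^esub> (c \<odot>\<^bsub>M\<^esub> y) = c \<odot>\<^bsub>M\<^esub> (x \<otimes>\<^bsub>M\<^esub> y))"

definition quot_alg :: "('k, 'a) module \<Rightarrow> 'a set \<Rightarrow> ('k, 'a set) module" where
  "quot_alg M I = \<lparr>carrier = carrier (M Quot I), monoid.mult = monoid.mult (M Quot I), one = one (M Quot I),
     zero = zero (M Quot I), add = add (M Quot I),
     module.smult = (\<lambda>c h. \<Union>f\<in>h. I +>\<^bsub>M\<^esub> (c \<odot>\<^bsub>M\<^esub> f))\<rparr>"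

definition lsum :: "('k, 'a) module \<Rightarrow> 'a list \<Rightarrow> 'a" where
  "lsum M as = foldr (add M) as \<zero>\<^bsub>M\<^esub>"

text \<open>The list \<open>vs\<close> (as a family) is a \<open>k\<close>-basis of \<open>M\<close>.\<close>

definition k_basis :: "('k::field, 'a) module \<Rightarrow> 'a list \<Rightarrow> bool" where
  "k_basis M vs \<longleftrightarrow> set vs \<subseteq> carrier M \<and>
     (\<forall>h\<in>carrier M. \<exists>a :: nat \<Rightarrow> 'k. h = (\<Oplus>\<^bsub>M\<^esub>i\<in>{..<length vs}. a i \<odot>\<^bsub>M\<^esub> (vs ! i))) \<and>
     (\<forall>a :: nat \<Rightarrow> 'k. (\<Oplus>\<^bsub>M\<^esub>i\<in>{..<length vs}. a i \<odot>\<^bsub>M\<^esub> (vs ! i)) = \<zero>\<^bsub>M\<^esub> \<longrightarrow> (\<forall>i<length vs. a i = 0))"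


section \<open>Batalin--Vilkovisky algebras\<close>

definition graded_algebra :: "('k::field, 'm) module \<Rightarrow> (nat \<Rightarrow> 'm set) \<Rightarrow> bool" where
  "graded_algebra M G \<longleftrightarrow> assoc_algebra M \<and>
     (\<forall>n. G n \<subseteq> carrier M \<and> \<zero>\<^bsub>M\<^esub> \<in> G n \<and>
        (\<forall>x\<in>G n. \<forall>y\<in>G n. x \<oplus>\<^bsub>M\<^esub> y \<in> G n) \<and> (\<forall>c. \<forall>x\<in>G n. c \<odot>\<^bsub>M\<^esub> x \<in> G n)) \<and>
     (\<forall>h\<in>carrier M. \<exists>!e :: nat \<Rightarrow> 'm. (\<forall>n. e n \<in> G n) \<and> finite {n. e n \<noteq> \<zero>\<^bsub>M\<^esub>} \<and>
        h = (\<Oplus>\<^bsub>M\<^esub>n\<in>{n. e n \<noteq> \<zero>\<^bsub>M\<^esub>}. e n)) \<and>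
     \<one>\<^bsub>M\<^esub> \<in> G 0 \<and> (\<forall>m n. \<forall>x\<in>G m. \<forall>y\<in>G n. x \<otimes>\<^bsub>M\<^esub> y \<in> G (m + n))"

text \<open>
  Concentrated in nonnegative degrees, so degree \<open>-1\<close> of \<open>Delta\<close> means in particular that it kills
  \<open>G 0\<close>. The last clause is the seven-term identity, i.e. \<open>Delta\<close> has order (at most) two.
\<close>

definition BV_algebra ::
    "('k::field, 'm) module \<Rightarrow> (nat \<Rightarrow> 'm set) \<Rightarrow> ('m \<Rightarrow> 'm) \<Rightarrow> bool" where
  "BV_algebra M G Delta \<longleftrightarrow> graded_algebra M G \<and>
     (\<forall>m n. \<forall>x\<in>G m. \<forall>y\<in>G n. x \<otimes>\<^bsub>M\<^esub> y = ((-1) ^ (m * n)) \<odot>\<^bsub>M\<^esub> (y \<otimes>\<^bsub>M\<^esub> x)) \<and>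
     (\<forall>x\<in>carrier M. \<forall>y\<in>carrier M. Delta (x \<oplus>\<^bsub>M\<^esub> y) = Delta x \<oplus>\<^bsub>M\<^esub> Delta y) \<and>
     (\<forall>c. \<forall>x\<in>carrier M. Delta (c \<odot>\<^bsub>M\<^esub> x) = c \<odot>\<^bsub>M\<^esub> Delta x) \<and>
     (\<forall>x\<in>G 0. Delta x = \<zero>\<^bsub>M\<^esub>) \<and> (\<forall>n. \<forall>x\<in>G (Suc n). Delta x \<in> G n) \<and>
     (\<forall>x\<in>carrier M. Delta (Delta x) = \<zero>\<^bsub>M\<^esub>) \<and>
     (\<forall>l m. \<forall>a\<in>G l. \<forall>b\<in>G m. \<forall>c\<in>carrier M.
        Delta (a \<otimes>\<^bsub>M\<^esub> b \<otimes>\<^bsub>M\<^esub> c) =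
          Delta (a \<otimes>\<^bsub>M\<^esub> b) \<otimes>\<^bsub>M\<^esub> c
          \<oplus>\<^bsub>M\<^esub> ((-1) ^ l) \<odot>\<^bsub>M\<^esub> (a \<otimes>\<^bsub>M\<^esub> Delta (b \<otimes>\<^bsub>M\<^esub> c))
          \<oplus>\<^bsub>M\<^esub> ((-1) ^ ((l + 1) * m)) \<odot>\<^bsub>M\<^esub> (b \<otimes>\<^bsub>M\<^esub> Delta (a \<otimes>\<^bsub>M\<^esub> c))
          \<ominus>\<^bsub>M\<^esub> Delta a \<otimes>\<^bsub>M\<^esub> b \<otimes>\<^bsub>M\<^esub> c
          \<ominus>\<^bsub>M\<^esub> ((-1) ^ l) \<odot>\<^bsub>M\<^esub> (a \<otimes>\<^bsub>M\<^esub> Delta b \<otimes>\<^bsub>M\<^esub> c)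
          \<ominus>\<^bsub>M\<^esub> ((-1) ^ (l + m)) \<odot>\<^bsub>M\<^esub> (a \<otimes>\<^bsub>M\<^esub> b \<otimes>\<^bsub>M\<^esub> Delta c))"


section \<open>Hochschild cohomology\<close>

definition contract :: "('k, 'a) module \<Rightarrow> nat \<Rightarrow> 'a list \<Rightarrow> 'a list" where
  "contract A i as = take (i - 1) as @ (as ! (i - 1) \<otimes>\<^bsub>A\<^esub> as ! i) # drop (i + 1) as"

text \<open>
  Normalized cochains of all degrees are packed into one function on lists, whose restriction to
  the lists of length \<open>n\<close> is the component in \<open>Hom(Abar^n, A)\<close>: it is multilinear and vanishes
  as soon as one argument is \<open>1\<close>. Only finitely many components are nonzero, so this is the direct
  sum of the \<open>C^n(A,A)\<close>.
\<close>

definition total_cochains :: "('k::field, 'a) module \<Rightarrow> ('a list \<Rightarrow> 'a) set" where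
  "total_cochains A = {f \<in> lists (carrier A) \<rightarrow>\<^sub>E carrier A.
     (\<forall>as\<in>lists (carrier A). \<forall>bs\<in>lists (carrier A). \<forall>a\<in>carrier A. \<forall>b\<in>carrier A. \<forall>c.
        f (as @ (a \<oplus>\<^bsub>A\<^esub> b) # bs) = f (as @ a # bs) \<oplus>\<^bsub>A\<^esub> f (as @ b # bs) \<and>
        f (as @ (c \<odot>\<^bsub>A\<^esub> a) # bs) = c \<odot>\<^bsub>A\<^esub> f (as @ a # bs) \<and>
        f (as @ \<one>\<^bsub>A\<^esub> # bs) = \<zero>\<^bsub>A\<^esub>) \<and>
     (\<exists>N. \<forall>as\<in>lists (carrier A). N \<le> length as \<longrightarrow> f as = \<zero>\<^bsub>A\<^esub>)}"

text \<open>The multiplication is the cup product.\<close>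

definition HC :: "('k::field, 'a) module \<Rightarrow> ('k, 'a list \<Rightarrow> 'a) module" where
  "HC A = \<lparr>carrier = total_cochains A,
     monoid.mult = (\<lambda>f g. \<lambda>as\<in>lists (carrier A). \<Oplus>\<^bsub>A\<^esub>i\<in>{0..length as}.
       ((-1) ^ (i * (length as - i))) \<odot>\<^bsub>A\<^esub> (f (take i as) \<otimes>\<^bsub>A\<^esub> g (drop i as))),
     one = (\<lambda>as\<in>lists (carrier A). if as = [] then \<one>\<^bsub>A\<^esub> else \<zero>\<^bsub>A\<^esub>),
     zero = (\<lambda>as\<in>lists (carrier A). \<zero>\<^bsub>A\<^esub>),
     add = (\<lambda>f g. \<lambda>as\<in>lists (carrier A). f as \<oplus>\<^bsub>A\<^esub> g as),
     module.smult = (\<lambda>c f. \<lambda>as\<in>lists (carrier A). c \<odot>\<^bsub>A\<^esub> f as)\<rparr>"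

definition HC_deg :: "('k::field, 'a) module \<Rightarrow> nat \<Rightarrow> ('a list \<Rightarrow> 'a) set" where
  "HC_deg A n = {f \<in> total_cochains A. \<forall>as\<in>lists (carrier A). length as \<noteq> n \<longrightarrow> f as = \<zero>\<^bsub>A\<^esub>}"

definition HC_proj :: "('k::field, 'a) module \<Rightarrow> nat \<Rightarrow> ('a list \<Rightarrow> 'a) \<Rightarrow> 'a list \<Rightarrow> 'a" where
  "HC_proj A n f = (\<lambda>as\<in>lists (carrier A). if length as = n then f as else \<zero>\<^bsub>A\<^esub>)"

definition hdelta :: "('k::field, 'a) module \<Rightarrow> ('a list \<Rightarrow> 'a) \<Rightarrow> 'a list \<Rightarrow> 'a" where
  "hdelta A f = (\<lambda>as\<in>lists (carrier A). if as = [] then \<zero>\<^bsub>A\<^esub> else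
     hd as \<otimes>\<^bsub>A\<^esub> f (tl as)
     \<oplus>\<^bsub>A\<^esub> (\<Oplus>\<^bsub>A\<^esub>i\<in>{1..<length as}. ((-1) ^ i) \<odot>\<^bsub>A\<^esub> f (contract A i as))
     \<oplus>\<^bsub>A\<^esub> ((-1) ^ length as) \<odot>\<^bsub>A\<^esub> (f (butlast as) \<otimes>\<^bsub>A\<^esub> last as))"

definition HZ :: "('k::field, 'a) module \<Rightarrow> ('a list \<Rightarrow> 'a) set" where
  "HZ A = {f \<in> total_cochains A. hdelta A f = \<zero>\<^bsub>HC A\<^esub>}"

definition HB :: "('k::field, 'a) module \<Rightarrow> ('a list \<Rightarrow> 'a) set" where
  "HB A = hdelta A ` total_cochains A"

definition HH :: "('k::field, 'a) module \<Rightarrow> ('k, ('a list \<Rightarrow> 'a) set) module" where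
  "HH A = quot_alg ((HC A)\<lparr>carrier := HZ A\<rparr>) (HB A)"

definition HH_deg :: "('k::field, 'a) module \<Rightarrow> nat \<Rightarrow> ('a list \<Rightarrow> 'a) set set" where
  "HH_deg A n = (\<lambda>f. HB A +>\<^bsub>HC A\<^esub> f) ` (HZ A \<inter> HC_deg A n)"

definition HH_comp ::
    "('k::field, 'a) module \<Rightarrow> nat \<Rightarrow> ('a list \<Rightarrow> 'a) set \<Rightarrow> ('a list \<Rightarrow> 'a) set" where
  "HH_comp A n h = (\<Union>f\<in>h. HB A +>\<^bsub>HC A\<^esub> HC_proj A n f)"


section \<open>Twisted Hochschild homology and the Connes operator\<close>

text \<open>
  A chain \<open>m[a1,...,an]\<close> is written as the list \<open>[m,a1,...,an]\<close>. The tensor product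
  \<open>A (x) Abar^n\<close> is the space of formal linear combinations of such lists modulo \<open>tensor_rels\<close>;
  chains are represented by formal combinations, so the relations are added to the boundaries.
\<close>

inductive_set tensor_rels :: "('k::field, 'a) module \<Rightarrow> ('a list \<Rightarrow>\<^sub>0 'k) set"
  for A :: "('k::field, 'a) module" where
  zero: "0 \<in> tensor_rels A"
| add: "r \<in> tensor_rels A \<Longrightarrow> s \<in> tensor_rels A \<Longrightarrow> r + s \<in> tensor_rels A"
| additive: "as \<in> lists (carrier A) \<Longrightarrow> bs \<in> lists (carrier A) \<Longrightarrow> a \<in> carrier A \<Longrightarrow> b \<in> carrier A \<Longrightarrow>
    Poly_Mapping.single (as @ (a \<oplus>\<^bsub>A\<^esub> b) # bs) c
      - Poly_Mapping.single (as @ a # bs) c - Poly_Mapping.single (as @ b # bs) c \<in> tensor_rels A"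
| scalar: "as \<in> lists (carrier A) \<Longrightarrow> bs \<in> lists (carrier A) \<Longrightarrow> a \<in> carrier A \<Longrightarrow>
    Poly_Mapping.single (as @ (e \<odot>\<^bsub>A\<^esub> a) # bs) c - Poly_Mapping.single (as @ a # bs) (c * e)
      \<in> tensor_rels A"
| normalized: "as \<in> lists (carrier A) \<Longrightarrow> bs \<in> lists (carrier A) \<Longrightarrow> as \<noteq> [] \<Longrightarrow>
    Poly_Mapping.single (as @ \<one>\<^bsub>A\<^esub> # bs) c \<in> tensor_rels A"

definition hchains :: "('k::field, 'a) module \<Rightarrow> nat \<Rightarrow> ('a list \<Rightarrow>\<^sub>0 'k) set" where
  "hchains A n = {c. \<forall>as\<in>Poly_Mapping.keys c. length as = Suc n \<and> set as \<subseteq> carrier A}"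

definition lin_ext :: "('a list \<Rightarrow> ('a list \<Rightarrow>\<^sub>0 'k)) \<Rightarrow> ('a list \<Rightarrow>\<^sub>0 'k) \<Rightarrow> ('a list \<Rightarrow>\<^sub>0 'k::field)" where
  "lin_ext F c = (\<Sum>as\<in>Poly_Mapping.keys c.
     Poly_Mapping.map ((*) (Poly_Mapping.lookup c as)) (F as))"

definition hbd_basis :: "('k::field, 'a) module \<Rightarrow> ('a \<Rightarrow> 'a) \<Rightarrow> 'a list \<Rightarrow> ('a list \<Rightarrow>\<^sub>0 'k)" where
  "hbd_basis A nu l = (let m = hd l; as = tl l in if as = [] then 0 else
     Poly_Mapping.single ((m \<otimes>\<^bsub>A\<^esub> nu (hd as)) # tl as) 1
     + (\<Sum>i\<in>{1..<length as}. Poly_Mapping.single (m # contract A i as) ((-1) ^ i))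
     + Poly_Mapping.single ((last as \<otimes>\<^bsub>A\<^esub> m) # butlast as) ((-1) ^ length as))"

definition hbd :: "('k::field, 'a) module \<Rightarrow> ('a \<Rightarrow> 'a) \<Rightarrow> ('a list \<Rightarrow>\<^sub>0 'k) \<Rightarrow> ('a list \<Rightarrow>\<^sub>0 'k)" where
  "hbd A nu = lin_ext (hbd_basis A nu)"

definition tw_bounds :: "('k::field, 'a) module \<Rightarrow> ('a \<Rightarrow> 'a) \<Rightarrow> nat \<Rightarrow> ('a list \<Rightarrow>\<^sub>0 'k) set" where
  "tw_bounds A nu n =
     {hbd A nu c + r | c r. c \<in> hchains A (Suc n) \<and> r \<in> tensor_rels A \<inter> hchains A n}"

text \<open>The class in \<open>H_n(A, A^nu)\<close> of a cycle \<open>c\<close>.\<close>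

definition tw_class ::
    "('k::field, 'a) module \<Rightarrow> ('a \<Rightarrow> 'a) \<Rightarrow> nat \<Rightarrow> ('a list \<Rightarrow>\<^sub>0 'k) \<Rightarrow> ('a list \<Rightarrow>\<^sub>0 'k) set" where
  "tw_class A nu n c = (\<lambda>b. c + b) ` tw_bounds A nu n"

text \<open>
  \<open>G d\<close> is the homogeneous part of \<open>A\<close> of degree \<open>d\<close>; the following are the chains of total degree \<open>0\<close>.
\<close>

definition deg0_chains ::
    "('k::field, 'a) module \<Rightarrow> (int \<Rightarrow> 'a set) \<Rightarrow> nat \<Rightarrow> ('a list \<Rightarrow>\<^sub>0 'k) set" where
  "deg0_chains A G n = {c \<in> hchains A n. \<forall>as\<in>Poly_Mapping.keys c.
     \<exists>ds. list_all2 (\<lambda>a d. a \<in> G d) as ds \<and> sum_list ds = 0}"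

definition connes_basis :: "('k::field, 'a) module \<Rightarrow> ('a \<Rightarrow> 'a) \<Rightarrow> 'a list \<Rightarrow> ('a list \<Rightarrow>\<^sub>0 'k)" where
  "connes_basis A nu l = (let m = hd l; as = tl l; n = length as in
     Poly_Mapping.single (\<one>\<^bsub>A\<^esub> # m # map nu as) 1
     + (\<Sum>i\<in>{1..n}. Poly_Mapping.single
          (\<one>\<^bsub>A\<^esub> # drop (i - 1) as @ m # map nu (take (i - 1) as)) ((-1) ^ (i * n))))"

text \<open>
  The induced map on homology: evaluate on the representatives lying in the subcomplex of total
  degree \<open>0\<close>. Here and below, a map on classes is written as a union over representatives, all of
  which contribute the same class.
\<close>

definition connes :: "('k::field, 'a) module \<Rightarrow> ('a \<Rightarrow> 'a) \<Rightarrow> (int \<Rightarrow> 'a set) \<Rightarrow> nat \<Rightarrow>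
    ('a list \<Rightarrow>\<^sub>0 'k) set \<Rightarrow> ('a list \<Rightarrow>\<^sub>0 'k) set" where
  "connes A nu G n h =
     (\<Union>c\<in>h \<inter> deg0_chains A G n. tw_class A nu (Suc n) (lin_ext (connes_basis A nu) c))"


section \<open>The generalized Weyl algebra\<close>

datatype gen = GX | GY | GZ

datatype word = Word (letters: "gen list")

instantiation word :: monoid_add
begin

definition zero_word :: word where
  "zero_word = Word []"

definition plus_word :: "word \<Rightarrow> word \<Rightarrow> word" where
  "plus_word v w = Word (letters v @ letters w)"

instance
  by standard (simp_all add: zero_word_def plus_word_def)

end

text \<open>
  With concatenation of words as addition, the convolution product on \<open>word \<Rightarrow>\<^sub>0 'k\<close> is the
  multiplication of the free algebra on the three letters.
\<close>

definition free_alg :: "('k::field, word \<Rightarrow>\<^sub>0 'k) module" where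
  "free_alg = \<lparr>carrier = UNIV, monoid.mult = (*), one = 1, zero = 0, add = (+),
     module.smult = (\<lambda>c f. Poly_Mapping.single 0 c * f)\<rparr>"

definition fgen :: "gen \<Rightarrow> (word \<Rightarrow>\<^sub>0 'k::field)" where
  "fgen g = Poly_Mapping.single (Word [g]) 1"

definition fpoly :: "'k::field poly \<Rightarrow> (word \<Rightarrow>\<^sub>0 'k)" where
  "fpoly f = (\<Sum>i\<le>degree f. Poly_Mapping.single (Word (replicate i GZ)) (coeff f i))"

fun gen_deg :: "gen \<Rightarrow> int" where
  "gen_deg GX = 1"
| "gen_deg GY = -1"
| "gen_deg GZ = 0"

definition word_deg :: "word \<Rightarrow> int" where
  "word_deg w = sum_list (map gen_deg (letters w))"

definition sigma :: "'k::field \<Rightarrow> 'k poly \<Rightarrow> 'k poly" where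
  "sigma q f = pcompose f [:0, q:]"

text \<open>The elements \<open>p1\<close>, \<open>p2\<close> in \<open>d(p) = p1 (x) p2\<close>, as a list of pairs.\<close>

definition dd :: "'k::field poly \<Rightarrow> ('k poly \<times> 'k poly) list" where
  "dd f = [(monom (coeff f i) (i - j), monom 1 (j - 1)). i \<leftarrow> [1..<Suc (degree f)], j \<leftarrow> [1..<Suc i]]"

context
  fixes q :: "'k::field" and p :: "'k poly"
begin

definition gwa_ideal :: "(word \<Rightarrow>\<^sub>0 'k) set" where
  "gwa_ideal = genideal free_alg
     {fgen GX * fgen GZ - Poly_Mapping.single 0 q * fgen GZ * fgen GX,
      fgen GY * fgen GZ - Poly_Mapping.single 0 (inverse q) * fgen GZ * fgen GY,
      fgen GY * fgen GX - fpoly p,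
      fgen GX * fgen GY - fpoly (sigma q p)}"

definition gwa :: "('k, (word \<Rightarrow>\<^sub>0 'k) set) module" where
  "gwa = quot_alg free_alg gwa_ideal"

definition gcls :: "(word \<Rightarrow>\<^sub>0 'k) \<Rightarrow> (word \<Rightarrow>\<^sub>0 'k) set" where
  "gcls f = gwa_ideal +>\<^bsub>free_alg\<^esub> f"

definition gx :: "(word \<Rightarrow>\<^sub>0 'k) set" where "gx = gcls (fgen GX)"
definition gy :: "(word \<Rightarrow>\<^sub>0 'k) set" where "gy = gcls (fgen GY)"
definition gz :: "(word \<Rightarrow>\<^sub>0 'k) set" where "gz = gcls (fgen GZ)"

definition gpoly :: "'k poly \<Rightarrow> (word \<Rightarrow>\<^sub>0 'k) set" where
  "gpoly f = gcls (fpoly f)"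

definition gscal :: "'k \<Rightarrow> (word \<Rightarrow>\<^sub>0 'k) set" where
  "gscal c = c \<odot>\<^bsub>gwa\<^esub> \<one>\<^bsub>gwa\<^esub>"

definition gwa_deg :: "int \<Rightarrow> (word \<Rightarrow>\<^sub>0 'k) set set" where
  "gwa_deg d = gcls ` {f. \<forall>w\<in>Poly_Mapping.keys f. word_deg w = d}"

definition gnu :: "(word \<Rightarrow>\<^sub>0 'k) set \<Rightarrow> (word \<Rightarrow>\<^sub>0 'k) set" where
  "gnu = (THE f. f \<in> ring_hom gwa gwa \<inter> extensional (carrier gwa) \<and> bij_betw f (carrier gwa) (carrier gwa) \<and>
     (\<forall>c. \<forall>a\<in>carrier gwa. f (c \<odot>\<^bsub>gwa\<^esub> a) = c \<odot>\<^bsub>gwa\<^esub> f a) \<and>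
     f gx = q \<odot>\<^bsub>gwa\<^esub> gx \<and> f gy = inverse q \<odot>\<^bsub>gwa\<^esub> gy \<and> f gz = gz)"


subsection \<open>The small complexes\<close>

text \<open>
  An element of \<open>A^e\<close> is a list of pairs \<open>(a, b)\<close>, standing for the sum of the \<open>a (x) b\<close>. It acts on
  the left of the bimodule \<open>A\<close> by \<open>act\<close>, and on the right of \<open>A^nu\<close> by \<open>ract\<close>, namely
  \<open>m (a (x) b) = b m nu(a)\<close>.
\<close>

definition act where
  "act t m = lsum gwa (map (\<lambda>(a, b). a \<otimes>\<^bsub>gwa\<^esub> m \<otimes>\<^bsub>gwa\<^esub> b) t)"

definition ract where
  "ract t m = lsum gwa (map (\<lambda>(a, b). b \<otimes>\<^bsub>gwa\<^esub> m \<otimes>\<^bsub>gwa\<^esub> gnu a) t)"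

definition mat_act where
  "mat_act M v = map (\<lambda>row. lsum gwa (map2 act row v)) M"

definition Frank :: "nat \<Rightarrow> nat" where
  "Frank n = (if n = 0 then 1 else if n = 1 then 3 else 4)"

definition Fmat where
  "Fmat (n::nat) = (let x = gx; y = gy; z = gz; zt = gpoly [:0, q:]; e = gscal 1; s = sigma q;
       neg = (\<lambda>a. \<ominus>\<^bsub>gwa\<^esub> a);
       D = (\<lambda>c u v. map (\<lambda>(f, g). (gpoly ([:c:] * u f), gpoly (v g))) (dd p)) in
     if n = 1 then
       [[[(x, e), (neg e, x)]],
        [[(y, e), (neg e, y)]],
        [[(z, e), (neg e, z)]]]
     else if n = 2 then
       [[[(y, e)], [(e, x)], D (-1) id id],
        [[(e, y)], [(x, e)], D (-q) s s],
        [[(zt, e), (neg e, z)], [], [(gscal q, x), (neg x, e)]],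
        [[], [(z, e), (neg e, zt)], [(e, y), (neg y, gscal q)]]]
     else if odd n then
       [[[(x, e)], [(neg e, x)], D (-1) s id, []],
        [[(neg e, y)], [(y, e)], [], D (-1) id s],
        [[(z, e), (neg e, z)], [], [(neg y, e)], [(neg e, x)]],
        [[], [(zt, e), (neg e, zt)], [(neg e, y)], [(neg x, e)]]]
     else
       [[[(y, e)], [(e, x)], D (-1) id id, []],
        [[(e, y)], [(x, e)], [], D (-1) s s],
        [[(zt, e), (neg e, z)], [], [(neg x, e)], [(e, x)]],
        [[], [(z, e), (neg e, zt)], [(e, y)], [(neg y, e)]]])"

definition vecs where
  "vecs n = {v. length v = Frank n \<and> set v \<subseteq> carrier gwa}"

definition vzero where
  "vzero n = replicate (Frank n) \<zero>\<^bsub>gwa\<^esub>"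

definition S_d where
  "S_d n v = mat_act (Fmat (n + 1)) v"

definition S_bounds where
  "S_bounds n = (if n = 0 then {vzero 0} else S_d (n - 1) ` vecs (n - 1))"

definition S_class where
  "S_class n v = (\<lambda>b. map2 (add gwa) v b) ` S_bounds n"

text \<open>The differential from degree \<open>n\<close> to degree \<open>n - 1\<close> of the complex \<open>T\<close>, for \<open>n > 0\<close>.\<close>

definition T_d where
  "T_d n w = map (\<lambda>k. lsum gwa (map2 (\<lambda>row m. ract (row ! k) m) (Fmat n) w)) [0..<Frank (n - 1)]"

definition T_class where
  "T_class n w = (\<lambda>b. map2 (add gwa) w b) ` (T_d (n + 1) ` vecs (n + 1))"

text \<open>
  The images of the standard basis vectors under the comparison map, a triple \<open>(a, bs, b)\<close>
  standing for \<open>a[bs]b\<close>. Only degrees up to 2 are used.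
\<close>

definition eta where
  "eta n = (let x = gx; y = gy; z = gz; zt = gpoly [:0, q:]; e = gscal 1; s = sigma q in
     if n = (0::nat) then [[(e, [], e)]]
     else if n = 1 then [[(e, [x], e)], [(e, [y], e)], [(e, [z], e)]]
     else if n = 2 then
       [(e, [y, x], e) # map (\<lambda>(f, g). (gscal (-1), [gpoly f, z], gpoly g)) (dd p),
        (e, [x, y], e) # map (\<lambda>(f, g). (gscal (-1), [gpoly (s f), zt], gpoly (s g))) (dd p),
        [(gscal q, [z, x], e), (gscal (-1), [x, z], e)],
        [(e, [z, y], e), (gscal (-q), [y, z], e)]]
     else [])"

definition eta_cochain where
  "eta_cochain n f = map (\<lambda>ts. lsum gwa (map (\<lambda>(a, bs, b). a \<otimes>\<^bsub>gwa\<^esub> f bs \<otimes>\<^bsub>gwa\<^esub> b) ts)) (eta n)"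

definition eta_chain :: "nat \<Rightarrow> (word \<Rightarrow>\<^sub>0 'k) set list \<Rightarrow> ((word \<Rightarrow>\<^sub>0 'k) set list \<Rightarrow>\<^sub>0 'k)" where
  "eta_chain n w = sum_list (map2 (\<lambda>ts m. sum_list (map (\<lambda>(a, bs, b).
     Poly_Mapping.single ((b \<otimes>\<^bsub>gwa\<^esub> m \<otimes>\<^bsub>gwa\<^esub> gnu a) # bs) 1) ts)) (eta n) w)"

text \<open>The isomorphism \<open>HH^n(A) \<rightarrow> H^n(S)\<close> for \<open>n \<le> 2\<close>, and the class in \<open>HH^n(A)\<close> represented by
  a cocycle \<open>v\<close> of \<open>S\<close>.\<close>

definition HH_to_S where
  "HH_to_S n h = (\<Union>f\<in>h \<inter> HC_deg gwa n. S_class n (eta_cochain n f))"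

definition HH_class where
  "HH_class n v = inv_into (HH_deg gwa n) (HH_to_S n) (S_class n v)"


subsection \<open>Duality and the BV operator\<close>

context
  fixes \<alpha> \<beta> :: "'k poly"
begin

definition gmat where
  "gmat n = (let y = gy; e = gscal 1; s = sigma q; i = inverse q; ay = gpoly \<alpha> \<otimes>\<^bsub>gwa\<^esub> y in
     if n = (0::nat) then
       [[[(e, gpoly \<beta>)]],
        [[(gscal (-i), gpoly (s \<beta>))]],
        [[(gscal i, ay)]],
        [[]]]
     else if n = 1 then
       [[[], [(gscal (-i), gpoly (s \<beta>))], [(gscal (-i), ay)]],
        [[(e, gpoly \<beta>)], [], []],
        [[(e, ay)], [],
          map (\<lambda>(f, g). (gpoly ([:q:] * s f), gpoly (s (\<beta> * pderiv g)))) (dd p)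
          @ map (\<lambda>(f, g). (gpoly (- f), gpoly (\<beta> * pderiv g))) (dd p)]]
     else
       [[[(gscal (-1), gpoly \<beta>)], [(gscal i, gpoly (s \<beta>))], [(gscal (-i), ay)], []]])"

definition S_to_T where
  "S_to_T n h = (\<Union>v\<in>h. T_class (2 - n) (mat_act (gmat n) v))"

definition T_to_tw where
  "T_to_tw n h = (\<Union>w\<in>h. tw_class gwa gnu n (eta_chain n w))"

text \<open>\<open>D : HH^n(A) \<rightarrow> H_(2-n)(A, A^nu)\<close>, for \<open>n \<le> 2\<close>.\<close>

definition vdb where
  "vdb n h = T_to_tw (2 - n) (S_to_T n (HH_to_S n h))"

text \<open>\<open>Delta = D^-1 B D\<close> on \<open>HH^n(A)\<close>, for \<open>n = 1, 2\<close>.\<close>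

definition BV_Delta_deg where
  "BV_Delta_deg n h =
     inv_into (HH_deg gwa (n - 1)) (vdb (n - 1)) (connes gwa gnu gwa_deg (2 - n) (vdb n h))"

text \<open>
  On \<open>HH^0(A)\<close> the operator is zero since \<open>HH^(-1)(A) = 0\<close>, and on \<open>HH^n(A)\<close>, \<open>n > 2\<close>, it is
  zero since \<open>D\<close> then takes values in \<open>H_(2-n)(A, A^nu) = 0\<close>.
\<close>

definition BV_Delta where
  "BV_Delta h = (\<Oplus>\<^bsub>HH gwa\<^esub>n\<in>{1, 2}. BV_Delta_deg n (HH_comp gwa n h))"

end

end

end

theory Submission
  imports Defs "HOL-Library.Product_Plus"
begin

text \<open>
  Since \<open>y x = p = c z\<close>, the algebra is the quantum plane \<open>x y = q y x\<close> with basis \<open>y\<^sup>i x\<^sup>j\<close> and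
  \<open>z = c\<^sup>-\<^sup>1 y x\<close>.

  A cochain is a function of its first argument with values in a bimodule of cochains, and a cocycle
  is determined by its values on lists starting with \<open>x\<close> or \<open>y\<close>. Hence a primitive can be built
  recursively along the monomials, and the relation \<open>x y = q y x\<close> leaves a single equation
  \<open>r = a y + x b - q (y a + b x)\<close> to be solved. In degrees \<open>> 2\<close> it always has a solution. In degree \<open>2\<close>
  the obstruction consists of the coefficients of \<open>1\<close> and \<open>y x\<close> in \<open>r\<close>, as \<open>q\<close> is not a root of unity; in
  degree \<open>1\<close> a derivation is inner up to the coefficients of \<open>x\<close> and \<open>y\<close> in its values at \<open>x\<close> and \<open>y\<close>.
  These numbers are coordinates on the cohomology, in which the cup product can be read off.

  For the operator, the choice of \<open>\<alpha>\<close> and \<open>\<beta>\<close> only changes the dual chains by boundaries. With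
  \<open>\<alpha> = 0\<close> they are short enough to apply \<open>B\<close> by hand; for instance \<open>v\<close> is dual to \<open>z\<close>, and
  \<open>1[z]\<close> is homologous to the dual of \<open>s\<close>. The duality is injective in degrees \<open>0\<close> and \<open>1\<close> because the
  coefficient of \<open>y x\<close> is a \<open>\<nu>\<close>-twisted trace, which pairs nontrivially with the chains in question.
\<close>

section \<open>The normalized Hochschild complex of an algebra\<close>

text \<open>Every map in the statement is a union over representatives or an
  \<open>inv_into\<close>, on records whose elements are cosets. So maps are inverted by exhibiting
  a preimage and testing injectivity with numbers that vanish on boundaries: \<open>psi\<close> in
  cohomology, twisted traces in homology. As \<open>psi\<close> is a surjective homomorphism from
  the cocycles onto an explicit algebra \<open>k^5\<close> with the coboundaries as kernel, the
  claims on products reduce to arithmetic with quintuples. That five coordinates survive is a matter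
  of resonances. Up to a shift, commutators with \<open>x\<close> and \<open>y\<close> multiply the
  coefficient of \<open>y^i x^j\<close> by \<open>q^i - 1\<close> and \<open>1 - q^j\<close>. In
  degree 2 the equation for the monomial \<open>y^i x^j\<close> of \<open>r\<close> has the factors
  \<open>q^j - q\<close> and \<open>q^i - q\<close>: both vanish at \<open>y x\<close>, and the
  monomial \<open>1\<close> is not reached at all. On the homology side, chains are formal
  combinations modulo an inductively generated set of relations. Membership in that set is decided
  by coordinates with respect to tensors of monomials, so that claims about chains become
  comparisons of coefficients.\<close>

locale k_algebra = vector_space scale
  for scale :: "'k::field \<Rightarrow> 'b::ab_group_add \<Rightarrow> 'b" (infixr "*s" 75) +
  fixes mul :: "'b \<Rightarrow> 'b \<Rightarrow> 'b" (infixl "\<cdot>" 70) and unit :: 'b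
  assumes mul_assoc: "a \<cdot> b \<cdot> c = a \<cdot> (b \<cdot> c)"
    and unit_mul [simp]: "unit \<cdot> a = a" and mul_unit [simp]: "a \<cdot> unit = a"
    and mul_add: "a \<cdot> (b + c) = a \<cdot> b + a \<cdot> c" and add_mul: "(a + b) \<cdot> c = a \<cdot> c + b \<cdot> c"
    and mul_scale: "a \<cdot> s *s b = s *s (a \<cdot> b)" and scale_mul: "(s *s a) \<cdot> b = s *s (a \<cdot> b)"
begin

lemma mul_0 [simp]: "a \<cdot> 0 = 0"
  using mul_add[of a 0 0] by simp

lemma zero_mul [simp]: "0 \<cdot> a = 0"
  using add_mul[of 0 0 a] by simp

lemma mul_minus: "a \<cdot> (- b) = - (a \<cdot> b)"
  using mul_scale[of a "-1" b] by simp

lemma minus_mul: "(- a) \<cdot> b = - (a \<cdot> b)"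
  using scale_mul[of "-1" a b] by simp

lemma mul_diff: "a \<cdot> (b - c) = a \<cdot> b - a \<cdot> c"
  using mul_add[of a b "-c"] by (simp add: mul_minus)

lemma diff_mul: "(a - b) \<cdot> c = a \<cdot> c - b \<cdot> c"
  using add_mul[of a "-b" c] by (simp add: minus_mul)

lemmas mul_simps = mul_add add_mul mul_diff diff_mul mul_minus minus_mul mul_scale scale_mul

lemmas scale_simps = scale_right_distrib scale_right_diff_distrib

definition mlin :: "('b list \<Rightarrow> 'b) \<Rightarrow> bool" where
  "mlin f \<longleftrightarrow> (\<forall>as bs a b c. f (as @ (a + b) # bs) = f (as @ a # bs) + f (as @ b # bs) \<and>
     f (as @ (c *s a) # bs) = c *s f (as @ a # bs) \<and> f (as @ unit # bs) = 0)"

definition vanishes_from :: "nat \<Rightarrow> ('b list \<Rightarrow> 'b) \<Rightarrow> bool" where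
  "vanishes_from N f \<longleftrightarrow> (\<forall>as. N \<le> length as \<longrightarrow> f as = 0)"

definition cochain :: "('b list \<Rightarrow> 'b) \<Rightarrow> bool" where
  "cochain f \<longleftrightarrow> mlin f \<and> (\<exists>N. vanishes_from N f)"

lemma mlinI:
  assumes "\<And>as bs a b. f (as @ (a + b) # bs) = f (as @ a # bs) + f (as @ b # bs)"
    and "\<And>as bs a c. f (as @ (c *s a) # bs) = c *s f (as @ a # bs)"
    and "\<And>as bs. f (as @ unit # bs) = 0"
  shows "mlin f"
  using assms by (simp add: mlin_def)

lemma mlinD:
  assumes "mlin f"
  shows "f (as @ (a + b) # bs) = f (as @ a # bs) + f (as @ b # bs)"
    and "f (as @ (c *s a) # bs) = c *s f (as @ a # bs)"
    and "f (as @ unit # bs) = 0"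
  using assms by (auto simp: mlin_def)

lemma mlin_hd:
  assumes "mlin f"
  shows "f ((a + b) # bs) = f (a # bs) + f (b # bs)"
    and "f ((c *s a) # bs) = c *s f (a # bs)"
    and "f (unit # bs) = 0"
    and "f (0 # bs) = 0" and "f ((- a) # bs) = - f (a # bs)" and "f ((a - b) # bs) = f (a # bs) - f (b # bs)"
proof -
  show 1: "f ((a + b) # bs) = f (a # bs) + f (b # bs)" for a b
    using mlinD(1)[OF assms, of "[]"] by simp
  show 2: "f ((c *s a) # bs) = c *s f (a # bs)" for c a
    using mlinD(2)[OF assms, of "[]"] by simp
  show "f (unit # bs) = 0"
    using mlinD(3)[OF assms, of "[]"] by simp
  show "f (0 # bs) = 0"
    using 1[of 0 0] by simp
  show 3: "f ((- a) # bs) = - f (a # bs)" for a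
    using 2[of "-1" a] by simp
  show "f ((a - b) # bs) = f (a # bs) - f (b # bs)"
    using 1[of a "-b"] by (simp add: 3)
qed

lemma mlin_snd:
  assumes "mlin f"
  shows "f (d # (a + b) # bs) = f (d # a # bs) + f (d # b # bs)"
    and "f (d # (c *s a) # bs) = c *s f (d # a # bs)"
    and "f (d # unit # bs) = 0"
  using mlinD[OF assms, of "[d]"] by simp_all

lemma mlin_tl: "mlin f \<Longrightarrow> mlin (\<lambda>bs. f (a # bs))"
  using mlinD[of f "a # _"] by (intro mlinI) simp_all

lemma mlin_zero: "mlin (\<lambda>_. 0)"
  by (intro mlinI) simp_all

lemma mlin_add: "mlin f \<Longrightarrow> mlin g \<Longrightarrow> mlin (\<lambda>bs. f bs + g bs)"
  by (intro mlinI) (simp_all add: mlinD scale_simps)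

lemma mlin_scale: "mlin f \<Longrightarrow> mlin (\<lambda>bs. s *s f bs)"
  by (intro mlinI) (simp_all add: mlinD scale_simps mult.commute)

lemma mlin_diff: "mlin f \<Longrightarrow> mlin g \<Longrightarrow> mlin (\<lambda>bs. f bs - g bs)"
  using mlin_add[of f "\<lambda>bs. -1 *s g bs"] mlin_scale[of g "-1"] by simp

lemma mlin_lmul: "mlin f \<Longrightarrow> mlin (\<lambda>bs. a \<cdot> f bs)"
  by (intro mlinI) (simp_all add: mlinD mul_simps)

text \<open>Fits functions defined by recursion on the list: linearity is checked by hand in the
  first argument only, the others being handled with the first one fixed.\<close>

lemma mlin_Cons:
  assumes "\<And>a. mlin (\<lambda>bs. f (a # bs))"
    and "\<And>a b bs. f ((a + b) # bs) = f (a # bs) + f (b # bs)"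
    and "\<And>a c bs. f ((c *s a) # bs) = c *s f (a # bs)"
    and "\<And>bs. f (unit # bs) = 0"
  shows "mlin f"
proof (rule mlinI)
  fix as bs a b c
  show "f (as @ (a + b) # bs) = f (as @ a # bs) + f (as @ b # bs)"
    by (cases as) (simp_all add: assms mlinD(1)[OF assms(1)])
  show "f (as @ (c *s a) # bs) = c *s f (as @ a # bs)"
    by (cases as) (simp_all add: assms mlinD(2)[OF assms(1)])
  show "f (as @ unit # bs) = 0"
    by (cases as) (simp_all add: assms mlinD(3)[OF assms(1)])
qed

text \<open>
  The right action of \<open>A\<close> on cochains whose left counterpart is \<open>\<lambda>bs. a \<cdot> f bs\<close>: with it a cochain
  is a function of its first argument with values in a bimodule of cochains, and the Hochschild
  differential takes the two-term form below.
\<close>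

fun ract :: "('b list \<Rightarrow> 'b) \<Rightarrow> 'b \<Rightarrow> 'b list \<Rightarrow> 'b" where
  "ract f a [] = f [] \<cdot> a"
| "ract f a (b # bs) = f ((a \<cdot> b) # bs) - ract (\<lambda>cs. f (a # cs)) b bs"

fun delta :: "('b list \<Rightarrow> 'b) \<Rightarrow> 'b list \<Rightarrow> 'b" where
  "delta f [] = 0"
| "delta f (a # bs) = a \<cdot> f bs - ract f a bs"

lemma ract_zero [simp]: "ract (\<lambda>_. 0) a bs = 0"
  by (induction "\<lambda>_::'b list. 0::'b" a bs rule: ract.induct) simp_all

lemma ract_add: "ract (\<lambda>cs. f cs + g cs) a bs = ract f a bs + ract g a bs"
proof (induction bs arbitrary: f g a)
  case (Cons b bs)
  show ?case using Cons.IH[of "\<lambda>cs. f (a # cs)" "\<lambda>cs. g (a # cs)"] by simp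
qed (simp add: mul_simps)

lemma ract_scale: "ract (\<lambda>cs. s *s f cs) a bs = s *s ract f a bs"
proof (induction bs arbitrary: f a)
  case (Cons b bs)
  show ?case using Cons.IH[of "\<lambda>cs. f (a # cs)"] by (simp add: scale_simps)
qed (simp add: mul_simps)

lemma ract_diff: "ract (\<lambda>cs. f cs - g cs) a bs = ract f a bs - ract g a bs"
  using ract_add[of f "\<lambda>cs. -1 *s g cs"] ract_scale[of "-1" g] by simp

lemma ract_lmul: "ract (\<lambda>cs. d \<cdot> f cs) a bs = d \<cdot> ract f a bs"
proof (induction bs arbitrary: f a)
  case (Cons b bs)
  show ?case using Cons.IH[of "\<lambda>cs. f (a # cs)"] by (simp add: mul_simps)
qed (simp add: mul_assoc)

text \<open>Makes the cochains a right module: the terms in which \<open>a\<close> stays a separate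
  argument occur twice, with opposite signs.\<close>

lemma ract_ract: "ract (ract f a) b bs = ract f (a \<cdot> b) bs"
proof (induction bs arbitrary: f a b)
  case (Cons c bs)
  have "ract (\<lambda>cs. ract f a (b # cs)) c bs
      = ract (\<lambda>cs. f ((a \<cdot> b) # cs)) c bs - ract (\<lambda>cs. f (a # cs)) (b \<cdot> c) bs"
    by (simp add: ract_diff Cons.IH)
  then show ?case by (simp add: mul_assoc)
qed (simp add: mul_assoc)

lemma ract_add_right: "mlin f \<Longrightarrow> ract f (a + b) bs = ract f a bs + ract f b bs"
  by (cases bs) (simp_all add: mul_simps mlin_hd ract_add)

lemma ract_scale_right: "mlin f \<Longrightarrow> ract f (s *s a) bs = s *s ract f a bs"
  by (cases bs) (simp_all add: mul_simps mlin_hd ract_scale scale_simps)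

lemma ract_unit: "mlin f \<Longrightarrow> ract f unit bs = f bs"
  by (cases bs) (simp_all add: mlin_hd)

lemma mlin_ract: "mlin f \<Longrightarrow> mlin (ract f a)"
proof -
  have "ract f a (as @ (b + b') # bs) = ract f a (as @ b # bs) + ract f a (as @ b' # bs) \<and>
      ract f a (as @ (c *s b) # bs) = c *s ract f a (as @ b # bs) \<and> ract f a (as @ unit # bs) = 0"
    if "mlin f" for f a as bs b b' c
    using that
  proof (induction as arbitrary: f a)
    case Nil
    then show ?case
      using mlin_tl[OF Nil, of a]
      by (simp add: mul_simps mlin_hd ract_add_right ract_scale_right ract_unit scale_simps)
  next
    case (Cons d as)
    then show ?case
      using Cons.IH[OF mlin_tl[OF Cons.prems, of a], of d]
        mlinD[OF mlin_tl[OF Cons.prems, of "a \<cdot> d"], of as]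
      by (simp add: scale_simps)
  qed
  then show "mlin (ract f a)" if "mlin f"
    using that by (intro mlinI) blast+
qed

lemma mlin_delta:
  assumes "mlin f"
  shows "mlin (delta f)"
proof (rule mlin_Cons)
  show "mlin (\<lambda>bs. delta f (a # bs))" for a
    using assms by (simp add: mlin_diff mlin_lmul mlin_ract)
qed (use assms in \<open>simp_all add: mul_simps ract_add_right ract_scale_right ract_unit scale_simps\<close>)

lemma vanishes_ract: "vanishes_from N f \<Longrightarrow> N \<le> length bs \<Longrightarrow> ract f a bs = 0"
proof (induction bs arbitrary: f a N)
  case (Cons b bs)
  have "vanishes_from (N - 1) (\<lambda>cs. f (a # cs))"
    using Cons.prems by (auto simp: vanishes_from_def)
  from Cons.IH[OF this] show ?case
    using Cons.prems by (auto simp: vanishes_from_def)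
qed (auto simp: vanishes_from_def)

lemma vanishes_delta: "vanishes_from N f \<Longrightarrow> vanishes_from (Suc N) (delta f)"
  unfolding vanishes_from_def
proof (intro allI impI)
  fix as :: "'b list"
  assume "\<forall>as. N \<le> length as \<longrightarrow> f as = 0" and "Suc N \<le> length as"
  then show "delta f as = 0"
    using vanishes_ract[of N f] by (cases as) (auto simp: vanishes_from_def)
qed

lemma cochain_delta: "cochain f \<Longrightarrow> cochain (delta f)"
  by (auto simp: cochain_def intro: mlin_delta vanishes_delta)

lemma cochain_add: "cochain f \<Longrightarrow> cochain g \<Longrightarrow> cochain (\<lambda>bs. f bs + g bs)"
  unfolding cochain_def
proof (intro conjI; elim conjE exE)
  fix M N assume "vanishes_from M f" "vanishes_from N g"
  then have "vanishes_from (max M N) (\<lambda>bs. f bs + g bs)"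
    by (auto simp: vanishes_from_def)
  then show "\<exists>N. vanishes_from N (\<lambda>bs. f bs + g bs)" ..
qed (rule mlin_add)

lemma cochain_scale: "cochain f \<Longrightarrow> cochain (\<lambda>bs. s *s f bs)"
  unfolding cochain_def by (auto simp: vanishes_from_def intro!: mlin_scale)

lemma cochain_diff: "cochain f \<Longrightarrow> cochain g \<Longrightarrow> cochain (\<lambda>bs. f bs - g bs)"
  using cochain_add[of f "\<lambda>bs. -1 *s g bs"] cochain_scale[of g "-1"] by simp

lemma delta_add: "delta (\<lambda>cs. f cs + g cs) bs = delta f bs + delta g bs"
  by (cases bs) (simp_all add: ract_add mul_simps)

lemma delta_scale: "delta (\<lambda>cs. s *s f cs) bs = s *s delta f bs"
  by (cases bs) (simp_all add: ract_scale mul_simps scale_simps)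

lemma delta_diff: "delta (\<lambda>cs. f cs - g cs) bs = delta f bs - delta g bs"
  using delta_add[of f "\<lambda>cs. -1 *s g cs"] delta_scale[of "-1" g] by simp

text \<open>\<open>delta f\<close> is the commutator of \<open>f\<close> with the first argument.
  Coboundaries are central in the bimodule of cochains, and hence the square of \<open>delta\<close>
  vanishes.\<close>

lemma ract_delta: "ract (delta f) a bs = a \<cdot> delta f bs"
proof (induction bs arbitrary: f a)
  case (Cons b bs)
  have "ract (\<lambda>cs. delta f (a # cs)) b bs = a \<cdot> ract f b bs - ract f (a \<cdot> b) bs"
    by (simp add: ract_diff ract_lmul ract_ract)
  then show ?case by (simp add: mul_simps mul_assoc)
qed simp

lemma delta_delta: "delta (delta f) bs = 0"
  by (cases bs) (simp_all add: ract_delta)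

section \<open>Cup product and Leibniz rule\<close>

fun cup :: "('b list \<Rightarrow> 'b) \<Rightarrow> ('b list \<Rightarrow> 'b) \<Rightarrow> 'b list \<Rightarrow> 'b" where
  "cup f g [] = f [] \<cdot> g []"
| "cup f g (a # bs) = f [] \<cdot> g (a # bs) + cup (\<lambda>cs. f (a # cs)) g bs"

definition alt :: "('b list \<Rightarrow> 'b) \<Rightarrow> 'b list \<Rightarrow> 'b" where
  "alt f bs = (-1) ^ length bs *s f bs"

lemma alt_Nil [simp]: "alt f [] = f []"
  by (simp add: alt_def)

lemma alt_Cons: "alt f (a # bs) = - alt (\<lambda>cs. f (a # cs)) bs"
  by (simp add: alt_def)

lemma cup_add: "cup (\<lambda>cs. f cs + f' cs) g bs = cup f g bs + cup f' g bs"
proof (induction bs arbitrary: f f')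
  case (Cons b bs)
  show ?case using Cons.IH[of "\<lambda>cs. f (b # cs)" "\<lambda>cs. f' (b # cs)"] by (simp add: mul_simps)
qed (simp add: mul_simps)

lemma cup_scale: "cup (\<lambda>cs. s *s f cs) g bs = s *s cup f g bs"
proof (induction bs arbitrary: f)
  case (Cons b bs)
  show ?case using Cons.IH[of "\<lambda>cs. f (b # cs)"] by (simp add: mul_simps scale_simps)
qed (simp add: mul_simps)

lemma cup_minus: "cup (\<lambda>cs. - f cs) g bs = - cup f g bs"
  using cup_scale[of "-1" f] by simp

lemma cup_diff: "cup (\<lambda>cs. f cs - f' cs) g bs = cup f g bs - cup f' g bs"
  using cup_add[of f "\<lambda>cs. - f' cs"] by (simp add: cup_minus)

lemma cup_lmul: "cup (\<lambda>cs. d \<cdot> f cs) g bs = d \<cdot> cup f g bs"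
proof (induction bs arbitrary: f)
  case (Cons b bs)
  show ?case using Cons.IH[of "\<lambda>cs. f (b # cs)"] by (simp add: mul_simps mul_assoc)
qed (simp add: mul_assoc)

lemma cup_zero_left [simp]: "cup (\<lambda>_. 0) g bs = 0"
  by (induction bs) simp_all

lemma cup_zero_right [simp]: "cup f (\<lambda>_. 0) bs = 0"
  by (induction f "\<lambda>_::'b list. 0::'b" bs rule: cup.induct) simp_all

lemma mlin_cup:
  assumes "mlin f" "mlin g"
  shows "mlin (cup f g)"
proof -
  have "cup f g (as @ (b + b') # bs) = cup f g (as @ b # bs) + cup f g (as @ b' # bs) \<and>
      cup f g (as @ (c *s b) # bs) = c *s cup f g (as @ b # bs) \<and> cup f g (as @ unit # bs) = 0"
    if "mlin f" for f as bs b b' c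
    using that
  proof (induction as arbitrary: f)
    case Nil
    then show ?case
      using assms(2) by (simp add: mul_simps mlin_hd cup_add cup_scale scale_simps)
  next
    case (Cons d as)
    then show ?case
      using Cons.IH[OF mlin_tl[OF Cons.prems, of d]] mlinD[OF mlin_tl[OF assms(2), of d], of as]
      by (simp add: mul_simps scale_simps)
  qed
  then show ?thesis
    using assms(1) by (intro mlinI) blast+
qed

lemma vanishes_cup:
  assumes "vanishes_from N g"
  shows "vanishes_from M f \<Longrightarrow> M + N \<le> length bs \<Longrightarrow> cup f g bs = 0"
proof (induction bs arbitrary: f M)
  case Nil
  then show ?case using assms by (simp add: vanishes_from_def)
next
  case (Cons b bs)
  show ?case
  proof (cases M)
    case 0
    then have "f = (\<lambda>_. 0)" using Cons.prems by (auto simp: vanishes_from_def)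
    then show ?thesis by simp
  next
    case (Suc M')
    then have "vanishes_from M' (\<lambda>cs. f (b # cs))"
      using Cons.prems by (auto simp: vanishes_from_def)
    from Cons.IH[OF this] show ?thesis
      using assms Cons.prems Suc by (simp add: vanishes_from_def)
  qed
qed

lemma delta_cup: "delta (cup f g) bs = cup (delta f) g bs + cup (alt f) (delta g) bs"
proof -
  \<comment> \<open>The recursion of \<open>ract\<close> modifies the first argument of
    \<open>f\<close>, so the induction runs on the right action of \<open>a\<close> on a product,
    with \<open>f\<close> and \<open>a\<close> arbitrary.\<close>
  have *: "ract (cup f g) a bs = f [] \<cdot> ract g a bs + cup (ract f a) g bs - f [] \<cdot> a \<cdot> g bs
      + cup (alt (\<lambda>cs. f (a # cs))) (delta g) bs" for f g a bs
  proof (induction bs arbitrary: f a)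
    case Nil
    then show ?case by (simp add: mul_assoc)
  next
    case (Cons b bs)
    have "ract (\<lambda>cs. cup f g (a # cs)) b bs
        = f [] \<cdot> ract (\<lambda>cs. g (a # cs)) b bs + ract (cup (\<lambda>cs. f (a # cs)) g) b bs"
      by (simp add: ract_add ract_lmul)
    then show ?case
      by (simp add: Cons.IH cup_diff cup_minus alt_Cons[abs_def] mul_simps mul_assoc algebra_simps)
  qed
  show ?thesis
  proof (cases bs)
    case (Cons a as)
    have "cup (\<lambda>cs. delta f (a # cs)) g as = a \<cdot> cup f g as - cup (ract f a) g as"
      by (simp add: cup_diff cup_lmul)
    then show ?thesis
      by (simp add: Cons * alt_Cons[abs_def] cup_minus mul_simps mul_assoc)
  qed simp
qed

text \<open>The sign \<open>(-1)^(i (n - i))\<close> for a list of length \<open>n\<close> cut at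
  \<open>i\<close> is \<open>(-1)^i\<close> if \<open>n\<close> is even and \<open>1\<close> if
  \<open>n\<close> is odd. So it can be put on \<open>f\<close> alone, depending on the parity of
  the whole length.\<close>

definition scup :: "('b list \<Rightarrow> 'b) \<Rightarrow> ('b list \<Rightarrow> 'b) \<Rightarrow> 'b list \<Rightarrow> 'b" where
  "scup f g bs = cup (if even (length bs) then alt f else f) g bs"

lemma ract_cong:
  "(\<And>cs. length cs = length bs \<Longrightarrow> f cs = g cs) \<Longrightarrow> ract f a bs = ract g a bs"
proof (induction bs arbitrary: f g a)
  case (Cons b bs)
  show ?case using Cons.IH[of "\<lambda>cs. f (a # cs)" "\<lambda>cs. g (a # cs)"] Cons.prems by simp
qed simp

lemma delta_cong:
  "(\<And>cs. Suc (length cs) = length bs \<Longrightarrow> f cs = g cs) \<Longrightarrow> delta f bs = delta g bs"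
  using ract_cong[of "tl bs" f g] by (cases bs) auto

lemma mlin_alt: "mlin f \<Longrightarrow> mlin (alt f)"
  by (intro mlinI) (simp_all add: alt_def mlinD scale_simps mult.commute)

lemma cochain_scup:
  assumes "cochain f" "cochain g"
  shows "cochain (scup f g)"
  unfolding cochain_def
proof
  have m: "mlin (cup f g)" "mlin (cup (alt f) g)"
    using assms by (simp_all add: cochain_def mlin_cup mlin_alt)
  show "mlin (scup f g)"
    by (intro mlinI) (simp_all add: scup_def mlinD[OF m(1)] mlinD[OF m(2)])
  obtain M N where v: "vanishes_from M f" "vanishes_from N g"
    using assms by (auto simp: cochain_def)
  then have "vanishes_from M (alt f)" by (simp add: vanishes_from_def alt_def)
  with v have "vanishes_from (M + N) (scup f g)"
    unfolding vanishes_from_def[of "M + N"] using vanishes_cup[OF v(2)] by (simp add: scup_def)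
  then show "\<exists>N. vanishes_from N (scup f g)" ..
qed

lemma delta_alt: "delta (alt f) bs = - alt (delta f) bs"
proof -
  have *: "ract (alt f) a bs = (-1) ^ length bs *s ract f a bs" for a bs
  proof (induction bs arbitrary: f a)
    case (Cons b bs)
    have "ract (\<lambda>cs. alt f (a # cs)) b bs = ract (\<lambda>cs. -1 *s alt (\<lambda>cs. f (a # cs)) cs) b bs"
      by (simp only: alt_Cons scale_minus_left scale_one)
    also have "\<dots> = - ((-1) ^ length bs *s ract (\<lambda>cs. f (a # cs)) b bs)"
      unfolding ract_scale Cons.IH by simp
    finally show ?case by (simp add: alt_def scale_simps)
  qed simp
  show ?thesis
    by (cases bs) (simp_all add: * alt_def mul_simps scale_simps)
qed

lemma delta_scup:
  assumes "delta f = (\<lambda>_. 0)" "delta g = (\<lambda>_. 0)"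
  shows "delta (scup f g) = (\<lambda>_. 0)"
proof
  fix bs
  \<comment> \<open>\<open>delta\<close> at \<open>bs\<close> only reads lists that are one shorter,
    and there the parity, hence the choice of sign, is fixed.\<close>
  have "delta (scup f g) bs = delta (cup (if odd (length bs) then alt f else f) g) bs"
  proof (rule delta_cong)
    fix cs :: "'b list" assume "Suc (length cs) = length bs"
    then have "odd (length bs) \<longleftrightarrow> even (length cs)" by (metis even_Suc)
    then show "scup f g cs = cup (if odd (length bs) then alt f else f) g cs"
      by (simp add: scup_def)
  qed
  also have "\<dots> = 0"
    by (simp add: delta_cup delta_alt[abs_def] assms alt_def[of "\<lambda>_. 0", abs_def])
  finally show "delta (scup f g) bs = 0" .
qed

definition trunc :: "nat \<Rightarrow> ('b list \<Rightarrow> 'b) \<Rightarrow> 'b list \<Rightarrow> 'b" where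
  "trunc n f bs = (if length bs = n then f bs else 0)"

lemma cochain_trunc: "cochain f \<Longrightarrow> cochain (trunc n f)"
  unfolding cochain_def by (auto simp: vanishes_from_def trunc_def mlinD intro!: mlinI)

lemma delta_trunc: "delta (trunc n f) bs = trunc (Suc n) (delta f) bs"
proof (cases "length bs = Suc n")
  case True
  then have "delta (trunc n f) bs = delta f bs"
    by (intro delta_cong) (simp add: trunc_def)
  then show ?thesis by (simp add: trunc_def True)
next
  case False
  have "delta (trunc n f) bs = delta (\<lambda>_. 0) bs"
    using False by (intro delta_cong) (auto simp: trunc_def)
  also have "\<dots> = 0" by (cases bs) simp_all
  finally show ?thesis by (simp add: trunc_def False)
qed

end

section \<open>The quantum plane\<close>

type_synonym 'k qp = "nat \<times> nat \<Rightarrow>\<^sub>0 'k"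

abbreviation "lookup \<equiv> Poly_Mapping.lookup"
abbreviation "keys \<equiv> Poly_Mapping.keys"
abbreviation "single \<equiv> Poly_Mapping.single"

definition pscale :: "'k::field \<Rightarrow> ('m \<Rightarrow>\<^sub>0 'k) \<Rightarrow> ('m \<Rightarrow>\<^sub>0 'k)" where
  "pscale s a = Poly_Mapping.map ((*) s) a"

lemma lookup_pscale [simp]: "lookup (pscale s a) m = s * lookup a m"
  by (simp add: pscale_def Poly_Mapping.map.rep_eq when_def)

interpretation pscale: vector_space pscale
  by standard (auto intro!: poly_mapping_eqI simp: lookup_add algebra_simps)

definition plift :: "('m \<Rightarrow> ('n \<Rightarrow>\<^sub>0 'k)) \<Rightarrow> ('m \<Rightarrow>\<^sub>0 'k::field) \<Rightarrow> ('n \<Rightarrow>\<^sub>0 'k)" where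
  "plift F a = (\<Sum>m\<in>keys a. pscale (lookup a m) (F m))"

lemma plift_superset:
  "finite S \<Longrightarrow> keys a \<subseteq> S \<Longrightarrow> plift F a = (\<Sum>m\<in>S. pscale (lookup a m) (F m))"
  unfolding plift_def by (rule sum.mono_neutral_left) (auto simp: in_keys_iff)

lemma plift_add: "plift F (a + b) = plift F a + plift F b"
proof -
  let ?S = "keys a \<union> keys b"
  have "plift F x = (\<Sum>m\<in>?S. pscale (lookup x m) (F m))" if "x \<in> {a, b, a + b}" for x
    using that Poly_Mapping.keys_add[of a b] by (intro plift_superset) auto
  then show ?thesis
    by (simp add: lookup_add pscale.scale_left_distrib sum.distrib)
qed

lemma plift_scale: "plift F (pscale s a) = pscale s (plift F a)"
proof -
  have "plift F (pscale s a) = (\<Sum>m\<in>keys a. pscale (lookup (pscale s a) m) (F m))"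
    by (rule plift_superset) (auto simp: in_keys_iff)
  then show ?thesis
    by (simp add: plift_def pscale.scale_sum_right)
qed

lemma plift_single [simp]: "plift F (single m s) = pscale s (F m)"
  by (simp add: plift_def)

lemma plift_zero [simp]: "plift F 0 = 0"
  by (simp add: plift_def)

lemma plift_fun_add: "plift (\<lambda>m. F m + G m) a = plift F a + plift G a"
  by (simp add: plift_def pscale.scale_right_distrib sum.distrib)

lemma plift_fun_scale: "plift (\<lambda>m. pscale s (F m)) a = pscale s (plift F a)"
  by (simp add: plift_def pscale.scale_sum_right mult.commute)

lemma plift_fun_zero [simp]: "plift (\<lambda>m. 0) a = 0"
  by (simp add: plift_def)

lemma poly_mapping_sum_singles:
  "(\<Sum>m\<in>keys a. single m (lookup a m)) = a"
  by (rule poly_mapping_eqI) (simp add: lookup_sum lookup_single when_def in_keys_iff)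

lemma additive_ext:
  fixes L M :: "('m \<Rightarrow>\<^sub>0 'k::ab_group_add) \<Rightarrow> 'b::ab_group_add"
  assumes "\<And>a b. L (a + b) = L a + L b" "\<And>a b. M (a + b) = M a + M b"
    and "\<And>m s. L (single m s) = M (single m s)"
  shows "L a = M a"
proof -
  have z: "L 0 = 0" "M 0 = 0"
    using assms(1)[of 0 0] assms(2)[of 0 0] by simp_all
  have "L (\<Sum>m\<in>S. single m (lookup a m)) = M (\<Sum>m\<in>S. single m (lookup a m))"
    if "finite S" for S
    using that by (induction S rule: finite_induct) (simp_all add: assms z)
  then show ?thesis
    using poly_mapping_sum_singles[of a] by (metis finite_keys)
qed

lemma linear_ext:
  fixes L M :: "('m \<Rightarrow>\<^sub>0 'k::field) \<Rightarrow> 'b::ab_group_add"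
  assumes "vector_space sc"
    and "\<And>a b. L (a + b) = L a + L b" "\<And>s a. L (pscale s a) = sc s (L a)"
    and "\<And>a b. M (a + b) = M a + M b" "\<And>s a. M (pscale s a) = sc s (M a)"
    and "\<And>m. L (single m 1) = M (single m 1)"
  shows "L a = M a"
proof -
  have s: "single m s = pscale s (single m 1)" for m and s :: 'k
    by (rule poly_mapping_eqI) (simp add: lookup_single when_def)
  have "L (single m s) = M (single m s)" for m s
    by (subst (1 2) s) (simp add: assms)
  then show ?thesis
    by (rule additive_ext[of L M, OF assms(2,4)])
qed

lemmas pscale_linear_ext = linear_ext[OF pscale.vector_space_axioms]

lemma single_scale: "single m s = pscale s (single m 1)"
  by (rule poly_mapping_eqI) (simp add: lookup_single when_def)

text \<open>\<open>mo i j\<close> is the monomial \<open>y\<^sup>i x\<^sup>j\<close>, and \<open>x y = q y x\<close>.\<close>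

definition mo :: "nat \<Rightarrow> nat \<Rightarrow> 'k::field qp" where
  "mo i j = single (i, j) 1"

text \<open>Moving \<open>x^j\<close> to the right past \<open>y^k\<close> costs the factor
  \<open>q^(j k)\<close>.\<close>

definition qmul :: "'k::field \<Rightarrow> 'k qp \<Rightarrow> 'k qp \<Rightarrow> 'k qp" where
  "qmul q a b = plift (\<lambda>m. plift (\<lambda>n. pscale (q ^ (snd m * fst n)) (mo (fst m + fst n) (snd m + snd n))) b) a"

lemma lookup_mo: "lookup (mo i j) m = (if m = (i, j) then 1 else 0)"
  by (auto simp: mo_def lookup_single when_def)

lemma plift_mo [simp]: "plift F (mo i j) = F (i, j)"
  by (simp add: mo_def)

lemma qmul_mo [simp]: "qmul q (mo i j) (mo k l) = pscale (q ^ (j * k)) (mo (i + k) (j + l))"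
  by (simp add: qmul_def)

lemma qmul_add_left: "qmul q (a + b) c = qmul q a c + qmul q b c"
  by (simp add: qmul_def plift_add)

lemma qmul_add_right: "qmul q a (b + c) = qmul q a b + qmul q a c"
  by (simp add: qmul_def plift_add plift_fun_add)

lemma qmul_scale_left: "qmul q (pscale s a) b = pscale s (qmul q a b)"
  by (simp add: qmul_def plift_scale)

lemma qmul_scale_right: "qmul q a (pscale s b) = pscale s (qmul q a b)"
  by (simp add: qmul_def plift_scale plift_fun_scale)

lemmas qmul_bilinear = qmul_add_left qmul_add_right qmul_scale_left qmul_scale_right

lemma linear_ext_mo:
  assumes "\<And>a b. L (a + b) = L a + L b" "\<And>s a. L (pscale s a) = pscale s (L a)"
    and "\<And>a b. M (a + b) = M a + M b" "\<And>s a. M (pscale s a) = pscale s (M a)"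
    and "\<And>i j. L (mo i j) = M (mo i j)"
  shows "L a = M a"
  by (rule pscale_linear_ext[of L M]) (use assms in \<open>auto simp: mo_def\<close>)

lemma k_algebra_qmul: "k_algebra pscale (qmul q) (mo 0 0)"
proof
  show "qmul q (mo 0 0) a = a" for a
    by (rule linear_ext_mo) (simp_all add: qmul_bilinear)
  show "qmul q a (mo 0 0) = a" for a
    by (rule linear_ext_mo) (simp_all add: qmul_bilinear)
  \<comment> \<open>On monomials, associativity is biadditivity of the exponent \<open>j k\<close>;
    it is then extended linearly in one argument at a time.\<close>
  have 1: "qmul q (qmul q (mo i j) (mo k l)) (mo m n) = qmul q (mo i j) (qmul q (mo k l) (mo m n))"
    for i j k l m n
    by (simp add: qmul_bilinear power_add[symmetric] algebra_simps)
  have 2: "qmul q (qmul q (mo i j) (mo k l)) c = qmul q (mo i j) (qmul q (mo k l) c)" for i j k l c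
    by (rule linear_ext_mo[of _ _ c], simp_all only: qmul_bilinear pscale.scale_right_distrib 1)
  have 3: "qmul q (qmul q (mo i j) b) c = qmul q (mo i j) (qmul q b c)" for i j b c
    by (rule linear_ext_mo[of _ _ b], simp_all only: qmul_bilinear pscale.scale_right_distrib 2)
  show "qmul q (qmul q a b) c = qmul q a (qmul q b c)" for a b c
    by (rule linear_ext_mo[of _ _ a], simp_all only: qmul_bilinear pscale.scale_right_distrib 3)
qed (simp_all add: qmul_bilinear)

locale qplane =
  fixes q :: "'k::field"
  assumes q_nonzero [simp]: "q \<noteq> 0" and q_power: "\<And>n. n > 0 \<Longrightarrow> q ^ n \<noteq> 1"
begin

abbreviation qmult (infixl "\<cdot>" 70) where "a \<cdot> b \<equiv> qmul q a b"
abbreviation qscale (infixr "*s" 75) where "s *s (a :: 'k qp) \<equiv> pscale s a"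

sublocale k_algebra pscale "qmul q" "mo 0 0"
  by (rule k_algebra_qmul)

abbreviation X :: "'k qp" where "X \<equiv> mo 0 (Suc 0)"
abbreviation Y :: "'k qp" where "Y \<equiv> mo (Suc 0) 0"

lemma q_power_eq_1 [simp]: "q ^ n = 1 \<longleftrightarrow> n = 0"
  using q_power[of n] by auto

lemma q_neq_1 [simp]: "q \<noteq> 1"
  using q_power[of 1] by simp

lemma q_power_Suc_neq_1 [simp]: "q * q ^ n \<noteq> 1"
  using q_power[of "Suc n"] by simp

lemma q_power_eq_q [simp]: "q ^ n = q \<longleftrightarrow> n = 1"
proof (cases n)
  case 0
  then show ?thesis using q_power[of 1] by auto
qed (auto simp: power_Suc)

lemma X_mo: "X \<cdot> mo i j = q ^ i *s mo i (Suc j)" and mo_X: "mo i j \<cdot> X = mo i (Suc j)"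
  and Y_mo: "Y \<cdot> mo i j = mo (Suc i) j" and mo_Y: "mo i j \<cdot> Y = q ^ j *s mo (Suc i) j"
  by simp_all

lemma XY: "X \<cdot> Y = q *s (Y \<cdot> X)"
  by simp

lemma XY_assoc: "X \<cdot> (Y \<cdot> a) = q *s (Y \<cdot> (X \<cdot> a))"
  using mul_assoc[of X Y a] mul_assoc[of Y X a] by (simp add: scale_mul)

lemma lookup_linear_ext:
  assumes "\<And>a b. L (a + b) = L a + L b" "\<And>s a. L (pscale s a) = s * L a"
    and "\<And>a b. M (a + b) = M a + M b" "\<And>s a. M (pscale s a) = s * M a"
    and "\<And>i j. L (mo i j) = M (mo i j)"
  shows "L a = (M (a :: 'k qp) :: 'k)"
  by (rule linear_ext[of "(*)" L M]) (use assms in \<open>auto simp: mo_def intro!: vector_space.intro algebra_simps\<close>)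

lemma lookup_X_mul: "lookup (X \<cdot> a) (i, j) = (if j = 0 then 0 else q ^ i * lookup a (i, j - 1))"
  by (rule lookup_linear_ext[of _ _ a])
    (auto simp: qmul_bilinear lookup_add lookup_mo algebra_simps)

lemma lookup_mul_X: "lookup (a \<cdot> X) (i, j) = (if j = 0 then 0 else lookup a (i, j - 1))"
  by (rule lookup_linear_ext[of _ _ a])
    (auto simp: qmul_bilinear lookup_add lookup_mo algebra_simps)

lemma lookup_Y_mul: "lookup (Y \<cdot> a) (i, j) = (if i = 0 then 0 else lookup a (i - 1, j))"
  by (rule lookup_linear_ext[of _ _ a])
    (auto simp: qmul_bilinear lookup_add lookup_mo algebra_simps)

lemma lookup_mul_Y: "lookup (a \<cdot> Y) (i, j) = (if i = 0 then 0 else q ^ j * lookup a (i - 1, j))"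
  by (rule lookup_linear_ext[of _ _ a])
    (auto simp: qmul_bilinear lookup_add lookup_mo algebra_simps)

lemmas lookup_XY = lookup_X_mul lookup_mul_X lookup_Y_mul lookup_mul_Y

lemma ex_lookup:
  fixes \<phi> :: "nat \<times> nat \<Rightarrow> 'k"
  assumes "finite {m. \<phi> m \<noteq> 0}"
  obtains a where "\<And>m. lookup a m = \<phi> m"
  using assms lookup_Abs_poly_mapping by metis

lemma finite_shift:
  assumes "inj f"
  shows "finite {m. lookup a (f m) \<noteq> (0 :: 'k)}"
  using finite_vimageI[OF finite_lookup[of a] assms] by (simp add: vimage_def)

text \<open>Commuting with \<open>x\<close> forces \<open>q^i = 1\<close>, and commuting with
  \<open>y\<close> forces \<open>q^j = 1\<close>, for every monomial \<open>y^i x^j\<close> that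
  occurs.\<close>

lemma central_scalar:
  assumes "X \<cdot> a = a \<cdot> X" "Y \<cdot> a = a \<cdot> Y"
  shows "a = lookup a (0, 0) *s mo 0 0"
proof (rule poly_mapping_eqI)
  fix m :: "nat \<times> nat"
  obtain i j where m: "m = (i, j)" by force
  have "q ^ i * lookup a (i, j) = lookup a (i, j)" "q ^ j * lookup a (i, j) = lookup a (i, j)"
    using arg_cong[OF assms(1), of "\<lambda>a. lookup a (i, Suc j)"]
      arg_cong[OF assms(2), of "\<lambda>a. lookup a (Suc i, j)"]
    by (simp_all add: lookup_XY)
  then show "lookup a m = lookup (lookup a (0, 0) *s mo 0 0) m"
    by (auto simp: m lookup_mo)
qed

text \<open>The assumption is what a derivation with values \<open>A\<close> at \<open>x\<close> and
  \<open>B\<close> at \<open>y\<close> satisfies when it is applied to \<open>x y = q y x\<close>;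
  the conclusions compare coefficients.\<close>

lemma derivation_values:
  assumes "A \<cdot> Y + X \<cdot> B = q *s (Y \<cdot> A + B \<cdot> X)"
  shows "lookup A (i, 0) = 0" and "lookup B (0, j) = 0"
    and "(q ^ j - 1) * lookup A (i, Suc j) = (1 - q ^ i) * lookup B (Suc i, j)"
proof -
  note * = arg_cong[OF assms, of "\<lambda>a. lookup a m" for m]
  have "lookup A (i, 0) * (1 - q) = 0"
    using *[of "(Suc i, 0)"] by (simp add: lookup_add lookup_XY algebra_simps)
  then show "lookup A (i, 0) = 0"
    using q_power[of 1] by simp
  have "lookup B (0, j) * (1 - q) = 0"
    using *[of "(0, Suc j)"] by (simp add: lookup_add lookup_XY algebra_simps)
  then show "lookup B (0, j) = 0"
    using q_power[of 1] by simp
  have "q * ((q ^ j - 1) * lookup A (i, Suc j)) = q * ((1 - q ^ i) * lookup B (Suc i, j))"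
    using *[of "(Suc i, Suc j)"] by (simp add: lookup_add lookup_XY algebra_simps)
  then show "(q ^ j - 1) * lookup A (i, Suc j) = (1 - q ^ i) * lookup B (Suc i, j)"
    by simp
qed

text \<open>The commutators of \<open>h\<close> with \<open>x\<close> and \<open>y\<close> rescale
  each coefficient of \<open>h\<close>, so \<open>h\<close> is found by division. The two excluded
  coefficients are those whose scaling factor is zero although the derivation equation allows
  them.\<close>

lemma inner_derivation:
  assumes "A \<cdot> Y + X \<cdot> B = q *s (Y \<cdot> A + B \<cdot> X)"
    and "lookup A (0, 1) = 0" "lookup B (1, 0) = 0"
  obtains h where "A = X \<cdot> h - h \<cdot> X" "B = Y \<cdot> h - h \<cdot> Y"
proof -
  note dv = derivation_values[OF assms(1)]
  \<comment> \<open>For \<open>i > 0\<close> the coefficient is read off from \<open>A\<close>, for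
    \<open>i = 0\<close> from \<open>B\<close>. Where both are possible, they agree by
    \<open>dv(3)\<close>. The constant term of \<open>h\<close> is immaterial and set to 0.\<close>
  define \<phi> where "\<phi> = (\<lambda>(i, j). if i = 0 then if j = 0 then 0 else lookup B (Suc i, j) / (1 - q ^ j)
      else lookup A (i, Suc j) / (q ^ i - 1))"
  have "finite {m. \<phi> m \<noteq> 0}"
    by (rule finite_subset[of _ "{m. lookup B (Suc (fst m), snd m) \<noteq> 0} \<union> {m. lookup A (fst m, Suc (snd m)) \<noteq> 0}"])
      (auto simp: \<phi>_def split: if_splits intro!: finite_shift inj_onI)
  then obtain h where h: "lookup h m = \<phi> m" for m
    by (rule ex_lookup) auto
  have A0: "lookup A (0, Suc j) = 0" for j
    using dv(3)[of j 0] assms(2) by (cases j) auto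
  have B0: "lookup B (Suc i, 0) = 0" for i
    using dv(3)[of 0 i] assms(3) by (cases i) auto
  have "A = X \<cdot> h - h \<cdot> X"
  proof (rule poly_mapping_eqI)
    fix m :: "nat \<times> nat"
    obtain i j where m: "m = (i, j)" by force
    have "lookup A (i, j) = (if j = 0 then 0 else (q ^ i - 1) * \<phi> (i, j - 1))"
      using dv(1)[of i] A0[of "j - 1"] by (cases j; cases i) (simp_all add: \<phi>_def)
    then show "lookup A m = lookup (X \<cdot> h - h \<cdot> X) m"
      by (auto simp: m lookup_minus lookup_XY h algebra_simps)
  qed
  moreover have "B = Y \<cdot> h - h \<cdot> Y"
  proof (rule poly_mapping_eqI)
    fix m :: "nat \<times> nat"
    obtain i j where m: "m = (i, j)" by force
    show "lookup B m = lookup (Y \<cdot> h - h \<cdot> Y) m"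
    proof (cases i)
      case 0
      then show ?thesis using dv(2) by (simp add: m lookup_minus lookup_XY)
    next
      case (Suc k)
      show ?thesis
      proof (cases "k = 0 \<or> j = 0")
        case True
        then show ?thesis
          using B0 Suc by (auto simp: m lookup_minus lookup_XY h \<phi>_def field_simps)
      next
        case False
        then have "lookup B (Suc k, j) = (1 - q ^ j) * (lookup A (k, Suc j) / (q ^ k - 1))"
          using dv(3)[of j k] by (simp add: field_simps)
        also have "\<dots> = (1 - q ^ j) * \<phi> (k, j)"
          using False by (simp add: \<phi>_def)
        finally show ?thesis
          by (simp add: Suc m lookup_minus lookup_XY h algebra_simps)
      qed
    qed
  qed
  ultimately show ?thesis using that by blast
qed

text \<open>The monomial \<open>1\<close> is not reached, as every term has a factor
  \<open>x\<close> or \<open>y\<close>; at \<open>y x\<close> each unknown enters with coefficient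
  \<open>q - q\<close>.\<close>

lemma relation_values:
  "lookup (A \<cdot> Y + X \<cdot> B - q *s (Y \<cdot> A + B \<cdot> X)) (0, 0) = 0"
  "lookup (A \<cdot> Y + X \<cdot> B - q *s (Y \<cdot> A + B \<cdot> X)) (1, 1) = 0"
  by (simp_all add: lookup_add lookup_minus lookup_XY algebra_simps)

lemma relation_solution:
  assumes "lookup r (0, 0) = 0" "lookup r (1, 1) = 0"
  obtains A B where "r = A \<cdot> Y + X \<cdot> B - q *s (Y \<cdot> A + B \<cdot> X)"
proof -
  \<comment> \<open>\<open>A\<close> takes care of the monomials \<open>y^i x^j\<close> of
    \<open>r\<close> with \<open>i > 0\<close> and \<open>j\<close> different from 1,
    \<open>B\<close> of those with \<open>i = 0, j > 0\<close> and of \<open>y^i x\<close> with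
    \<open>i > 1\<close>. What remains is \<open>1\<close> and \<open>y x\<close>.\<close>
  define \<phi> where "\<phi> = (\<lambda>(i, j). if j = 1 then 0 else lookup r (Suc i, j) / (q ^ j - q))"
  define \<psi> where "\<psi> = (\<lambda>(i, j). if i = 0 \<or> (j = 0 \<and> i \<noteq> 1) then lookup r (i, Suc j) / (q ^ i - q) else 0)"
  have "finite {m. \<phi> m \<noteq> 0}"
    by (rule finite_subset[of _ "{m. lookup r (Suc (fst m), snd m) \<noteq> 0}"])
      (auto simp: \<phi>_def split: if_splits intro!: finite_shift inj_onI)
  then obtain A where A: "lookup A m = \<phi> m" for m
    by (rule ex_lookup) auto
  have "finite {m. \<psi> m \<noteq> 0}"
    by (rule finite_subset[of _ "{m. lookup r (fst m, Suc (snd m)) \<noteq> 0}"])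
      (auto simp: \<psi>_def split: if_splits intro!: finite_shift inj_onI)
  then obtain B where B: "lookup B m = \<psi> m" for m
    by (rule ex_lookup) auto
  have "r = A \<cdot> Y + X \<cdot> B - q *s (Y \<cdot> A + B \<cdot> X)"
  proof (rule poly_mapping_eqI)
    fix m :: "nat \<times> nat"
    obtain i j where m: "m = (i, j)" by force
    have "lookup r (i, j) = (if i = 0 then 0 else (q ^ j - q) * \<phi> (i - 1, j))
        + (if j = 0 then 0 else (q ^ i - q) * \<psi> (i, j - 1))"
      using assms by (cases i; cases j) (auto simp: \<phi>_def \<psi>_def)
    then show "lookup r m = lookup (A \<cdot> Y + X \<cdot> B - q *s (Y \<cdot> A + B \<cdot> X)) m"
      by (auto simp: m lookup_add lookup_minus lookup_XY A B algebra_simps)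
  qed
  with that show ?thesis by blast
qed

end

section \<open>Hochschild cocycles of the quantum plane\<close>

context qplane
begin

definition cocycle :: "('k qp list \<Rightarrow> 'k qp) \<Rightarrow> bool" where
  "cocycle f \<longleftrightarrow> cochain f \<and> delta f = (\<lambda>_. 0)"

lemma cocycle_mlin: "cocycle f \<Longrightarrow> mlin f"
  by (simp add: cocycle_def cochain_def)

lemma cocycle_nil: "cocycle f \<Longrightarrow> a \<cdot> f [] = f [] \<cdot> a"
  unfolding cocycle_def by (drule conjunct2, drule fun_cong[of _ _ "[a]"]) simp

lemma cocycle_Cons: "cocycle f \<Longrightarrow> a \<cdot> f (b # bs) = f ((a \<cdot> b) # bs) - ract (\<lambda>cs. f (a # cs)) b bs"
  unfolding cocycle_def by (drule conjunct2, drule fun_cong[of _ _ "a # b # bs"]) simp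

lemma cocycle_singleton: "cocycle f \<Longrightarrow> f [a \<cdot> b] = a \<cdot> f [b] + f [a] \<cdot> b"
  using cocycle_Cons[of f a b "[]"] by simp

lemma mlin_plift: "(\<And>m. mlin (F m)) \<Longrightarrow> mlin (\<lambda>bs. plift (\<lambda>m. F m bs) c)"
  by (intro mlinI) (simp_all add: mlinD plift_fun_add plift_fun_scale)

lemma mlin_plift_Cons:
  assumes "\<And>i j. mlin (F i j)" "\<And>bs. F 0 0 bs = 0" "\<And>c bs. f (c # bs) = plift (\<lambda>m. F (fst m) (snd m) bs) c"
  shows "mlin f"
  by (rule mlin_Cons) (simp_all add: assms plift_add plift_scale mlin_plift)

lemma mlin_ext_Cons:
  assumes "mlin f" "mlin g" "\<And>i j. f (mo i j # bs) = g (mo i j # bs)"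
  shows "f (a # bs) = g (a # bs)"
  by (rule linear_ext_mo[of "\<lambda>a. f (a # bs)" "\<lambda>a. g (a # bs)"]) (simp_all add: assms mlin_hd)

text \<open>Under these assumptions the cocycle equation says that multiplying the first argument by
  a generator on the left multiplies the value by it. So the value at a monomial reduces to the one
  at \<open>1\<close>, which is 0.\<close>

lemma cocycle_eqI:
  assumes "cocycle f" "f [] = 0" "\<And>bs. f (X # bs) = 0" "\<And>bs. f (Y # bs) = 0"
  shows "f = (\<lambda>_. 0)"
proof
  fix as
  have X: "f ((X \<cdot> c) # bs) = X \<cdot> f (c # bs)" and Y: "f ((Y \<cdot> c) # bs) = Y \<cdot> f (c # bs)" for c bs
    using cocycle_Cons[OF assms(1)] by (simp_all add: assms)
  have *: "f (mo 0 j # bs) = 0" for j bs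
    using X[of "mo 0 _"] by (induction j) (simp_all add: mlin_hd(3)[OF cocycle_mlin[OF assms(1)]])
  have "f (mo i j # bs) = 0" for i j bs
    using Y[of "mo _ j"] by (induction i) (simp_all add: *)
  then show "f as = 0"
    using mlin_ext_Cons[OF cocycle_mlin[OF assms(1)] mlin_zero] assms(2) by (cases as) auto
qed

text \<open>
  Let \<open>f\<close> be a cocycle that vanishes on \<open>[]\<close>, \<open>[x]\<close> and \<open>[y]\<close>. A cochain \<open>g\<close> with \<open>delta g = f\<close>
  is determined by \<open>g (x # _)\<close> and \<open>g (y # _)\<close>: the equation on lists starting with \<open>y\<close>, or with \<open>x\<close>
  followed by \<open>x\<^sup>l\<close>, defines \<open>g\<close> on monomials recursively, and the remaining equations reduce by the
  relation \<open>x y = q y x\<close> to \<open>rho = Gx y + x Gy - q (y Gx + Gy x)\<close>. In degree \<open>0\<close> this equation is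
  a hypothesis; in higher degrees \<open>Gx = 0\<close> and a recursively defined \<open>Gy\<close> solve it.
\<close>

definition rho :: "('k qp list \<Rightarrow> 'k qp) \<Rightarrow> 'k qp list \<Rightarrow> 'k qp" where
  "rho f bs = f (X # Y # bs) - q *s f (Y # X # bs)"

context
  fixes f :: "'k qp list \<Rightarrow> 'k qp" and A B :: "'k qp" and N :: nat
  assumes cocycle: "cocycle f" and vanishes: "vanishes_from N f"
    and f_Nil: "f [] = 0" and f_X: "f [X] = 0" and f_Y: "f [Y] = 0"
    and rho_f: "rho f [] = A \<cdot> Y + X \<cdot> B - q *s (Y \<cdot> A + B \<cdot> X)"
begin

fun Gx :: "'k qp list \<Rightarrow> 'k qp" where
  "Gx [] = A"
| "Gx (c # cs) = 0"

text \<open>On nonempty lists the relation reads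
  \<open>X gy_mo(i, j) - q^(i+1) gy_mo(i, j+1) = rho f\<close> at \<open>y^i x^j\<close>, and is
  solved here for the next value. One factor \<open>q\<close> belongs to the relation,
  \<open>q^i\<close> to \<open>X \<cdot> mo i j\<close>. The start \<open>j = 0\<close> is a free
  choice.\<close>

fun gy_mo :: "nat \<Rightarrow> nat \<Rightarrow> 'k qp list \<Rightarrow> 'k qp" where
  "gy_mo i 0 cs = 0"
| "gy_mo i (Suc j) cs = inverse q ^ Suc i *s (X \<cdot> gy_mo i j cs - rho f (mo i j # cs))"

fun Gy :: "'k qp list \<Rightarrow> 'k qp" where
  "Gy [] = B"
| "Gy (c # cs) = plift (\<lambda>m. gy_mo (fst m) (snd m) cs) c"

fun g_mo :: "nat \<Rightarrow> nat \<Rightarrow> 'k qp list \<Rightarrow> 'k qp" where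
  "g_mo 0 0 cs = 0"
| "g_mo 0 (Suc l) cs = X \<cdot> g_mo 0 l cs + ract Gx (mo 0 l) cs - f (X # mo 0 l # cs)"
| "g_mo (Suc k) l cs = Y \<cdot> g_mo k l cs + ract Gy (mo k l) cs - f (Y # mo k l # cs)"

fun primitive :: "'k qp list \<Rightarrow> 'k qp" where
  "primitive [] = 0"
| "primitive (c # cs) = plift (\<lambda>m. g_mo (fst m) (snd m) cs) c"

lemma mlin_f: "mlin f"
  by (rule cocycle_mlin[OF cocycle])

lemma mlin_f2: "mlin (\<lambda>cs. f (a # b # cs))"
  using mlin_tl[OF mlin_tl[OF mlin_f, of a], of b] .

lemma mlin_rho: "mlin (rho f)"
  unfolding rho_def[abs_def] by (intro mlin_diff mlin_scale mlin_f2)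

lemma mlin_Gx: "mlin Gx"
  by (rule mlin_Cons) (simp_all add: mlin_zero)

lemma mlin_gy_mo: "mlin (gy_mo i j)"
proof (induction j)
  case (Suc j)
  show ?case
    unfolding gy_mo.simps(2)[abs_def] by (intro mlin_scale mlin_diff mlin_lmul Suc mlin_tl[OF mlin_rho])
qed (simp add: mlin_zero)

lemma mlin_Gy: "mlin Gy"
  by (rule mlin_plift_Cons[of gy_mo]) (simp_all add: mlin_gy_mo)

lemma mlin_g_mo: "mlin (g_mo k l)"
proof (induction k)
  case 0
  show ?case
  proof (induction l)
    case (Suc l)
    show ?case
      unfolding g_mo.simps(2)[abs_def] by (intro mlin_diff mlin_add mlin_lmul Suc mlin_ract mlin_Gx mlin_f2)
  qed (simp add: mlin_zero)
next
  case (Suc k)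
  show ?case
    unfolding g_mo.simps(3)[abs_def] by (intro mlin_diff mlin_add mlin_lmul Suc mlin_ract mlin_Gy mlin_f2)
qed

lemma mlin_primitive: "mlin primitive"
  by (rule mlin_plift_Cons[of g_mo]) (simp_all add: mlin_g_mo)

lemma cochain_primitive: "cochain primitive"
proof -
  have f0: "f cs = 0" if "N \<le> length cs" for cs
    using vanishes that by (auto simp: vanishes_from_def)
  have gy: "gy_mo i j cs = 0" if "N \<le> length cs" for i j cs
    using that by (induction j) (simp_all add: f0 rho_def)
  have Gx: "vanishes_from (Suc N) Gx"
    unfolding vanishes_from_def
  proof (intro allI impI)
    show "Gx cs = 0" if "Suc N \<le> length cs" for cs using that by (cases cs) simp_all
  qed
  have Gy: "vanishes_from (Suc N) Gy"
    unfolding vanishes_from_def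
  proof (intro allI impI)
    show "Gy cs = 0" if "Suc N \<le> length cs" for cs using that by (cases cs) (simp_all add: gy)
  qed
  have g: "g_mo k l cs = 0" if "Suc N \<le> length cs" for k l cs
    using that
    by (induction k l cs rule: g_mo.induct) (simp_all add: vanishes_ract[OF Gx] vanishes_ract[OF Gy] f0)
  have "vanishes_from (Suc (Suc N)) primitive"
    unfolding vanishes_from_def
  proof (intro allI impI)
    show "primitive cs = 0" if "Suc (Suc N) \<le> length cs" for cs using that by (cases cs) (simp_all add: g)
  qed
  then show ?thesis
    using mlin_primitive by (auto simp: cochain_def)
qed

lemma relation: "ract Gx Y cs + X \<cdot> Gy cs - q *s (Y \<cdot> Gx cs + ract Gy X cs) = rho f cs"
proof (cases cs)
  case Nil
  then show ?thesis by (simp add: rho_f)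
next
  case (Cons c cs')
  \<comment> \<open>\<open>rho f\<close> vanishes at \<open>1\<close>. Hence \<open>Gy\<close>
    vanishes on nonempty lists that start with \<open>X\<close> followed by further arguments, and
    the second term of the right action by \<open>X\<close> disappears.\<close>
  have g01: "gy_mo 0 (Suc 0) = (\<lambda>cs. 0)"
    using mlin_hd(3)[OF mlin_rho] by (simp add: fun_eq_iff)
  have "X \<cdot> Gy (c # cs') - q *s Gy ((X \<cdot> c) # cs') = rho f (c # cs')"
    by (rule linear_ext_mo[of "\<lambda>c. X \<cdot> Gy (c # cs') - q *s Gy ((X \<cdot> c) # cs')" "\<lambda>c. rho f (c # cs')"])
      (simp_all add: mul_simps mlin_hd[OF mlin_rho] plift_add plift_scale scale_simps power_inverse algebra_simps)
  then show ?thesis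
    by (simp add: Cons g01)
qed

text \<open>The recursion for \<open>g_mo\<close> strips letters \<open>y\<close> first, so for
  \<open>k > 0\<close> the equation at lists starting with \<open>X\<close> is not built in. The
  induction moves \<open>X\<close> past one \<open>Y\<close>; the defect is the equation
  \<open>relation\<close>, acted on from the right by the monomial.\<close>

lemma g_mo_X:
  "X \<cdot> g_mo k l cs - q ^ k *s g_mo k (Suc l) cs + ract Gx (mo k l) cs = f (X # mo k l # cs)"
proof (induction k arbitrary: l cs)
  case (Suc k)
  let ?c = "mo k l"
  have 1: "q ^ k *s g_mo k (Suc l) cs = X \<cdot> g_mo k l cs + ract Gx ?c cs - f (X # ?c # cs)"
    using Suc[of l cs] by (simp add: algebra_simps)
  have 2: "q ^ k *s ract Gy (mo k (Suc l)) cs = ract Gy (X \<cdot> ?c) cs"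
    by (simp add: ract_scale_right mlin_Gy)
  have 3: "q ^ k *s f (Y # mo k (Suc l) # cs) = f (Y # (X \<cdot> ?c) # cs)"
    by (simp add: mlin_snd[OF mlin_f])
  have "q ^ Suc k *s g_mo (Suc k) (Suc l) cs
      = q *s (Y \<cdot> (q ^ k *s g_mo k (Suc l) cs) + q ^ k *s ract Gy (mo k (Suc l)) cs
        - q ^ k *s f (Y # mo k (Suc l) # cs))"
    by (simp add: mul_simps scale_simps)
  also have "\<dots> = q *s (Y \<cdot> (X \<cdot> g_mo k l cs + ract Gx ?c cs - f (X # ?c # cs)) + ract Gy (X \<cdot> ?c) cs
        - f (Y # (X \<cdot> ?c) # cs))"
    by (simp only: 1 2 3)
  finally have 4: "q ^ Suc k *s g_mo (Suc k) (Suc l) cs = \<dots>" .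
  have "ract (\<lambda>cs. ract Gx Y cs + X \<cdot> Gy cs - q *s (Y \<cdot> Gx cs + ract Gy X cs)) ?c cs = ract (rho f) ?c cs"
    by (simp only: relation)
  then have 5: "ract Gx (Y \<cdot> ?c) cs + X \<cdot> ract Gy ?c cs - q *s (Y \<cdot> ract Gx ?c cs + ract Gy (X \<cdot> ?c) cs)
      = ract (\<lambda>cs. f (X # Y # cs)) ?c cs - q *s ract (\<lambda>cs. f (Y # X # cs)) ?c cs"
    by (simp only: ract_add ract_diff ract_scale ract_lmul ract_ract rho_def[abs_def])
  have 6: "X \<cdot> f (Y # ?c # cs) + f (X # (Y \<cdot> ?c) # cs) = f ((X \<cdot> Y) # ?c # cs) + ract (\<lambda>cs. f (X # Y # cs)) ?c cs"
    using cocycle_Cons[OF cocycle, of X Y "?c # cs"] by simp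
  have 7: "Y \<cdot> f (X # ?c # cs) + f (Y # (X \<cdot> ?c) # cs) = f ((Y \<cdot> X) # ?c # cs) + ract (\<lambda>cs. f (Y # X # cs)) ?c cs"
    using cocycle_Cons[OF cocycle, of Y X "?c # cs"] by simp
  have 8: "f ((X \<cdot> Y) # ?c # cs) = q *s f ((Y \<cdot> X) # ?c # cs)"
    by (simp add: mlin_hd[OF mlin_f])
  have "X \<cdot> g_mo (Suc k) l cs - q ^ Suc k *s g_mo (Suc k) (Suc l) cs + ract Gx (Y \<cdot> ?c) cs
      = (ract Gx (Y \<cdot> ?c) cs + X \<cdot> ract Gy ?c cs - q *s (Y \<cdot> ract Gx ?c cs + ract Gy (X \<cdot> ?c) cs))
        - X \<cdot> f (Y # ?c # cs) + q *s (Y \<cdot> f (X # ?c # cs) + f (Y # (X \<cdot> ?c) # cs))"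
    unfolding 4 by (simp only: g_mo.simps mul_simps scale_simps XY_assoc) (simp add: algebra_simps)
  also have "\<dots> = f (X # (Y \<cdot> ?c) # cs)"
    unfolding 5 7 using 6 8 by (simp add: scale_simps algebra_simps)
  finally show ?case by (simp only: Y_mo)
qed simp

lemma delta_primitive: "delta primitive = f"
proof -
  have pX: "(\<lambda>cs. primitive (X # cs)) = Gx"
    by (simp add: fun_eq_iff ract_unit[OF mlin_Gx] mlin_snd(3)[OF mlin_f])
  have pY: "(\<lambda>cs. primitive (Y # cs)) = Gy"
    by (simp add: fun_eq_iff ract_unit[OF mlin_Gy] mlin_snd(3)[OF mlin_f])
  have X: "delta primitive (X # cs) = f (X # cs)" for cs
  proof (cases cs)
    case (Cons c cs')
    have "X \<cdot> primitive (c # cs') - primitive ((X \<cdot> c) # cs') + ract Gx c cs' = f (X # c # cs')"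
      by (rule linear_ext_mo[of "\<lambda>c. X \<cdot> primitive (c # cs') - primitive ((X \<cdot> c) # cs') + ract Gx c cs'"])
        (use g_mo_X in \<open>simp_all add: mul_simps plift_add plift_scale mlin_snd[OF mlin_f]
          ract_add_right[OF mlin_Gx] ract_scale_right[OF mlin_Gx] scale_simps algebra_simps del: g_mo.simps\<close>)
    then show ?thesis by (simp add: Cons pX algebra_simps del: primitive.simps)
  qed (simp add: f_X)
  have Y: "delta primitive (Y # cs) = f (Y # cs)" for cs
  proof (cases cs)
    case (Cons c cs')
    have "Y \<cdot> primitive (c # cs') - primitive ((Y \<cdot> c) # cs') + ract Gy c cs' = f (Y # c # cs')"
      by (rule linear_ext_mo[of "\<lambda>c. Y \<cdot> primitive (c # cs') - primitive ((Y \<cdot> c) # cs') + ract Gy c cs'"])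
        (simp_all add: mul_simps plift_add plift_scale mlin_snd[OF mlin_f]
          ract_add_right[OF mlin_Gy] ract_scale_right[OF mlin_Gy] scale_simps)
    then show ?thesis by (simp add: Cons pY algebra_simps del: primitive.simps)
  qed (simp add: f_Y)
  \<comment> \<open>A cocycle that vanishes at \<open>[]\<close> and on all lists starting with a
    generator is zero, so these two cases give the equation everywhere.\<close>
  let ?h = "\<lambda>cs. delta primitive cs - f cs"
  have "cocycle ?h"
    unfolding cocycle_def using cocycle
    by (simp add: cochain_diff cochain_delta cochain_primitive cocycle_def delta_diff[abs_def] delta_delta)
  then have "?h = (\<lambda>_. 0)"
    by (rule cocycle_eqI) (simp_all add: f_Nil X Y del: delta.simps(2))
  then show ?thesis by (simp add: fun_eq_iff)
qed

end

type_synonym (in -) 'k h5 = "'k \<times> 'k \<times> 'k \<times> 'k \<times> 'k"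

text \<open>
  The coordinates of a cohomology class. The last two are scaled so that the classes \<open>u\<close> and \<open>v\<close>
  of the theorem become basis vectors.
\<close>

definition psi :: "('k qp list \<Rightarrow> 'k qp) \<Rightarrow> 'k h5" where
  "psi f = (lookup (f []) (0, 0), lookup (f [X]) (0, 1), lookup (f [Y]) (1, 0),
     lookup (rho f []) (0, 0) / (1 - q), lookup (rho f []) (1, 1) / q)"

lemma psi_add: "psi (\<lambda>as. f as + g as) = psi f + psi g"
  by (simp add: psi_def rho_def lookup_add lookup_minus scale_simps add_divide_distrib diff_divide_distrib algebra_simps)

lemma psi_minus: "psi (\<lambda>as. - f as) = - psi f"
  by (simp add: psi_def rho_def lookup_minus uminus_prod_def add_divide_distrib diff_divide_distrib algebra_simps)

lemma psi_diff: "psi (\<lambda>as. f as - g as) = psi f - psi g"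
  using psi_add[of f "\<lambda>as. - g as"] by (simp add: psi_minus)

definition h5_scale :: "'k \<Rightarrow> 'k h5 \<Rightarrow> 'k h5" where
  "h5_scale s = (\<lambda>(a, b, c, d, e). (s * a, s * b, s * c, s * d, s * e))"

text \<open>The only product of positive-degree elements that survives is that of two combinations
  of the Euler derivations \<open>x d/dx\<close> and \<open>y d/dy\<close>; it is minus the
  determinant of their coefficients, in the last coordinate.\<close>

definition h5_mul :: "'k h5 \<Rightarrow> 'k h5 \<Rightarrow> 'k h5" where
  "h5_mul = (\<lambda>(a, b, c, d, e) (a', b', c', d', e').
     (a * a', a * b' + b * a', a * c' + c * a', a * d' + d * a', a * e' + e * a' + c * b' - b * c'))"

lemma psi_scale: "psi (\<lambda>as. s *s f as) = h5_scale s (psi f)"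
  by (simp add: psi_def rho_def h5_scale_def lookup_minus algebra_simps)

lemma cocycle_XY:
  assumes "cocycle f"
  shows "f [X] \<cdot> Y + X \<cdot> f [Y] = q *s (Y \<cdot> f [X] + f [Y] \<cdot> X)"
proof -
  have "f [X \<cdot> Y] = q *s f [Y \<cdot> X]"
    by (simp add: mlin_hd[OF cocycle_mlin[OF assms]])
  then show ?thesis
    unfolding cocycle_singleton[OF assms] by (simp add: add.commute)
qed

lemma cocycle_delta: "cochain g \<Longrightarrow> cocycle (delta g)"
  by (simp add: cocycle_def cochain_delta fun_eq_iff delta_delta)

text \<open>A commutator with \<open>x\<close> has no term \<open>x\<close>, and one with
  \<open>y\<close> no term \<open>y\<close>. In \<open>rho (delta g) []\<close> the values of
  \<open>g\<close> at \<open>x y\<close> and \<open>y x\<close> cancel, and what is left has the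
  form treated in \<open>relation_values\<close>.\<close>

lemma psi_delta:
  assumes "cochain g"
  shows "psi (delta g) = 0"
proof -
  have "rho (delta g) [] = g [X] \<cdot> Y + X \<cdot> g [Y] - q *s (Y \<cdot> g [X] + g [Y] \<cdot> X)"
    using assms by (simp add: rho_def cochain_def mlin_hd scale_simps algebra_simps)
  then show ?thesis
    using relation_values[of "g [X]" "g [Y]"] by (simp add: psi_def zero_prod_def lookup_minus lookup_XY)
qed

text \<open>Each coordinate is the obstruction to one stage: \<open>f []\<close> is central and so a
  scalar, the derivation part is inner, and the remaining relation equation is solvable.\<close>

lemma psi_eq_0D:
  assumes "cocycle f" "psi f = 0"
  obtains g where "cochain g" "f = delta g"
proof -
  have z: "lookup (f []) (0, 0) = 0" "lookup (f [X]) (0, 1) = 0" "lookup (f [Y]) (1, 0) = 0"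
    "lookup (rho f []) (0, 0) = 0" "lookup (rho f []) (1, 1) = 0"
    using assms(2) by (simp_all add: psi_def zero_prod_def)
  have f0: "f [] = 0"
    using central_scalar[OF cocycle_nil cocycle_nil, OF assms(1,1)] z(1) by simp
  obtain h where h: "f [X] = X \<cdot> h - h \<cdot> X" "f [Y] = Y \<cdot> h - h \<cdot> Y"
    using inner_derivation[OF cocycle_XY[OF assms(1)] z(2,3)] .
  \<comment> \<open>The cochain of degree 0 whose coboundary is the inner derivation. It does not
    affect values on two arguments, so \<open>rho\<close> at \<open>[]\<close> stays the
    same.\<close>
  define g0 where "g0 = (\<lambda>as :: 'k qp list. if as = [] then h else 0)"
  have "cochain g0"
    unfolding cochain_def vanishes_from_def g0_def by (auto intro!: mlinI exI[of _ 1])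
  define f' where "f' = (\<lambda>as. f as - delta g0 as)"
  have cf': "cocycle f'"
    using assms(1) \<open>cochain g0\<close>
    by (simp add: cocycle_def f'_def cochain_diff cochain_delta delta_diff[abs_def] delta_delta)
  have f': "f' [] = 0" "f' [X] = 0" "f' [Y] = 0" "rho f' [] = rho f []"
    by (simp_all add: f'_def f0 h g0_def rho_def)
  obtain A B where AB: "rho f' [] = A \<cdot> Y + X \<cdot> B - q *s (Y \<cdot> A + B \<cdot> X)"
    using relation_solution[of "rho f' []"] z(4,5) unfolding f'(4) by metis
  obtain N where N: "vanishes_from N f'"
    using cf' by (auto simp: cocycle_def cochain_def)
  note * = cf' N f'(1-3) AB
  have "delta (\<lambda>as. g0 as + primitive f' A B as) as = f as" for as
    unfolding delta_add delta_primitive[OF *] by (simp add: f'_def)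
  then have "f = delta (\<lambda>as. g0 as + primitive f' A B as)"
    by (simp add: fun_eq_iff)
  moreover have "cochain (\<lambda>as. g0 as + primitive f' A B as)"
    by (rule cochain_add) (use \<open>cochain g0\<close> cochain_primitive[OF *] in auto)
  ultimately show ?thesis using that by blast
qed

lemma lookup_mo_mul:
  "lookup (mo i j \<cdot> b) (r, s) = (if i \<le> r \<and> j \<le> s then q ^ (j * (r - i)) * lookup b (r - i, s - j) else 0)"
  by (rule lookup_linear_ext[of _ _ b]) (auto simp: mul_simps lookup_add lookup_mo algebra_simps)

lemma lookup_mul_0: "lookup (a \<cdot> b) (0, 0) = lookup a (0, 0) * lookup b (0, 0)"
  by (rule lookup_linear_ext[of _ _ a])
    (auto simp: mul_simps lookup_add lookup_mo lookup_mo_mul algebra_simps)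

text \<open>The four ways of writing \<open>y x\<close> as a product of two monomials;
  \<open>q\<close> comes from \<open>x y\<close>.\<close>

lemma lookup_mul_1: "lookup (a \<cdot> b) (Suc 0, Suc 0) = lookup a (0, 0) * lookup b (Suc 0, Suc 0)
    + lookup a (Suc 0, Suc 0) * lookup b (0, 0) + lookup a (Suc 0, 0) * lookup b (0, Suc 0)
    + q * (lookup a (0, Suc 0) * lookup b (Suc 0, 0))"
proof (rule lookup_linear_ext[of _ _ a])
  show "lookup (mo i j \<cdot> b) (Suc 0, Suc 0) = lookup (mo i j) (0, 0) * lookup b (Suc 0, Suc 0)
    + lookup (mo i j) (Suc 0, Suc 0) * lookup b (0, 0) + lookup (mo i j) (Suc 0, 0) * lookup b (0, Suc 0)
    + q * (lookup (mo i j) (0, Suc 0) * lookup b (Suc 0, 0))" for i j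
    by (cases i; cases j) (auto simp: lookup_mo_mul lookup_mo)
qed (simp_all add: mul_simps lookup_add algebra_simps)

text \<open>\<open>f []\<close> and \<open>g []\<close> are scalars. In the product of the degree-1
  parts, \<open>derivation_values\<close> removes all contributions to the coefficients of
  \<open>1\<close> and \<open>y x\<close> except those of \<open>x\<close> in the values at
  \<open>x\<close> and of \<open>y\<close> in the values at \<open>y\<close>.\<close>

lemma psi_scup:
  assumes f: "cocycle f" and g: "cocycle g"
  shows "psi (scup f g) = h5_mul (psi f) (psi g)"
proof -
  obtain s where s: "f [] = s *s mo 0 0"
    using central_scalar cocycle_nil[OF f] by blast
  obtain t where t: "g [] = t *s mo 0 0"
    using central_scalar cocycle_nil[OF g] by blast
  note dv = derivation_values[OF cocycle_XY[OF f]] derivation_values[OF cocycle_XY[OF g]]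
  have 0: "scup f g [] = (s * t) *s mo 0 0"
    by (simp add: scup_def s t mul_simps)
  have 1: "scup f g [a] = s *s g [a] + t *s f [a]" for a
    by (simp add: scup_def s t mul_simps)
  have 2: "scup f g [a, b] = s *s g [a, b] - f [a] \<cdot> g [b] + t *s f [a, b]" for a b
    by (simp add: scup_def alt_Cons minus_mul s t mul_simps)
  have inv: "q * (inverse q * z) = z" "q * (r * (inverse q * z)) = r * z" for r z
    by simp_all
  show ?thesis
    by (simp add: psi_def h5_mul_def rho_def 0 1 2 s t lookup_mo lookup_add lookup_minus lookup_mul_0 lookup_mul_1
        dv(1,2,4,5) divide_inverse algebra_simps inv)
qed

section \<open>Explicit cocycles with prescribed coordinates\<close>

definition dx :: "'k qp \<Rightarrow> 'k qp" where
  "dx = plift (\<lambda>m. of_nat (snd m) *s mo (fst m) (snd m))"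

definition dy :: "'k qp \<Rightarrow> 'k qp" where
  "dy = plift (\<lambda>m. of_nat (fst m) *s mo (fst m) (snd m))"

definition qnum :: "nat \<Rightarrow> 'k" where
  "qnum n = (\<Sum>i<n. q ^ i)"

lemma qnum_simps [simp]: "qnum 0 = 0" "qnum (Suc n) = q ^ n + qnum n"
  by (simp_all add: qnum_def)

lemma qnum_add: "qnum (m + n) = qnum n + q ^ n * qnum m"
  by (induction m) (simp_all add: algebra_simps power_add)

text \<open>
  The \<open>q\<close>-derivatives \<open>d1\<close>, \<open>d2\<close> in the directions \<open>x\<close>, \<open>y\<close> are twisted derivations for the same
  automorphism \<open>theta\<close>, so \<open>d1 a \<cdot> d2 b\<close> is a \<open>2\<close>-cocycle: the infinitesimal deformation of the quantum
  plane into the quantum Weyl algebra.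
\<close>

definition d1 :: "'k qp \<Rightarrow> 'k qp" where
  "d1 = plift (\<lambda>m. qnum (snd m) *s mo (fst m) (snd m - 1))"

definition d2 :: "'k qp \<Rightarrow> 'k qp" where
  "d2 = plift (\<lambda>m. qnum (fst m) *s mo (fst m - 1) (snd m))"

definition theta :: "'k qp \<Rightarrow> 'k qp" where
  "theta = plift (\<lambda>m. q ^ (fst m + snd m) *s mo (fst m) (snd m))"

lemma d_mo [simp]:
  "dx (mo i j) = of_nat j *s mo i j" "dy (mo i j) = of_nat i *s mo i j"
  "d1 (mo i j) = qnum j *s mo i (j - 1)" "d2 (mo i j) = qnum i *s mo (i - 1) j"
  "theta (mo i j) = q ^ (i + j) *s mo i j"
  by (simp_all add: dx_def dy_def d1_def d2_def theta_def)

lemma d_linear: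
  "dx (a + b) = dx a + dx b" "dx (s *s a) = s *s dx a" "dy (a + b) = dy a + dy b" "dy (s *s a) = s *s dy a"
  "d1 (a + b) = d1 a + d1 b" "d1 (s *s a) = s *s d1 a" "d2 (a + b) = d2 a + d2 b" "d2 (s *s a) = s *s d2 a"
  "theta (a + b) = theta a + theta b" "theta (s *s a) = s *s theta a"
  by (simp_all add: dx_def dy_def d1_def d2_def theta_def plift_add plift_scale)

lemma bilinear_ext_mo:
  assumes "\<And>a a' b. L (a + a') b = L a b + L a' b" "\<And>s a b. L (s *s a) b = s *s L a b"
    "\<And>a b b'. L a (b + b') = L a b + L a b'" "\<And>s a b. L a (s *s b) = s *s L a b"
    "\<And>a a' b. M (a + a') b = M a b + M a' b" "\<And>s a b. M (s *s a) b = s *s M a b"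
    "\<And>a b b'. M a (b + b') = M a b + M a b'" "\<And>s a b. M a (s *s b) = s *s M a b"
    and "\<And>i j k l. L (mo i j) (mo k l) = M (mo i j) (mo k l)"
  shows "L a b = (M a b :: 'k qp)"
proof -
  have *: "L (mo i j) b = M (mo i j) b" for i j
    by (rule linear_ext_mo[of "L (mo i j)" "M (mo i j)"]) (simp_all only: assms)
  show ?thesis
    by (rule linear_ext_mo[of "\<lambda>a. L a b" "\<lambda>a. M a b"]) (simp_all only: assms *)
qed

lemma dx_mul: "dx (a \<cdot> b) = dx a \<cdot> b + a \<cdot> dx b"
  by (rule bilinear_ext_mo[of "\<lambda>a b. dx (a \<cdot> b)"])
    (simp_all add: mul_simps d_linear scale_simps algebra_simps)

lemma dy_mul: "dy (a \<cdot> b) = dy a \<cdot> b + a \<cdot> dy b"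
  by (rule bilinear_ext_mo[of "\<lambda>a b. dy (a \<cdot> b)"])
    (simp_all add: mul_simps d_linear scale_simps algebra_simps)

lemma d1_mul: "d1 (a \<cdot> b) = a \<cdot> d1 b + d1 a \<cdot> theta b"
proof (rule bilinear_ext_mo[of "\<lambda>a b. d1 (a \<cdot> b)"])
  fix i j k l
  show "d1 (mo i j \<cdot> mo k l) = mo i j \<cdot> d1 (mo k l) + d1 (mo i j) \<cdot> theta (mo k l)"
  proof -
    let ?m = "q ^ (j * k) *s mo (i + k) (j + l - 1)"
    have "mo i j \<cdot> d1 (mo k l) = qnum l *s ?m"
      by (cases l) (simp_all add: mul_simps)
    moreover have "d1 (mo i j) \<cdot> theta (mo k l) = (q ^ l * qnum j) *s ?m"
      by (cases j) (simp_all add: mul_simps power_add ac_simps del: qnum_simps(2))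
    moreover have "d1 (mo i j \<cdot> mo k l) = qnum (j + l) *s ?m"
      by (simp add: d_linear mult.commute)
    ultimately show ?thesis
      by (simp only: qnum_add scale_left_distrib)
  qed
qed (simp_all add: mul_simps d_linear scale_simps algebra_simps)

lemma d2_mul: "d2 (a \<cdot> b) = d2 a \<cdot> b + theta a \<cdot> d2 b"
proof (rule bilinear_ext_mo[of "\<lambda>a b. d2 (a \<cdot> b)"])
  fix i j k l
  show "d2 (mo i j \<cdot> mo k l) = d2 (mo i j) \<cdot> mo k l + theta (mo i j) \<cdot> d2 (mo k l)"
  proof -
    let ?m = "q ^ (j * k) *s mo (i + k - 1) (j + l)"
    have "d2 (mo i j) \<cdot> mo k l = qnum i *s ?m"
      by (cases i) (simp_all add: mul_simps)
    moreover have "theta (mo i j) \<cdot> d2 (mo k l) = (q ^ i * qnum k) *s ?m"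
      by (cases k) (simp_all add: mul_simps power_add ac_simps del: qnum_simps(2))
    moreover have "d2 (mo i j \<cdot> mo k l) = qnum (k + i) *s ?m"
      by (simp add: d_linear mult.commute add.commute)
    ultimately show ?thesis
      by (simp only: qnum_add scale_left_distrib)
  qed
qed (simp_all add: mul_simps d_linear scale_simps algebra_simps)

text \<open>A cocycle for every quintuple. The product of \<open>q\<close>-derivatives has the value
  1 at \<open>[x, y]\<close> and 0 at \<open>[y, x]\<close>, so the factor \<open>1 - q\<close>
  matches the division in \<open>psi\<close>; the product of the Euler derivations has the value
  \<open>x y = q y x\<close> at \<open>[x, y]\<close>, which matches the division by
  \<open>q\<close>.\<close>

fun rep :: "'k h5 \<Rightarrow> 'k qp list \<Rightarrow> 'k qp" where
  "rep (w, wx, wy, wu, wv) [] = w *s mo 0 0"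
| "rep (w, wx, wy, wu, wv) [a] = wx *s dx a + wy *s dy a"
| "rep (w, wx, wy, wu, wv) [a, b] = ((1 - q) * wu) *s (d1 a \<cdot> d2 b) + wv *s (dx a \<cdot> dy b)"
| "rep w (a # b # c # as) = 0"

lemma mlin_rep: "mlin (rep w)"
proof -
  obtain w0 wx wy wu wv where w: "w = (w0, wx, wy, wu, wv)" by (cases w)
  have "mlin (\<lambda>cs. rep w (a # b # cs))" for a b
  proof (rule mlin_Cons)
    show "mlin (\<lambda>cs. rep w (a # b # c # cs))" for c by (simp add: mlin_zero)
  qed simp_all
  then have "mlin (\<lambda>cs. rep w (a # cs))" for a
  proof (rule mlin_Cons)
    fix b b' s and bs :: "'k qp list"
    show "rep w (a # (b + b') # bs) = rep w (a # b # bs) + rep w (a # b' # bs)"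
      "rep w (a # (s *s b) # bs) = s *s rep w (a # b # bs)" "rep w (a # mo 0 0 # bs) = 0"
      by (cases bs; simp add: w d_linear mul_simps scale_simps algebra_simps)+
  qed
  then show ?thesis
  proof (rule mlin_Cons)
    fix b b' s and bs :: "'k qp list"
    show "rep w ((b + b') # bs) = rep w (b # bs) + rep w (b' # bs)"
      "rep w ((s *s b) # bs) = s *s rep w (b # bs)" "rep w (mo 0 0 # bs) = 0"
      by (induct w bs rule: rep.induct; simp add: w d_linear mul_simps scale_simps algebra_simps)+
  qed
qed

lemma vanishes_rep: "vanishes_from 3 (rep w)"
  unfolding vanishes_from_def
proof (intro allI impI)
  show "rep w as = 0" if "3 \<le> length as" for as
    using that by (induct w as rule: rep.induct) simp_all
qed

lemma cocycle_rep: "cocycle (rep w)"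
proof -
  obtain w0 wx wy wu wv where w: "w = (w0, wx, wy, wu, wv)" by (cases w)
  have "delta (rep w) as = 0" for as
  proof -
    consider "as = []" | a where "as = [a]" | a b where "as = [a, b]" | a b c where "as = [a, b, c]"
      | a b c d cs where "as = a # b # c # d # cs"
      by (metis list.exhaust)
    then show ?thesis
    proof cases
      \<comment> \<open>From length 4 on the coboundary vanishes because \<open>rep w\<close> does
        from length 3 on. The shorter lists are covered by the Leibniz rules, plain and
        twisted.\<close>
      case 5
      then have "Suc 3 \<le> length as" by simp
      then show ?thesis
        using vanishes_delta[OF vanishes_rep] by (simp add: vanishes_from_def)
    qed (simp_all add: w dx_mul dy_mul d1_mul d2_mul mul_simps scale_simps mul_assoc algebra_simps)
  qed
  then show ?thesis
    using mlin_rep[of w] vanishes_rep[of w] by (auto simp: cocycle_def cochain_def fun_eq_iff)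
qed

lemma psi_rep: "psi (rep w) = w"
proof -
  obtain w0 wx wy wu wv where w: "w = (w0, wx, wy, wu, wv)" by (cases w)
  show ?thesis by (simp add: w psi_def rho_def lookup_mo lookup_add lookup_minus)
qed

end

section \<open>Algebras given by a record\<close>

lemma cring_field_ring: "cring (field_ring :: 'k::field ring)"
  by (rule cringI; (rule abelian_groupI comm_monoidI)?)
    (auto simp: field_ring_def algebra_simps intro: exI[of _ "- x" for x])

text \<open>
  All computations take place in an algebra on a type, where no carrier conditions arise; \<open>abs\<close> transports
  them to the algebra \<open>A\<close> given by a record.
\<close>

locale alg_model = k_algebra scale mul unit
  for scale :: "'k::field \<Rightarrow> 'b::ab_group_add \<Rightarrow> 'b" (infixr "*s" 75)
    and mul :: "'b \<Rightarrow> 'b \<Rightarrow> 'b" (infixl "\<cdot>" 70) and unit :: 'b +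
  fixes A :: "('k, 'a) module" and abs :: "'b \<Rightarrow> 'a"
  assumes inj_abs: "inj abs" and carrier_A: "carrier A = range abs"
    and abs_mul: "abs a \<otimes>\<^bsub>A\<^esub> abs b = abs (a \<cdot> b)" and abs_add: "abs a \<oplus>\<^bsub>A\<^esub> abs b = abs (a + b)"
    and abs_smult: "s \<odot>\<^bsub>A\<^esub> abs a = abs (s *s a)"
    and abs_one: "\<one>\<^bsub>A\<^esub> = abs unit" and abs_zero: "\<zero>\<^bsub>A\<^esub> = abs 0"
begin

lemma abs_eq_iff [simp]: "abs a = abs b \<longleftrightarrow> a = b"
  using inj_abs by (auto dest: injD)

lemma abs_closed [simp]: "abs a \<in> carrier A"
  by (simp add: carrier_A)

lemma ball_carrier: "(\<forall>x\<in>carrier A. P x) \<longleftrightarrow> (\<forall>a. P (abs a))"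
  by (simp add: carrier_A)

lemma abelian_group_A: "abelian_group A"
proof (rule abelian_groupI)
  fix x assume "x \<in> carrier A"
  then obtain a where "x = abs a" by (auto simp: carrier_A)
  then have "abs (- a) \<oplus>\<^bsub>A\<^esub> x = \<zero>\<^bsub>A\<^esub>" by (simp add: abs_add abs_zero)
  then show "\<exists>y\<in>carrier A. y \<oplus>\<^bsub>A\<^esub> x = \<zero>\<^bsub>A\<^esub>" by (rule bexI) simp
qed (auto simp: carrier_A abs_add abs_zero algebra_simps)

lemma ring_A: "ring A"
proof (rule ringI)
  show "Group.monoid A"
    by (rule monoidI) (auto simp: carrier_A abs_mul abs_one mul_assoc)
qed (auto simp: abelian_group_A carrier_A abs_add abs_mul mul_simps)

lemma module_A: "Module.module field_ring A"
proof (rule moduleI)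
  show "cring (field_ring :: 'k ring)" by (rule cring_field_ring)
qed (auto simp: abelian_group_A carrier_A abs_add abs_smult scale_simps scale_left_distrib
    field_ring_def abs_zero)

lemma assoc_algebra_A: "assoc_algebra A"
  by (auto simp: assoc_algebra_def ring_A module_A carrier_A abs_smult abs_mul mul_simps)

lemma abs_minus: "\<ominus>\<^bsub>A\<^esub> abs a = abs (- a)"
  by (rule abelian_group.minus_equality[OF abelian_group_A]) (simp_all add: abs_add abs_zero)

lemma abs_diff: "abs a \<ominus>\<^bsub>A\<^esub> abs b = abs (a - b)"
  by (simp add: a_minus_def abs_minus abs_add)

lemma abs_finsum: "finite I \<Longrightarrow> (\<Oplus>\<^bsub>A\<^esub>i\<in>I. abs (f i)) = abs (\<Sum>i\<in>I. f i)"
proof (induction I rule: finite_induct)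
  case empty
  then show ?case
    by (simp add: abelian_monoid.finsum_empty[OF abelian_group.axioms(1)[OF abelian_group_A]] abs_zero)
next
  case (insert i I)
  then show ?case
    by (subst abelian_monoid.finsum_insert[OF abelian_group.axioms(1)[OF abelian_group_A]])
      (auto simp: abs_add)
qed

lemmas abs_simps = abs_mul abs_add abs_smult abs_one abs_zero abs_minus abs_diff

lemma carrierE: "x \<in> carrier A \<Longrightarrow> (\<And>a. x = abs a \<Longrightarrow> P) \<Longrightarrow> P"
  by (auto simp: carrier_A)

lemma lists_carrierE:
  assumes "xs \<in> lists (carrier A)" obtains as where "xs = map abs as"
proof -
  have "\<forall>x\<in>set xs. \<exists>a. x = abs a"
    using assms by (auto simp: carrier_A in_lists_conv_set)
  then show ?thesis
    using that unfolding ex_map_conv[symmetric] by blast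
qed

lemma map_abs_lists [simp]: "map abs as \<in> lists (carrier A)"
  by auto

lemma ball_lists: "(\<forall>xs\<in>lists (carrier A). P xs) \<longleftrightarrow> (\<forall>as. P (map abs as))"
  by (metis lists_carrierE map_abs_lists)

subsection \<open>The Hochschild complex\<close>

definition emb :: "('b list \<Rightarrow> 'b) \<Rightarrow> 'a list \<Rightarrow> 'a" where
  "emb f = (\<lambda>xs\<in>lists (carrier A). abs (f (map (inv_into UNIV abs) xs)))"

lemma emb_map [simp]: "emb f (map abs as) = abs (f as)"
  unfolding emb_def using map_abs_lists[of as]
  by (simp add: inj_abs o_def del: map_abs_lists)

lemma emb_Nil [simp]: "emb f [] = abs (f [])"
  using emb_map[of f "[]"] by simp

lemma restrict_eq_emb:
  assumes "\<And>as. F (map abs as) = abs (f as)"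
  shows "(\<lambda>xs\<in>lists (carrier A). F xs) = emb f"
proof
  show "(\<lambda>xs\<in>lists (carrier A). F xs) xs = emb f xs" for xs
  proof (cases "xs \<in> lists (carrier A)")
    case True
    then obtain as where "xs = map abs as" by (rule lists_carrierE)
    then show ?thesis using assms map_abs_lists[of as] by simp
  qed (simp add: emb_def)
qed

lemma emb_eq_iff [simp]: "emb f = emb g \<longleftrightarrow> f = g"
  by (metis emb_map abs_eq_iff ext)

lemma map_abs_Cons: "map abs as @ abs a # map abs bs = map abs (as @ a # bs)"
  by simp

lemma total_cochains_eq: "total_cochains A = emb ` {f. cochain f}"
proof (intro equalityI subsetI)
  fix F assume F: "F \<in> total_cochains A"
  define f where "f = (\<lambda>as. inv_into UNIV abs (F (map abs as)))"
  have *: "F (map abs as) = abs (f as)" for as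
  proof -
    have "F (map abs as) \<in> carrier A"
      using F map_abs_lists[of as] unfolding total_cochains_def by blast
    then show ?thesis
      by (auto simp: f_def carrier_A f_inv_into_f)
  qed
  have "F = restrict F (lists (carrier A))"
    using F unfolding total_cochains_def by (metis (no_types, lifting) PiE_restrict mem_Collect_eq)
  also have "\<dots> = emb f"
    by (rule restrict_eq_emb) (rule *)
  finally have F': "F = emb f" .
  have "(\<forall>as bs a b c. abs (f (as @ (a + b) # bs)) = abs (f (as @ a # bs) + f (as @ b # bs)) \<and>
      abs (f (as @ (c *s a) # bs)) = abs (c *s f (as @ a # bs)) \<and> abs (f (as @ unit # bs)) = abs 0) \<and>
     (\<exists>N. \<forall>as. N \<le> length as \<longrightarrow> abs (f as) = abs 0)"
    using F unfolding total_cochains_def ball_lists ball_carrier mem_Collect_eq abs_simps map_abs_Cons *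
    by (simp add: abs_simps)
  then have "cochain f"
    unfolding cochain_def mlin_def vanishes_from_def by simp
  with F' show "F \<in> emb ` {f. cochain f}" by blast
next
  fix F assume "F \<in> emb ` {f. cochain f}"
  then obtain f where f: "F = emb f" "cochain f" by auto
  have "emb f \<in> lists (carrier A) \<rightarrow>\<^sub>E carrier A"
    by (auto simp: emb_def)
  then show "F \<in> total_cochains A"
    using f(2) unfolding f(1) total_cochains_def ball_lists ball_carrier mem_Collect_eq abs_simps map_abs_Cons
      emb_map cochain_def mlin_def vanishes_from_def abs_eq_iff
    by (simp add: abs_simps)
qed

lemma emb_add: "emb f \<oplus>\<^bsub>HC A\<^esub> emb g = emb (\<lambda>as. f as + g as)"
  by (simp add: HC_def) (rule restrict_eq_emb, simp add: abs_simps)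

lemma emb_smult: "s \<odot>\<^bsub>HC A\<^esub> emb f = emb (\<lambda>as. s *s f as)"
  by (simp add: HC_def) (rule restrict_eq_emb, simp add: abs_simps)

lemma emb_zero: "\<zero>\<^bsub>HC A\<^esub> = emb (\<lambda>_. 0)"
  by (simp add: HC_def) (rule restrict_eq_emb, simp add: abs_simps)

lemma emb_one: "\<one>\<^bsub>HC A\<^esub> = emb (\<lambda>as. if as = [] then unit else 0)"
  by (simp add: HC_def) (rule restrict_eq_emb, simp add: abs_simps)

lemma cup_eq_sum: "cup f g as = (\<Sum>i\<in>{0..length as}. f (take i as) \<cdot> g (drop i as))"
proof (induction as arbitrary: f)
  case (Cons a as)
  show ?case
    by (simp add: Cons sum.atLeast0_atMost_Suc_shift del: sum.cl_ivl_Suc)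
qed simp

lemma scup_eq_sum:
  "scup f g as = (\<Sum>i\<in>{0..length as}. (-1) ^ (i * (length as - i)) *s (f (take i as) \<cdot> g (drop i as)))"
proof -
  have "((-1) ^ (i * (n - i)) :: 'k) = (if even n then (-1) ^ i else 1)" if "i \<le> n" for i n :: nat
    using that by (auto simp: minus_one_power_iff)
  then show ?thesis
    unfolding scup_def cup_eq_sum by (auto simp: alt_def mul_simps intro!: sum.cong)
qed

lemma emb_mult: "emb f \<otimes>\<^bsub>HC A\<^esub> emb g = emb (scup f g)"
  by (simp add: HC_def)
    (rule restrict_eq_emb, simp add: abs_simps abs_finsum scup_eq_sum take_map drop_map)

text \<open>Identifies the two-term differential with the usual alternating sum: each unfolding of
  \<open>ract\<close> subtracts, which produces the alternating signs of the inner terms and of the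
  last one.\<close>

lemma ract_eq_sum:
  "- ract f a bs = (\<Sum>i<length bs. (-1) ^ Suc i *s f (take i (a # bs) @
      ((a # bs) ! i \<cdot> (a # bs) ! Suc i) # drop (Suc (Suc i)) (a # bs)))
    + (-1) ^ Suc (length bs) *s (f (butlast (a # bs)) \<cdot> last (a # bs))"
proof (induction bs arbitrary: f a)
  case (Cons b bs)
  have "ract (\<lambda>cs. f (a # cs)) b bs = - (- ract (\<lambda>cs. f (a # cs)) b bs)" by simp
  also note Cons
  finally show ?case
    by (simp add: sum.lessThan_Suc_shift sum_negf del: sum.lessThan_Suc)
qed simp

lemma hdelta_emb: "hdelta A (emb f) = emb (delta f)"
  unfolding hdelta_def
proof (rule restrict_eq_emb)
  fix as :: "'b list"
  show "(if map abs as = [] then \<zero>\<^bsub>A\<^esub> else hd (map abs as) \<otimes>\<^bsub>A\<^esub> emb f (tl (map abs as))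
     \<oplus>\<^bsub>A\<^esub> (\<Oplus>\<^bsub>A\<^esub>i\<in>{1..<length (map abs as)}. ((-1) ^ i) \<odot>\<^bsub>A\<^esub> emb f (contract A i (map abs as)))
     \<oplus>\<^bsub>A\<^esub> ((-1) ^ length (map abs as)) \<odot>\<^bsub>A\<^esub> (emb f (butlast (map abs as)) \<otimes>\<^bsub>A\<^esub> last (map abs as))) = abs (delta f as)"
  proof (cases as)
    case (Cons a bs)
    let ?F = "\<lambda>i. f (take (i - 1) as @ (as ! (i - 1) \<cdot> as ! i) # drop (i + 1) as)"
    have "contract A i (map abs as) = map abs (take (i - 1) as @ (as ! (i - 1) \<cdot> as ! i) # drop (i + 1) as)"
      if "i \<in> {1..<length as}" for i
      using that by (auto simp: contract_def abs_mul take_map drop_map)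
    then have "(\<Oplus>\<^bsub>A\<^esub>i\<in>{1..<length as}. ((-1) ^ i) \<odot>\<^bsub>A\<^esub> emb f (contract A i (map abs as)))
        = (\<Oplus>\<^bsub>A\<^esub>i\<in>{1..<length as}. abs ((-1) ^ i *s ?F i))"
      by (intro abelian_monoid.finsum_cong'[OF abelian_group.axioms(1)[OF abelian_group_A]])
        (auto simp: abs_smult simp del: map_append list.map)
    also have "\<dots> = abs (\<Sum>i\<in>{1..<length as}. (-1) ^ i *s ?F i)"
      by (simp add: abs_finsum)
    also have "(\<Sum>i\<in>{1..<length as}. (-1) ^ i *s ?F i) = (\<Sum>i<length bs. (-1) ^ Suc i *s ?F (Suc i))"
      by (simp only: Cons list.size(4) add_Suc_right add_0_right One_nat_def
          sum.atLeast_Suc_lessThan_Suc_shift lessThan_atLeast0 o_def)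
    finally have 1: "(\<Oplus>\<^bsub>A\<^esub>i\<in>{1..<length as}. ((-1) ^ i) \<odot>\<^bsub>A\<^esub> emb f (contract A i (map abs as))) 
        = abs (\<Sum>i<length bs. (-1) ^ Suc i *s ?F (Suc i))" .
    have 2: "hd (map abs as) = abs a" "tl (map abs as) = map abs bs" "map abs as \<noteq> []"
      "last (map abs as) = abs (last as)" "length (map abs as) = length as"
      by (simp_all add: Cons last_map)
    show ?thesis
      using ract_eq_sum[of f a bs]
      unfolding 1 2 map_butlast[symmetric] emb_map abs_simps if_False
      by (simp add: Cons diff_conv_add_uminus add.assoc del: butlast.simps last.simps add_uminus_conv_diff)
  qed (simp add: abs_simps)
qed

lemma HC_deg_eq: "HC_deg A n = emb ` {f. cochain f \<and> (\<forall>as. length as \<noteq> n \<longrightarrow> f as = 0)}"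
  unfolding HC_deg_def total_cochains_eq ball_lists by (auto simp: abs_simps)

lemma HC_proj_emb: "HC_proj A n (emb f) = emb (trunc n f)"
  unfolding HC_proj_def by (rule restrict_eq_emb) (simp add: trunc_def abs_simps)

lemma HZ_eq: "HZ A = emb ` {f. cochain f \<and> delta f = (\<lambda>_. 0)}"
  unfolding HZ_def total_cochains_eq by (auto simp: hdelta_emb emb_zero)

lemma HB_eq: "HB A = emb ` delta ` {f. cochain f}"
  unfolding HB_def total_cochains_eq image_image hdelta_emb ..

end

subsection \<open>Quotients\<close>

text \<open>
  A surjective homomorphism \<open>\<psi>\<close> from (a record of operations) \<open>M\<close> onto an algebra identifies the
  quotient of \<open>M\<close> by the kernel with that algebra: \<open>fibre\<close> is the inverse isomorphism. \<open>M\<close> itself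
  is not assumed to be an algebra.
\<close>

locale alg_surjection = k_algebra scale mul unit
  for scale :: "'k::field \<Rightarrow> 'b::ab_group_add \<Rightarrow> 'b" (infixr "*s" 75)
    and mul :: "'b \<Rightarrow> 'b \<Rightarrow> 'b" (infixl "\<cdot>" 70) and unit :: 'b +
  fixes M :: "('k, 'm) module" and \<psi> :: "'m \<Rightarrow> 'b"
  assumes add: "x \<in> carrier M \<Longrightarrow> y \<in> carrier M \<Longrightarrow> x \<oplus>\<^bsub>M\<^esub> y \<in> carrier M \<and> \<psi> (x \<oplus>\<^bsub>M\<^esub> y) = \<psi> x + \<psi> y"
    and mult: "x \<in> carrier M \<Longrightarrow> y \<in> carrier M \<Longrightarrow> x \<otimes>\<^bsub>M\<^esub> y \<in> carrier M \<and> \<psi> (x \<otimes>\<^bsub>M\<^esub> y) = \<psi> x \<cdot> \<psi> y"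
    and smult: "x \<in> carrier M \<Longrightarrow> s \<odot>\<^bsub>M\<^esub> x \<in> carrier M \<and> \<psi> (s \<odot>\<^bsub>M\<^esub> x) = s *s \<psi> x"
    and one: "\<one>\<^bsub>M\<^esub> \<in> carrier M \<and> \<psi> \<one>\<^bsub>M\<^esub> = unit"
    and surj: "\<exists>x\<in>carrier M. \<psi> x = a"
    and subtract: "x \<in> carrier M \<Longrightarrow> y \<in> carrier M \<Longrightarrow> \<exists>h\<in>carrier M. y = h \<oplus>\<^bsub>M\<^esub> x"
begin

definition fibre :: "'b \<Rightarrow> 'm set" where
  "fibre a = {x \<in> carrier M. \<psi> x = a}"

lemma fibre_nonempty: "fibre a \<noteq> {}"
  using surj[of a] by (auto simp: fibre_def)

text \<open>That a translate of a fibre is a whole fibre, rather than a part of one, needs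
  solvability of \<open>y = h + x\<close> in \<open>M\<close>; this is the purpose of
  \<open>subtract\<close>.\<close>

lemma fibre_plus:
  assumes x: "x \<in> carrier M"
  shows "(\<Union>h\<in>fibre a. {h \<oplus>\<^bsub>M\<^esub> x}) = fibre (a + \<psi> x)"
proof (intro equalityI subsetI)
  fix y assume "y \<in> fibre (a + \<psi> x)"
  then have y: "y \<in> carrier M" "\<psi> y = a + \<psi> x" by (auto simp: fibre_def)
  obtain h where "h \<in> carrier M" "y = h \<oplus>\<^bsub>M\<^esub> x"
    using subtract[OF x y(1)] by blast
  then show "y \<in> (\<Union>h\<in>fibre a. {h \<oplus>\<^bsub>M\<^esub> x})"
    using y(2) add[of h x] x by (auto simp: fibre_def)
qed (auto simp: fibre_def x add[THEN conjunct1] add[THEN conjunct2])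

lemma coset: "x \<in> carrier M \<Longrightarrow> fibre 0 +>\<^bsub>M\<^esub> x = fibre (\<psi> x)"
  unfolding a_r_coset_def' using fibre_plus[of x 0] by simp

lemma quotient:
  assumes "I = fibre 0"
  shows "alg_model scale mul unit (quot_alg M I) fibre"
proof
  show "inj fibre"
  proof (rule injI)
    fix a b assume "fibre a = fibre b"
    then show "a = b" using fibre_nonempty[of a] by (auto simp: fibre_def)
  qed
  show "carrier (quot_alg M I) = range fibre"
  proof -
    have "(\<Union>x\<in>carrier M. {fibre 0 +>\<^bsub>M\<^esub> x}) = fibre ` \<psi> ` carrier M"
      by (auto simp: coset)
    moreover have "\<psi> ` carrier M = UNIV"
      using surj by (metis UNIV_eq_I image_eqI)
    ultimately show ?thesis
      by (simp add: quot_alg_def FactRing_def A_RCOSETS_def' assms)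
  qed
  show "\<zero>\<^bsub>quot_alg M I\<^esub> = fibre 0"
    by (simp add: quot_alg_def FactRing_def assms)
  show "\<one>\<^bsub>quot_alg M I\<^esub> = fibre unit"
    using coset[of "\<one>\<^bsub>M\<^esub>"] one by (simp add: quot_alg_def FactRing_def assms)
  fix a b s
  have "fibre a <+>\<^bsub>M\<^esub> fibre b = (\<Union>x\<in>fibre b. \<Union>h\<in>fibre a. {h \<oplus>\<^bsub>M\<^esub> x})"
    unfolding set_add_def' by blast
  also have "\<dots> = (\<Union>x\<in>fibre b. fibre (a + b))"
    by (intro SUP_cong refl) (simp add: fibre_plus fibre_def[of b])
  also have "\<dots> = fibre (a + b)"
    using fibre_nonempty by auto
  finally show "fibre a \<oplus>\<^bsub>quot_alg M I\<^esub> fibre b = fibre (a + b)"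
    by (simp add: quot_alg_def FactRing_def)
  have "fibre 0 +>\<^bsub>M\<^esub> (x \<otimes>\<^bsub>M\<^esub> y) = fibre (a \<cdot> b)" if "x \<in> fibre a" "y \<in> fibre b" for x y
    using that mult[of x y] coset[of "x \<otimes>\<^bsub>M\<^esub> y"] by (simp add: fibre_def)
  then have "(\<Union>x\<in>fibre a. \<Union>y\<in>fibre b. fibre 0 +>\<^bsub>M\<^esub> (x \<otimes>\<^bsub>M\<^esub> y)) = (\<Union>x\<in>fibre a. \<Union>y\<in>fibre b. fibre (a \<cdot> b))"
    by (simp cong: SUP_cong_simp)
  also have "\<dots> = fibre (a \<cdot> b)"
    using fibre_nonempty by auto
  finally show "fibre a \<otimes>\<^bsub>quot_alg M I\<^esub> fibre b = fibre (a \<cdot> b)"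
    by (simp add: quot_alg_def FactRing_def rcoset_mult_def assms)
  have "fibre 0 +>\<^bsub>M\<^esub> (s \<odot>\<^bsub>M\<^esub> x) = fibre (s *s a)" if "x \<in> fibre a" for x
    using that smult[of x s] coset[of "s \<odot>\<^bsub>M\<^esub> x"] by (simp add: fibre_def)
  then have "(\<Union>x\<in>fibre a. fibre 0 +>\<^bsub>M\<^esub> (s \<odot>\<^bsub>M\<^esub> x)) = (\<Union>x\<in>fibre a. fibre (s *s a))"
    by (simp cong: SUP_cong_simp)
  also have "\<dots> = fibre (s *s a)"
    using fibre_nonempty by auto
  finally show "s \<odot>\<^bsub>quot_alg M I\<^esub> fibre a = fibre (s *s a)"
    by (simp add: quot_alg_def assms)
qed

end

section \<open>Hochschild cohomology of the quantum plane\<close>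

lemma h5_eq_0_iff [simp]: "(a, b, c, d, e) = (0 :: 'k::zero h5) \<longleftrightarrow> a = 0 \<and> b = 0 \<and> c = 0 \<and> d = 0 \<and> e = 0"
  by (simp add: zero_prod_def)

context qplane
begin

lemma k_algebra_h5: "k_algebra h5_scale h5_mul (1, 0, 0, 0, 0)"
  by standard (auto simp: h5_scale_def h5_mul_def algebra_simps prod_eq_iff split_beta)

definition h5_deg :: "nat \<Rightarrow> 'k h5 set" where
  "h5_deg n = {(a, b, c, d, e). (n \<noteq> 0 \<longrightarrow> a = 0) \<and> (n \<noteq> 1 \<longrightarrow> b = 0 \<and> c = 0) \<and> (n \<noteq> 2 \<longrightarrow> d = 0 \<and> e = 0)}"

definition h5_proj :: "nat \<Rightarrow> 'k h5 \<Rightarrow> 'k h5" where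
  "h5_proj n = (\<lambda>(a, b, c, d, e). (if n = 0 then a else 0, if n = 1 then b else 0, if n = 1 then c else 0,
     if n = 2 then d else 0, if n = 2 then e else 0))"

text \<open>In degree 1 this is minus the divergence of \<open>b x d/dx + c y d/dy\<close>; in
  degree 2 it sends \<open>v\<close> to the difference of the two Euler derivations.\<close>

definition h5_Delta :: "'k h5 \<Rightarrow> 'k h5" where
  "h5_Delta = (\<lambda>(a, b, c, d, e). (- (b + c), e, - e, 0, 0))"

lemma h5_proj_in: "h5_proj n w \<in> h5_deg n"
  by (cases w) (simp add: h5_proj_def h5_deg_def)

lemma h5_proj_id: "w \<in> h5_deg m \<Longrightarrow> h5_proj n w = (if m = n then w else 0)"
  by (auto simp: h5_proj_def h5_deg_def)

lemma h5_proj_add: "h5_proj n (v + w) = h5_proj n v + h5_proj n w"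
  by (cases v; cases w) (simp add: h5_proj_def)

lemma h5_proj_sum: "h5_proj n (sum f I) = (\<Sum>i\<in>I. h5_proj n (f i))"
  by (induction I rule: infinite_finite_induct) (simp_all add: h5_proj_add, simp_all add: h5_proj_def zero_prod_def)

lemma h5_proj_eq_0: "2 < n \<Longrightarrow> h5_proj n w = 0"
  by (cases w) (simp add: h5_proj_def)

lemma sum_h5_proj: "(\<Sum>n\<le>2. h5_proj n w) = w"
  by (cases w) (simp add: h5_proj_def numeral_2_eq_2)

lemma psi_trunc: "psi (trunc n f) = h5_proj n (psi f)"
  by (auto simp: psi_def trunc_def h5_proj_def rho_def)

lemma cocycle_trunc: "cocycle f \<Longrightarrow> cocycle (trunc n f)"
  by (simp add: cocycle_def cochain_trunc delta_trunc[abs_def]) (simp add: trunc_def[abs_def])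

lemma rep_homogeneous: "w \<in> h5_deg n \<Longrightarrow> length as \<noteq> n \<Longrightarrow> rep w as = 0"
  by (induct w as rule: rep.induct) (auto simp: h5_deg_def)

lemma psi_homogeneous: "(\<And>as. length as \<noteq> n \<Longrightarrow> f as = 0) \<Longrightarrow> psi f \<in> h5_deg n"
  by (auto simp: psi_def h5_deg_def rho_def)

end

locale qplane_model = qplane q + alg_model pscale "qmul q" "mo 0 0" A abs
  for q :: "'k::field" and A :: "('k, 'a) module" and abs :: "'k qp \<Rightarrow> 'a"
begin

definition unemb :: "('a list \<Rightarrow> 'a) \<Rightarrow> 'k qp list \<Rightarrow> 'k qp" where
  "unemb F as = inv_into UNIV abs (F (map abs as))"

lemma unemb_emb [simp]: "unemb (emb f) = f"
  by (simp add: fun_eq_iff unemb_def inj_abs)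

lemma HZ_cocycle: "HZ A = emb ` {f. cocycle f}"
  by (simp add: HZ_eq cocycle_def)

text \<open>With \<open>HB_Theta\<close>, which identifies the kernel with the coboundaries, this
  turns the cohomology algebra into \<open>k^5\<close>; \<open>Theta\<close> is the resulting
  isomorphism.\<close>

sublocale H: alg_surjection h5_scale h5_mul "(1, 0, 0, 0, 0)" "(HC A)\<lparr>carrier := HZ A\<rparr>" "psi \<circ> unemb"
proof (intro alg_surjection.intro k_algebra_h5 alg_surjection_axioms.intro; (clarsimp simp: HZ_cocycle)?)
  fix f g assume "cocycle f" "cocycle g"
  then show "emb f \<oplus>\<^bsub>HC A\<^esub> emb g \<in> emb ` Collect cocycle \<and> psi (unemb (emb f \<oplus>\<^bsub>HC A\<^esub> emb g)) = psi f + psi g"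
    by (auto simp: emb_add psi_add cocycle_def cochain_add delta_add[abs_def])
next
  fix f g assume "cocycle f" "cocycle g"
  moreover from this have "cocycle (scup f g)"
    by (simp add: cocycle_def cochain_scup delta_scup)
  ultimately show "emb f \<otimes>\<^bsub>HC A\<^esub> emb g \<in> emb ` Collect cocycle \<and> psi (unemb (emb f \<otimes>\<^bsub>HC A\<^esub> emb g)) = h5_mul (psi f) (psi g)"
    by (simp add: emb_mult psi_scup)
next
  fix f s assume "cocycle f"
  then show "s \<odot>\<^bsub>HC A\<^esub> emb f \<in> emb ` Collect cocycle \<and> psi (unemb (s \<odot>\<^bsub>HC A\<^esub> emb f)) = h5_scale s (psi f)"
    by (auto simp: emb_smult psi_scale cocycle_def cochain_scale delta_scale[abs_def])
next
  have "(\<lambda>as. if as = [] then mo 0 0 else 0) = rep (1, 0, 0, 0, 0)"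
  proof
    fix as :: "'k qp list"
    show "(if as = [] then mo 0 0 else 0) = rep (1, 0, 0, 0, 0) as"
      by (cases "((1, 0, 0, 0, 0) :: 'k h5, as)" rule: rep.cases) auto
  qed
  then show "\<one>\<^bsub>HC A\<^esub> \<in> emb ` Collect cocycle \<and> psi (unemb \<one>\<^bsub>HC A\<^esub>) = (1, 0, 0, 0, 0)"
    by (simp add: emb_one cocycle_rep psi_rep)
next
  fix a b c d e
  show "\<exists>f. cocycle f \<and> psi f = (a, b, c, d, e)"
    using cocycle_rep psi_rep by blast
next
  fix f g assume "cocycle f" "cocycle g"
  then have "cocycle (\<lambda>as. g as - f as)"
    by (simp add: cocycle_def cochain_diff delta_diff[abs_def])
  then show "\<exists>h. cocycle h \<and> emb g = emb h \<oplus>\<^bsub>HC A\<^esub> emb f"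
    by (intro exI[of _ "\<lambda>as. g as - f as"]) (simp add: emb_add)
qed

abbreviation Theta :: "'k h5 \<Rightarrow> ('a list \<Rightarrow> 'a) set" where
  "Theta \<equiv> H.fibre"

lemma Theta_eq: "Theta w = emb ` {f. cocycle f \<and> psi f = w}"
  unfolding H.fibre_def by (auto simp: HZ_cocycle)

lemma HB_Theta: "HB A = Theta 0"
  unfolding HB_eq Theta_eq
  by (auto simp: cocycle_delta psi_delta elim!: psi_eq_0D)

sublocale HH: alg_model h5_scale h5_mul "(1, 0, 0, 0, 0)" "HH A" Theta
  unfolding HH_def by (rule H.quotient) (rule HB_Theta)

lemma HB_coset: "cocycle f \<Longrightarrow> HB A +>\<^bsub>HC A\<^esub> emb f = Theta (psi f)"
  using H.coset[of "emb f"] by (simp add: HB_Theta a_r_coset_def' HZ_cocycle)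

lemma HH_deg_eq: "HH_deg A n = Theta ` h5_deg n"
proof -
  have "HZ A \<inter> HC_deg A n = emb ` {f. cocycle f \<and> (\<forall>as. length as \<noteq> n \<longrightarrow> f as = 0)}"
    by (auto simp: HZ_cocycle HC_deg_eq cocycle_def)
  then have "HH_deg A n = Theta ` psi ` {f. cocycle f \<and> (\<forall>as. length as \<noteq> n \<longrightarrow> f as = 0)}"
    unfolding HH_deg_def by (auto simp: HB_coset image_image)
  also have "psi ` {f. cocycle f \<and> (\<forall>as. length as \<noteq> n \<longrightarrow> f as = 0)} = h5_deg n"
  proof (intro equalityI subsetI)
    fix w assume "w \<in> h5_deg n"
    then show "w \<in> psi ` {f. cocycle f \<and> (\<forall>as. length as \<noteq> n \<longrightarrow> f as = 0)}"
      by (intro image_eqI[of _ _ "rep w"]) (auto simp: psi_rep cocycle_rep rep_homogeneous)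
  next
    fix w assume "w \<in> psi ` {f. cocycle f \<and> (\<forall>as. length as \<noteq> n \<longrightarrow> f as = 0)}"
    then obtain f where "w = psi f" "\<And>as. length as \<noteq> n \<Longrightarrow> f as = 0" by blast
    then show "w \<in> h5_deg n" by (simp add: psi_homogeneous)
  qed
  finally show ?thesis .
qed

lemma HH_comp_Theta: "HH_comp A n (Theta w) = Theta (h5_proj n w)"
proof -
  have "HH_comp A n (Theta w) = (\<Union>f\<in>{f. cocycle f \<and> psi f = w}. Theta (h5_proj n w))"
    unfolding HH_comp_def Theta_eq[of w] UN_simps(10)
    by (intro SUP_cong refl) (auto simp: HC_proj_emb HB_coset cocycle_trunc psi_trunc)
  also have "\<dots> = Theta (h5_proj n w)"
    using cocycle_rep psi_rep by blast
  finally show ?thesis .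
qed

lemma HH_degE: "x \<in> HH_deg A n \<Longrightarrow> (\<And>w. x = Theta w \<Longrightarrow> w \<in> h5_deg n \<Longrightarrow> P) \<Longrightarrow> P"
  by (auto simp: HH_deg_eq)

lemma ball_HH_deg: "(\<forall>x\<in>HH_deg A n. P x) \<longleftrightarrow> (\<forall>w\<in>h5_deg n. P (Theta w))"
  by (auto simp: HH_deg_eq)

lemma Theta_in_HH_deg: "Theta w \<in> HH_deg A n \<longleftrightarrow> w \<in> h5_deg n"
  by (auto simp: HH_deg_eq)

lemma ex1_decomposition:
  "\<exists>!e :: nat \<Rightarrow> _. (\<forall>n. e n \<in> HH_deg A n) \<and> finite {n. e n \<noteq> \<zero>\<^bsub>HH A\<^esub>} \<and>
     Theta w = (\<Oplus>\<^bsub>HH A\<^esub>n\<in>{n. e n \<noteq> \<zero>\<^bsub>HH A\<^esub>}. e n)" (is "\<exists>!e. ?P e")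
proof (rule ex1I)
  have sub: "{n. h5_proj n w \<noteq> 0} \<subseteq> {..2}"
  proof (rule subsetI, rule ccontr)
    fix n assume "n \<in> {n. h5_proj n w \<noteq> 0}" "n \<notin> {..2}"
    then show False by (simp add: h5_proj_eq_0)
  qed
  then have "finite {n. h5_proj n w \<noteq> 0}"
    by (rule finite_subset) simp
  moreover have "(\<Sum>n\<in>{n. h5_proj n w \<noteq> 0}. h5_proj n w) = (\<Sum>n\<le>2. h5_proj n w)"
    using sub by (intro sum.mono_neutral_left) auto
  ultimately show "?P (\<lambda>n. Theta (h5_proj n w))"
    by (simp add: Theta_in_HH_deg h5_proj_in HH.abs_zero HH.abs_finsum sum_h5_proj)
next
  fix e assume e: "?P e"
  have "\<forall>n. \<exists>v. e n = Theta v \<and> v \<in> h5_deg n"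
    using e unfolding HH_deg_eq by blast
  from choice[OF this] obtain v where "\<forall>n. e n = Theta (v n) \<and> v n \<in> h5_deg n" ..
  then have v: "e = (\<lambda>n. Theta (v n))" "v n \<in> h5_deg n" for n
    by auto
  have fin: "finite {n. v n \<noteq> 0}"
    using e by (simp add: v(1) HH.abs_zero)
  then have w: "w = (\<Sum>n\<in>{n. v n \<noteq> 0}. v n)"
    using e by (simp add: v(1) HH.abs_zero HH.abs_finsum)
  \<comment> \<open>Uniqueness: projecting the sum to degree \<open>n\<close> leaves only its term
    of that degree.\<close>
  have "h5_proj n w = v n" for n
  proof -
    have "h5_proj n w = (\<Sum>m\<in>{n. v n \<noteq> 0}. if m = n then v m else 0)"
      unfolding w h5_proj_sum by (intro sum.cong refl h5_proj_id v(2))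
    then show ?thesis using fin by simp
  qed
  then show "e = (\<lambda>n. Theta (h5_proj n w))"
    by (simp add: v(1))
qed

lemma h5_deg_closed:
  "0 \<in> h5_deg n" "v \<in> h5_deg n \<Longrightarrow> w \<in> h5_deg n \<Longrightarrow> v + w \<in> h5_deg n" "v \<in> h5_deg n \<Longrightarrow> h5_scale s v \<in> h5_deg n"
  "v \<in> h5_deg m \<Longrightarrow> w \<in> h5_deg n \<Longrightarrow> h5_mul v w \<in> h5_deg (m + n)"
  by (auto simp: h5_deg_def h5_scale_def h5_mul_def zero_prod_def)

lemma graded_algebra_HH: "graded_algebra (HH A) (HH_deg A)"
  unfolding graded_algebra_def
proof (intro conjI)
  show "\<forall>h\<in>carrier (HH A). \<exists>!e :: nat \<Rightarrow> _. (\<forall>n. e n \<in> HH_deg A n) \<and> finite {n. e n \<noteq> \<zero>\<^bsub>HH A\<^esub>} \<and>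
     h = (\<Oplus>\<^bsub>HH A\<^esub>n\<in>{n. e n \<noteq> \<zero>\<^bsub>HH A\<^esub>}. e n)"
    unfolding HH.ball_carrier by (rule allI, rule ex1_decomposition)
qed (auto simp: HH.assoc_algebra_A ball_HH_deg Theta_in_HH_deg HH.abs_simps h5_deg_closed elim!: HH_degE,
     simp add: h5_deg_def)

lemma h5_deg_cases:
  assumes "w \<in> h5_deg n"
  obtains a where "n = 0" "w = (a, 0, 0, 0, 0)" | b c where "n = 1" "w = (0, b, c, 0, 0)"
    | d e where "n = 2" "w = (0, 0, 0, d, e)" | "w = 0"
  using assms by (auto simp: h5_deg_def zero_prod_def)

lemma h5_commute: "v \<in> h5_deg m \<Longrightarrow> w \<in> h5_deg n \<Longrightarrow> h5_mul v w = h5_scale ((-1) ^ (m * n)) (h5_mul w v)"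
  by (elim h5_deg_cases) (auto simp: h5_mul_def h5_scale_def zero_prod_def algebra_simps split: prod.splits)

lemma h5_seven_term:
  assumes "a \<in> h5_deg l" "b \<in> h5_deg m"
  shows "h5_Delta (h5_mul (h5_mul a b) c) =
    h5_mul (h5_Delta (h5_mul a b)) c + h5_scale ((-1) ^ l) (h5_mul a (h5_Delta (h5_mul b c)))
    + h5_scale ((-1) ^ ((l + 1) * m)) (h5_mul b (h5_Delta (h5_mul a c)))
    - h5_mul (h5_mul (h5_Delta a) b) c - h5_scale ((-1) ^ l) (h5_mul (h5_mul a (h5_Delta b)) c)
    - h5_scale ((-1) ^ (l + m)) (h5_mul (h5_mul a b) (h5_Delta c))"
  using assms
  by (elim h5_deg_cases; cases c)
    (simp_all add: h5_mul_def h5_scale_def h5_Delta_def zero_prod_def algebra_simps)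

lemma BV_algebra_HH:
  assumes "\<And>w. Delta (Theta w) = Theta (h5_Delta w)"
  shows "BV_algebra (HH A) (HH_deg A) Delta"
proof -
  have "h5_Delta (v + w) = h5_Delta v + h5_Delta w" "h5_Delta (h5_scale s w) = h5_scale s (h5_Delta w)"
    "h5_Delta (h5_Delta w) = 0" for s v w
    by (cases v; cases w; simp add: h5_Delta_def h5_scale_def algebra_simps)+
  moreover have "w \<in> h5_deg 0 \<Longrightarrow> h5_Delta w = 0" "w \<in> h5_deg (Suc n) \<Longrightarrow> h5_Delta w \<in> h5_deg n" for w n
    by (auto simp: h5_deg_def h5_Delta_def)
  ultimately show ?thesis
    unfolding BV_algebra_def ball_HH_deg HH.ball_carrier HH.abs_simps assms HH.abs_eq_iff Theta_in_HH_deg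
    by (intro conjI graded_algebra_HH allI ballI impI h5_commute h5_seven_term) simp_all
qed

end

section \<open>The generalized Weyl algebra for \<open>p = c z\<close> is the quantum plane\<close>

lemma pscale_single: "pscale s (single w t) = single w (s * t)"
  by (rule poly_mapping_eqI) (simp add: lookup_single when_def)

lemma pscale_eq_mult: "pscale s f = single 0 s * (f :: 'w::monoid_add \<Rightarrow>\<^sub>0 'k::field)"
  by (rule additive_ext[of "pscale s" "\<lambda>f. single 0 s * f"])
    (simp_all add: pscale.scale_right_distrib distrib_left mult_single pscale_single)

lemma pscale_mult_left: "pscale s f * g = pscale s (f * g)" for f :: "'w::monoid_add \<Rightarrow>\<^sub>0 'k::field"
  by (simp add: pscale_eq_mult mult.assoc)

lemma pscale_mult_right: "f * pscale s g = pscale s (f * g)" for f :: "'w::monoid_add \<Rightarrow>\<^sub>0 'k::field"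
proof -
  have "f * single 0 s = single 0 s * f"
    by (rule additive_ext[of "\<lambda>f. f * single 0 s" "\<lambda>f. single 0 s * f"])
      (simp_all add: algebra_simps mult_single)
  then show ?thesis
    by (simp add: pscale_eq_mult flip: mult.assoc)
qed

lemma free_alg_simps [simp]:
  "carrier free_alg = UNIV" "f \<otimes>\<^bsub>free_alg\<^esub> g = f * g" "\<one>\<^bsub>free_alg\<^esub> = 1" "\<zero>\<^bsub>free_alg\<^esub> = 0"
  "f \<oplus>\<^bsub>free_alg\<^esub> g = f + g" "s \<odot>\<^bsub>free_alg\<^esub> f = pscale s f"
  by (simp_all add: free_alg_def pscale_eq_mult)

lemma ring_free_alg: "ring free_alg"
proof (rule ringI)
  show "abelian_group free_alg"
    by (rule abelian_groupI) (auto simp: algebra_simps intro: exI[of _ "- x" for x])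
  show "Group.monoid free_alg"
    by (rule monoidI) (auto simp: mult.assoc)
qed (simp_all add: algebra_simps)

locale gwa_plane = qplane q for q :: "'k::field" +
  fixes c :: 'k and p :: "'k poly"
  assumes c_nonzero [simp]: "c \<noteq> 0" and p_eq: "p = [:0, c:]"
begin

definition Z :: "'k qp" where
  "Z = inverse c *s mo 1 1"

fun nf_gen :: "gen \<Rightarrow> 'k qp" where
  "nf_gen GX = X" | "nf_gen GY = Y" | "nf_gen GZ = Z"

definition nf_word :: "word \<Rightarrow> 'k qp" where
  "nf_word w = foldr (\<lambda>g a. nf_gen g \<cdot> a) (letters w) (mo 0 0)"

definition nf :: "(word \<Rightarrow>\<^sub>0 'k) \<Rightarrow> 'k qp" where
  "nf = plift nf_word"

text \<open>A linear section of \<open>nf\<close> by the ordered words. It shows that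
  \<open>nf\<close> is onto, and it supplies the normal forms to which words are reduced modulo the
  relators.\<close>

definition sec :: "'k qp \<Rightarrow> (word \<Rightarrow>\<^sub>0 'k)" where
  "sec = plift (\<lambda>m. single (Word (replicate (fst m) GY @ replicate (snd m) GX)) 1)"

lemma nf_word_Cons: "nf_word (Word (g # gs)) = nf_gen g \<cdot> nf_word (Word gs)"
  by (simp add: nf_word_def)

lemma nf_word_0: "nf_word 0 = mo 0 0"
  by (simp add: nf_word_def zero_word_def)

lemma nf_word_add: "nf_word (v + w) = nf_word v \<cdot> nf_word w"
proof -
  have "nf_word (Word as + Word bs) = nf_word (Word as) \<cdot> nf_word (Word bs)" for as bs
  proof (induction as)
    case (Cons a as)
    then show ?case
      by (simp add: nf_word_def plus_word_def mul_assoc)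
  qed (simp add: nf_word_def plus_word_def)
  then show ?thesis
    by (metis word.collapse)
qed

lemma nf_add: "nf (f + g) = nf f + nf g" and nf_pscale: "nf (pscale s f) = s *s nf f"
  by (simp_all add: nf_def plift_add plift_scale)

lemma nf_diff: "nf (f - g) = nf f - nf g"
  using nf_add[of "f - g" g] by simp

lemma nf_single: "nf (single w s) = s *s nf_word w"
  by (simp add: nf_def)

lemma nf_zero [simp]: "nf 0 = 0"
  by (simp add: nf_def)

lemma nf_mult: "nf (f * g) = nf f \<cdot> nf g"
proof -
  have *: "nf (single v s * g) = nf (single v s) \<cdot> nf g" for v s
    by (rule additive_ext[of "\<lambda>g. nf (single v s * g)" "\<lambda>g. nf (single v s) \<cdot> nf g"])
      (simp_all add: distrib_left nf_add mul_simps mult_single nf_single nf_word_add mult.commute)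
  show ?thesis
    by (rule additive_ext[of "\<lambda>f. nf (f * g)" "\<lambda>f. nf f \<cdot> nf g"]) (simp_all add: distrib_right nf_add mul_simps *)
qed

lemma nf_one: "nf 1 = mo 0 0"
  using nf_single[of 0 1] by (simp add: nf_word_0)

lemma nf_fgen [simp]: "nf (fgen g) = nf_gen g"
  by (simp add: fgen_def nf_single nf_word_def)

lemma sec_add: "sec (a + b) = sec a + sec b" and sec_scale: "sec (s *s a) = pscale s (sec a)"
  by (simp_all add: sec_def plift_add plift_scale)

lemma sec_mo: "sec (mo i j) = single (Word (replicate i GY @ replicate j GX)) 1"
  by (simp add: sec_def)

lemma nf_replicate_X: "nf_word (Word (replicate j GX)) = mo 0 j"
  by (induction j) (simp_all add: nf_word_Cons, simp add: nf_word_def)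

lemma nf_replicate: "nf_word (Word (replicate i GY @ replicate j GX)) = mo i j"
  by (induction i) (simp_all add: nf_word_Cons nf_replicate_X)

lemma nf_sec: "nf (sec a) = a"
  by (rule linear_ext_mo[of "\<lambda>a. nf (sec a)" "\<lambda>a. a"])
    (simp_all add: sec_add sec_scale nf_add nf_pscale sec_mo nf_single nf_replicate)

sublocale quot: alg_surjection pscale "qmul q" "mo 0 0" free_alg nf
  by (intro alg_surjection.intro k_algebra_qmul alg_surjection_axioms.intro)
    (auto simp: nf_add nf_mult nf_pscale nf_one intro: nf_sec, metis diff_add_cancel)

lemma sigma_linear: "sigma q [:0, s:] = [:0, s * q:]"
  by (simp add: sigma_def pcompose_pCons)

lemma sigma_p: "sigma q p = [:0, c * q:]"
  by (simp add: p_eq sigma_linear)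

lemma fpoly_linear: "fpoly [:0, s:] = pscale s (fgen GZ)"
proof -
  have "fpoly [:0, s:] = (\<Sum>i\<le>1. single (Word (replicate i GZ)) (coeff [:0, s:] i))"
    by (cases "s = 0") (simp_all add: fpoly_def)
  then show ?thesis
    by (simp add: fgen_def pscale_single)
qed

definition relators :: "(word \<Rightarrow>\<^sub>0 'k) set" where
  "relators = {fgen GX * fgen GZ - single 0 q * fgen GZ * fgen GX,
      fgen GY * fgen GZ - single 0 (inverse q) * fgen GZ * fgen GY,
      fgen GY * fgen GX - fpoly p,
      fgen GX * fgen GY - fpoly (sigma q p)}"

lemma nf_relators: "r \<in> relators \<Longrightarrow> nf r = 0"
  unfolding relators_def
  by (auto simp: nf_diff nf_mult nf_pscale Z_def mul_simps sigma_linear p_eq fpoly_linear simp flip: pscale_eq_mult)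

lemma ideal_kernel: "ideal {f. nf f = 0} free_alg"
proof (rule idealI)
  show "subgroup {f. nf f = 0} (add_monoid free_alg)"
  proof (rule group.subgroupI)
    have ag: "abelian_group free_alg"
      using ring_free_alg by (rule ring.is_abelian_group)
    then show "Group.group (add_monoid free_alg)"
      by (rule abelian_group.a_group)
    show "inv\<^bsub>add_monoid free_alg\<^esub> f \<in> {f. nf f = 0}" if "f \<in> {f. nf f = 0}" for f
    proof -
      have "inv\<^bsub>add_monoid free_alg\<^esub> f = \<ominus>\<^bsub>free_alg\<^esub> f"
        by (simp only: a_inv_def)
      also have "\<dots> = - f"
        by (rule abelian_group.minus_equality[OF ag]) simp_all
      finally have "inv\<^bsub>add_monoid free_alg\<^esub> f = - f" .
      then show ?thesis using that nf_diff[of 0 f] by simp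
    qed
  qed (auto simp: nf_add intro: exI[of _ 0])
qed (auto simp: ring_free_alg nf_mult)

context
  fixes I :: "(word \<Rightarrow>\<^sub>0 'k) set"
  assumes I: "ideal I free_alg" "relators \<subseteq> I"
begin

lemma I_closed: "f \<in> I \<Longrightarrow> g \<in> I \<Longrightarrow> f + g \<in> I" "f \<in> I \<Longrightarrow> g * f \<in> I" "f \<in> I \<Longrightarrow> f * g \<in> I"
  "f \<in> I \<Longrightarrow> pscale s f \<in> I" "0 \<in> I"
proof -
  interpret ideal I free_alg by (rule I)
  show "f \<in> I \<Longrightarrow> g \<in> I \<Longrightarrow> f + g \<in> I" using additive_subgroup.a_closed[OF ideal.axioms(1)[OF I(1)]] by simp
  show l: "f \<in> I \<Longrightarrow> g * f \<in> I" for f g using I_l_closed by simp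
  show "f \<in> I \<Longrightarrow> f * g \<in> I" using I_r_closed by simp
  show "f \<in> I \<Longrightarrow> pscale s f \<in> I" using l by (simp add: pscale_eq_mult)
  show "0 \<in> I" using additive_subgroup.zero_closed[OF ideal.axioms(1)[OF I(1)]] by simp
qed

definition congr :: "(word \<Rightarrow>\<^sub>0 'k) \<Rightarrow> (word \<Rightarrow>\<^sub>0 'k) \<Rightarrow> bool" (infix "\<sim>" 50) where
  "f \<sim> g \<longleftrightarrow> f - g \<in> I"

lemma congr_refl: "f \<sim> f"
  by (simp add: congr_def I_closed)

lemma congr_trans [trans]: "f \<sim> g \<Longrightarrow> g \<sim> h \<Longrightarrow> f \<sim> h"
  using I_closed(1)[of "f - g" "g - h"] by (simp add: congr_def)

lemma congr_sym: "f \<sim> g \<Longrightarrow> g \<sim> f"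
  using I_closed(4)[of "f - g" "-1"] by (simp add: congr_def)

lemma congr_add: "f \<sim> g \<Longrightarrow> f' \<sim> g' \<Longrightarrow> f + f' \<sim> g + g'"
  using I_closed(1)[of "f - g" "f' - g'"] by (simp add: congr_def algebra_simps)

lemma congr_scale: "f \<sim> g \<Longrightarrow> pscale s f \<sim> pscale s g"
  using I_closed(4)[of "f - g" s] by (simp add: congr_def pscale.scale_right_diff_distrib)

lemma congr_mult_left: "f \<sim> g \<Longrightarrow> h * f \<sim> h * g"
  using I_closed(2)[of "f - g" h] by (simp add: congr_def right_diff_distrib)

lemma congr_mult_right: "f \<sim> g \<Longrightarrow> f * h \<sim> g * h"
  using I_closed(3)[of "f - g" h] by (simp add: congr_def left_diff_distrib)

text \<open>As \<open>c\<close> is invertible, the relator \<open>y x - c z\<close> can be solved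
  for \<open>z\<close>, which eliminates this letter.\<close>

lemma congr_Z: "fgen GZ \<sim> pscale (inverse c) (fgen GY * fgen GX)"
proof -
  have "fgen GY * fgen GX \<sim> pscale c (fgen GZ)"
    using I(2) unfolding relators_def congr_def by (simp add: p_eq fpoly_linear)
  from congr_scale[OF congr_sym[OF this], of "inverse c"] show ?thesis
    by simp
qed

lemma congr_XY: "fgen GX * fgen GY \<sim> pscale q (fgen GY * fgen GX)"
proof -
  have "fgen GX * fgen GY \<sim> pscale (c * q) (fgen GZ)"
    using I(2) unfolding relators_def congr_def by (simp add: sigma_p fpoly_linear)
  also have "\<dots> \<sim> pscale (c * q) (pscale (inverse c) (fgen GY * fgen GX))"
    by (rule congr_scale[OF congr_Z])
  also have "\<dots> = pscale q (fgen GY * fgen GX)"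
  proof -
    have "c * q * inverse c = q" by simp
    then show ?thesis by (simp only: pscale.scale_scale)
  qed
  finally show ?thesis .
qed

lemma sec_mo_Suc: "sec (mo (Suc i) j) = fgen GY * sec (mo i j)"
  by (simp add: sec_mo fgen_def mult_single plus_word_def)

text \<open>Moves the new letter \<open>x\<close> past the leading letters \<open>y\<close>, one in
  each step of the induction.\<close>

lemma congr_X_sec: "fgen GX * sec (mo i j) \<sim> sec (X \<cdot> mo i j)"
proof (induction i)
  case 0
  then show ?case by (simp add: sec_mo fgen_def mult_single plus_word_def congr_refl)
next
  case (Suc i)
  have "fgen GX * sec (mo (Suc i) j) = fgen GX * fgen GY * sec (mo i j)"
    by (simp add: sec_mo_Suc mult.assoc)
  also have "\<dots> \<sim> pscale q (fgen GY * fgen GX) * sec (mo i j)"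
    by (rule congr_mult_right[OF congr_XY])
  also have "\<dots> = pscale q (fgen GY * (fgen GX * sec (mo i j)))"
    by (simp add: pscale_mult_left mult.assoc)
  also have "\<dots> \<sim> pscale q (fgen GY * sec (X \<cdot> mo i j))"
    by (intro congr_scale congr_mult_left Suc)
  also have "\<dots> = sec (X \<cdot> mo (Suc i) j)"
    by (simp add: sec_scale sec_mo_Suc pscale_mult_right)
  finally show ?case .
qed

lemma congr_Z_sec: "fgen GZ * sec (mo i j) \<sim> sec (Z \<cdot> mo i j)"
proof -
  have "fgen GZ * sec (mo i j) \<sim> pscale (inverse c) (fgen GY * fgen GX) * sec (mo i j)"
    by (rule congr_mult_right[OF congr_Z])
  also have "\<dots> = pscale (inverse c) (fgen GY * (fgen GX * sec (mo i j)))"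
    by (simp add: pscale_mult_left mult.assoc)
  also have "\<dots> \<sim> pscale (inverse c) (fgen GY * sec (X \<cdot> mo i j))"
    by (intro congr_scale congr_mult_left congr_X_sec)
  also have "\<dots> = sec (Z \<cdot> mo i j)"
    by (simp add: sec_scale sec_mo_Suc pscale_mult_right Z_def mul_simps)
  finally show ?thesis .
qed

lemma congr_gen_sec: "fgen g * sec a \<sim> sec (nf_gen g \<cdot> a)"
proof -
  have "fgen g * sec (mo i j) \<sim> sec (nf_gen g \<cdot> mo i j)" for i j
    using congr_X_sec[of i j] congr_Z_sec[of i j] by (cases g) (simp_all add: sec_mo_Suc congr_refl)
  then have *: "fgen g * sec (single m s) \<sim> sec (nf_gen g \<cdot> single m s)" for m s
    using congr_scale[of _ _ s] unfolding single_scale[of m s]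
    by (cases m) (simp add: sec_scale pscale_mult_right mul_simps flip: mo_def)
  have "fgen g * sec (\<Sum>m\<in>S. single m (lookup a m)) \<sim> sec (nf_gen g \<cdot> (\<Sum>m\<in>S. single m (lookup a m)))"
    if "finite S" for S
    using that
  proof (induction S rule: finite_induct)
    case empty
    have "sec 0 = 0" by (simp add: sec_def)
    then show ?case by (simp add: congr_refl)
  next
    case (insert m S)
    then show ?case using * by (simp add: sec_add mul_simps distrib_left congr_add)
  qed
  then show ?thesis
    by (metis poly_mapping_sum_singles finite_keys)
qed

text \<open>A word is reduced from its right end: once the tail is in normal form,
  \<open>congr_gen_sec\<close> absorbs the next letter on the left.\<close>

lemma congr_sec_nf: "f \<sim> sec (nf f)"
proof -
  have "single (Word gs) 1 \<sim> sec (nf_word (Word gs))" for gs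
  proof (induction gs)
    case Nil
    then show ?case using sec_mo[of 0 0] by (simp add: nf_word_def congr_refl)
  next
    case (Cons g gs)
    have "single (Word (g # gs)) 1 = fgen g * single (Word gs) (1::'k)"
      by (simp add: fgen_def mult_single plus_word_def)
    also have "\<dots> \<sim> fgen g * sec (nf_word (Word gs))"
      by (rule congr_mult_left[OF Cons])
    also have "\<dots> \<sim> sec (nf_word (Word (g # gs)))"
      unfolding nf_word_Cons by (rule congr_gen_sec)
    finally show ?case .
  qed
  then have "pscale s (single w 1) \<sim> sec (nf (pscale s (single w 1)))" for w s
    using congr_scale[of _ _ s] by (cases w) (simp add: nf_pscale nf_single sec_scale)
  then have *: "single w s \<sim> sec (nf (single w s))" for w s
    by (metis single_scale)
  have "(\<Sum>m\<in>S. single m (lookup f m)) \<sim> sec (nf (\<Sum>m\<in>S. single m (lookup f m)))"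
    if "finite S" for S
    using that
  proof (induction S rule: finite_induct)
    case empty
    have "sec 0 = 0" by (simp add: sec_def)
    then show ?case by (simp add: congr_refl)
  next
    case (insert m S)
    then show ?case using * by (simp add: sec_add nf_add congr_add)
  qed
  then show ?thesis
    by (metis poly_mapping_sum_singles finite_keys)
qed

lemma kernel_le: "nf f = 0 \<Longrightarrow> f \<in> I"
  using congr_sec_nf[of f] by (simp add: congr_def sec_def)

end

text \<open>The kernel of \<open>nf\<close> is an ideal containing the relators, and by
  \<open>kernel_le\<close> it lies in every such ideal. Hence it is the intersection that defines
  the generated ideal.\<close>

lemma gwa_ideal_eq: "gwa_ideal q p = quot.fibre 0"
proof -
  have "gwa_ideal q p = \<Inter>{I. ideal I free_alg \<and> relators \<subseteq> I}"
    by (simp add: gwa_ideal_def genideal_def relators_def)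
  also have "\<dots> = {f. nf f = 0}"
    using ideal_kernel nf_relators kernel_le by (intro equalityI) auto
  finally show ?thesis by (simp add: quot.fibre_def)
qed

sublocale qplane_model q "gwa q p" quot.fibre
  unfolding gwa_def by (intro qplane_model.intro qplane_axioms quot.quotient gwa_ideal_eq)

abbreviation "G \<equiv> gwa q p"
abbreviation "\<nu> \<equiv> gnu q p"

abbreviation ab :: "'k qp \<Rightarrow> (word \<Rightarrow>\<^sub>0 'k) set" where
  "ab \<equiv> quot.fibre"

lemma gcls_eq: "gcls q p f = ab (nf f)"
  using quot.coset[of f] by (simp add: gcls_def gwa_ideal_eq)

lemma gx_eq: "gx q p = ab X" and gy_eq: "gy q p = ab Y" and gz_eq: "gz q p = ab Z"
  by (simp_all add: gx_def gy_def gz_def gcls_eq)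

lemma gscal_eq: "gscal q p s = ab (s *s mo 0 0)"
  by (simp add: gscal_def abs_simps)

section \<open>Polynomials in \<open>z\<close> inside the quantum plane\<close>

definition zpow :: "nat \<Rightarrow> 'k qp" where
  "zpow n = nf_word (Word (replicate n GZ))"

definition zp :: "'k poly \<Rightarrow> 'k qp" where
  "zp f = (\<Sum>i\<le>degree f. coeff f i *s zpow i)"

lemma zpow_0: "zpow 0 = mo 0 0" and zpow_Suc: "zpow (Suc n) = Z \<cdot> zpow n"
  by (simp_all add: zpow_def nf_word_Cons, simp add: nf_word_def)

lemma gpoly_eq: "gpoly q p f = ab (zp f)"
proof -
  have "nf (\<Sum>i\<in>S. single (Word (replicate i GZ)) (coeff f i)) = (\<Sum>i\<in>S. coeff f i *s zpow i)"
    if "finite S" for S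
    using that by (induction S rule: finite_induct) (simp_all add: nf_add nf_single zpow_def)
  then show ?thesis
    by (simp add: gpoly_def gcls_eq fpoly_def zp_def)
qed

lemma zp_superset: "degree f \<le> n \<Longrightarrow> zp f = (\<Sum>i\<le>n. coeff f i *s zpow i)"
  unfolding zp_def by (rule sum.mono_neutral_left) (auto simp: coeff_eq_0)

lemma zp_zero [simp]: "zp 0 = 0"
  by (simp add: zp_def)

lemma zp_pCons: "zp (pCons s f) = s *s mo 0 0 + Z \<cdot> zp f"
proof -
  have mul_sum: "Z \<cdot> sum g S = (\<Sum>i\<in>S. Z \<cdot> g i)" for g :: "nat \<Rightarrow> 'k qp" and S
    by (induction S rule: infinite_finite_induct) (simp_all add: mul_simps)
  have "zp (pCons s f) = (\<Sum>i\<le>Suc (degree f). coeff (pCons s f) i *s zpow i)"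
    by (rule zp_superset) (simp add: degree_pCons_le)
  also have "\<dots> = s *s mo 0 0 + (\<Sum>i\<le>degree f. coeff f i *s zpow (Suc i))"
    by (simp add: sum.atMost_Suc_shift zpow_0 del: sum.atMost_Suc)
  finally show ?thesis
    by (simp add: zp_def mul_sum zpow_Suc mul_simps)
qed

lemma zp_add: "zp (f + g) = zp f + zp g"
proof -
  let ?n = "max (degree f) (degree g)"
  have "degree (f + g) \<le> ?n" by (rule degree_add_le_max)
  then show ?thesis
    by (simp add: zp_superset[of _ ?n] scale_left_distrib sum.distrib)
qed

lemma zp_smult: "zp (smult s f) = s *s zp f"
  by (simp add: zp_superset[of "smult s f" "degree f"] zp_def scale_sum_right)

lemma zp_const: "zp [:s:] = s *s mo 0 0" and zp_one: "zp 1 = mo 0 0"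
  by (simp_all add: zp_pCons one_pCons)

lemma zp_mult: "zp (f * g) = zp f \<cdot> zp g"
  by (induction f) (simp_all add: zp_pCons zp_add zp_smult mul_simps mul_assoc zp_const)

lemma XZ: "X \<cdot> Z = q *s (Z \<cdot> X)" and ZY: "Z \<cdot> Y = q *s (Y \<cdot> Z)"
  by (simp_all add: Z_def mul_simps)

lemma YX: "Y \<cdot> X = c *s Z"
  by (simp add: Z_def)

lemma sigma_simps: "sigma q 0 = 0" "sigma q (pCons s f) = pCons s (smult q (sigma q f))"
  "sigma q (f + g) = sigma q f + sigma q g" "sigma q (f * g) = sigma q f * sigma q g"
  "sigma q (f - g) = sigma q f - sigma q g"
  by (simp_all add: sigma_def pcompose_pCons pcompose_add pcompose_mult pcompose_diff)

lemma X_zp: "X \<cdot> zp f = zp (sigma q f) \<cdot> X"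
proof (induction f)
  case (pCons s f)
  have "X \<cdot> (Z \<cdot> zp f) = q *s (Z \<cdot> (X \<cdot> zp f))"
    by (simp only: mul_assoc[symmetric] XZ scale_mul)
  then show ?case
    by (simp add: sigma_simps zp_pCons zp_smult mul_simps pCons.IH mul_assoc)
qed (simp add: sigma_simps)

lemma zp_Y: "zp f \<cdot> Y = Y \<cdot> zp (sigma q f)"
proof (induction f)
  case (pCons s f)
  have "Z \<cdot> (Y \<cdot> zp (sigma q f)) = q *s (Y \<cdot> (Z \<cdot> zp (sigma q f)))"
    by (simp only: mul_assoc[symmetric] ZY scale_mul)
  then show ?case
    by (simp add: sigma_simps zp_pCons zp_smult mul_simps pCons.IH mul_assoc)
qed (simp add: sigma_simps)

lemma Z_zp: "Z \<cdot> zp f = zp f \<cdot> Z"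
proof (induction f)
  case (pCons s f)
  have "Z \<cdot> (Z \<cdot> zp f) = Z \<cdot> (zp f \<cdot> Z)"
    by (simp only: pCons.IH)
  also have "\<dots> = (Z \<cdot> zp f) \<cdot> Z"
    by (simp only: mul_assoc)
  finally show ?case by (simp add: zp_pCons mul_simps)
qed simp

section \<open>The grading and the Nakayama automorphism in monomials\<close>

definition qdeg :: "nat \<times> nat \<Rightarrow> int" where
  "qdeg m = int (snd m) - int (fst m)"

definition homogeneous :: "int \<Rightarrow> 'k qp set" where
  "homogeneous d = {a. \<forall>m. lookup a m \<noteq> 0 \<longrightarrow> qdeg m = d}"

lemma homogeneous_closed:
  "0 \<in> homogeneous d" "a \<in> homogeneous d \<Longrightarrow> b \<in> homogeneous d \<Longrightarrow> a + b \<in> homogeneous d"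
  "a \<in> homogeneous d \<Longrightarrow> s *s a \<in> homogeneous d"
  by (auto simp: homogeneous_def lookup_add) (metis add.right_neutral)

lemma homogeneous_mo: "mo i j \<in> homogeneous (int j - int i)"
  by (auto simp: homogeneous_def qdeg_def lookup_mo)

lemma homogeneous_nf_word: "nf_word (Word gs) \<in> homogeneous (word_deg (Word gs))"
proof (induction gs)
  case Nil
  then show ?case using homogeneous_mo[of 0 0] by (simp add: nf_word_def word_deg_def)
next
  case (Cons g gs)
  have X: "X \<cdot> a \<in> homogeneous (1 + d)" if "a \<in> homogeneous d" for a d
    using that by (auto simp: homogeneous_def lookup_XY qdeg_def) fastforce
  have Y: "Y \<cdot> a \<in> homogeneous (- 1 + d)" if "a \<in> homogeneous d" for a d
    using that by (auto simp: homogeneous_def lookup_XY qdeg_def) fastforce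
  have "Z \<cdot> a = inverse c *s (Y \<cdot> (X \<cdot> a))" for a
    by (simp add: Z_def scale_mul flip: mul_assoc)
  then have Z: "Z \<cdot> a \<in> homogeneous d" if "a \<in> homogeneous d" for a d
    using Y[OF X[OF that]] homogeneous_closed(3) by simp
  show ?case
    using Cons X Y Z by (cases g) (simp_all add: nf_word_Cons word_deg_def)
qed

lemma gwa_deg_eq: "gwa_deg q p d = ab ` homogeneous d"
proof -
  have *: "nf ` {f. \<forall>w\<in>keys f. word_deg w = d} = homogeneous d"
  proof (intro equalityI subsetI)
    fix a assume "a \<in> nf ` {f. \<forall>w\<in>keys f. word_deg w = d}"
    then obtain f where f: "a = nf f" "\<And>w. w \<in> keys f \<Longrightarrow> word_deg w = d" by blast
    have "(\<Sum>w\<in>S. lookup f w *s nf_word w) \<in> homogeneous d" if "finite S" "S \<subseteq> keys f" for S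
      using that
    proof (induction S rule: finite_induct)
      case (insert w S)
      then show ?case
        using homogeneous_nf_word[of "letters w"] f(2)[of w] by (simp add: homogeneous_closed)
    qed (simp add: homogeneous_closed)
    then show "a \<in> homogeneous d" by (simp add: f(1) nf_def plift_def)
  next
    fix a assume a: "a \<in> homogeneous d"
    \<comment> \<open>The converse inclusion: \<open>sec\<close> respects the grading, since it
      sends \<open>y^i x^j\<close> to a word of degree \<open>j - i\<close>.\<close>
    have "word_deg w = d" if "w \<in> keys (sec a)" for w
    proof -
      have "(\<Sum>m\<in>keys a. lookup a m * lookup (single (Word (replicate (fst m) GY @ replicate (snd m) GX)) 1) w) \<noteq> 0"
        using that by (simp add: in_keys_iff sec_def plift_def lookup_sum)
      then obtain m where m: "m \<in> keys a"
        "lookup (single (Word (replicate (fst m) GY @ replicate (snd m) GX)) (1::'k)) w \<noteq> 0"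
        by (elim sum.not_neutral_contains_not_neutral) (auto simp del: lookup_single)
      then have "w = Word (replicate (fst m) GY @ replicate (snd m) GX)" "qdeg m = d"
        using a by (cases m; auto simp: lookup_single when_def homogeneous_def in_keys_iff split: if_splits)+
      then show ?thesis by (simp add: word_deg_def qdeg_def sum_list_replicate)
    qed
    then show "a \<in> nf ` {f. \<forall>w\<in>keys f. word_deg w = d}"
      using nf_sec[of a] by (intro image_eqI[of _ _ "sec a"]) auto
  qed
  then show ?thesis
    unfolding gwa_deg_def by (simp add: gcls_eq[abs_def] image_image flip: *)
qed

definition nu :: "'k qp \<Rightarrow> 'k qp" where
  "nu = plift (\<lambda>m. (q ^ snd m * inverse q ^ fst m) *s mo (fst m) (snd m))"

lemma nu_mo [simp]: "nu (mo i j) = (q ^ j * inverse q ^ i) *s mo i j"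
  by (simp add: nu_def)

lemma nu_linear: "nu (a + b) = nu a + nu b" "nu (s *s a) = s *s nu a"
  by (simp_all add: nu_def plift_add plift_scale)

lemma nu_zero [simp]: "nu 0 = 0"
  by (simp add: nu_def)

lemma nu_mul: "nu (a \<cdot> b) = nu a \<cdot> nu b"
  by (rule bilinear_ext_mo[of "\<lambda>a b. nu (a \<cdot> b)" "\<lambda>a b. nu a \<cdot> nu b"])
    (simp_all add: mul_simps nu_linear scale_simps power_add ac_simps)

lemma lookup_nu: "lookup (nu a) (i, j) = q ^ j * inverse q ^ i * lookup a (i, j)"
  by (rule lookup_linear_ext[of "\<lambda>a. lookup (nu a) (i, j)" "\<lambda>a. q ^ j * inverse q ^ i * lookup a (i, j)"])
    (auto simp: nu_linear lookup_add lookup_mo algebra_simps)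

lemma bij_nu: "bij nu"
proof (rule bijI)
  show "inj nu"
  proof (rule injI)
    fix a b assume "nu a = nu b"
    then have "lookup (nu a) (i, j) = lookup (nu b) (i, j)" for i j by simp
    then show "a = b"
      unfolding lookup_nu by (intro poly_mapping_eqI) (auto split: prod.splits)
  qed
  show "surj nu"
  proof (rule surjI)
    show "nu (plift (\<lambda>m. (inverse q ^ snd m * q ^ fst m) *s mo (fst m) (snd m)) a) = a" for a
      by (rule linear_ext_mo[of "\<lambda>a. nu (plift (\<lambda>m. (inverse q ^ snd m * q ^ fst m) *s mo (fst m) (snd m)) a)" "\<lambda>a. a"])
        (simp_all add: plift_add plift_scale nu_linear power_inverse, simp add: field_simps)
  qed
qed

lemma nu_Z: "nu Z = Z"
  by (simp add: Z_def nu_linear)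

text \<open>Uniqueness for the definite description of \<open>gnu\<close>: a homomorphism is
  determined by its values at \<open>x\<close> and \<open>y\<close>, because the monomials
  \<open>y^i x^j\<close> span the algebra.\<close>

lemma gnu_unique:
  assumes "F \<in> ring_hom (gwa q p) (gwa q p)"
    and "\<And>s a. a \<in> carrier (gwa q p) \<Longrightarrow> F (s \<odot>\<^bsub>gwa q p\<^esub> a) = s \<odot>\<^bsub>gwa q p\<^esub> F a"
    and "F (gx q p) = q \<odot>\<^bsub>gwa q p\<^esub> gx q p" "F (gy q p) = inverse q \<odot>\<^bsub>gwa q p\<^esub> gy q p"
  shows "F (ab a) = ab (nu a)"
proof -
  have "\<exists>b. F (ab a) = ab b" for a
    using ring_hom_closed[OF assms(1), of "ab a"] by (auto simp: carrier_A)
  then obtain L where L: "F (ab a) = ab (L a)" for a by metis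
  have add: "L (a + b) = L a + L b" and mul: "L (a \<cdot> b) = L a \<cdot> L b" and scale: "L (s *s a) = s *s L a"
    and one: "L (mo 0 0) = mo 0 0" for a b s
    using ring_hom_add[OF assms(1), of "ab a" "ab b"] ring_hom_mult[OF assms(1), of "ab a" "ab b"]
      assms(2)[of "ab a" s] ring_hom_one[OF assms(1)]
    by (simp_all add: abs_simps L)
  have X: "L X = nu X" and Y: "L Y = nu Y"
    using assms(3,4) by (simp_all add: gx_eq gy_eq abs_simps L)
  have *: "L (mo 0 j) = nu (mo 0 j)" for j
  proof (induction j)
    case (Suc j)
    then have "L (X \<cdot> mo 0 j) = nu (X \<cdot> mo 0 j)"
      by (simp only: mul nu_mul X)
    then show ?case by simp
  qed (simp add: one)
  have "L (mo i j) = nu (mo i j)" for i j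
  proof (induction i)
    case (Suc i)
    then have "L (Y \<cdot> mo i j) = nu (Y \<cdot> mo i j)"
      by (simp only: mul nu_mul Y)
    then show ?case by simp
  qed (rule *)
  then have "L a = nu a"
    by (rule linear_ext_mo[of L nu, OF add scale nu_linear])
  then show ?thesis by (simp add: L)
qed

lemma gnu_ab: "gnu q p (ab a) = ab (nu a)"
proof -
  let ?A = "gwa q p"
  define P where "P F \<longleftrightarrow> F \<in> ring_hom ?A ?A \<inter> extensional (carrier ?A) \<and> bij_betw F (carrier ?A) (carrier ?A) \<and>
     (\<forall>s. \<forall>a\<in>carrier ?A. F (s \<odot>\<^bsub>?A\<^esub> a) = s \<odot>\<^bsub>?A\<^esub> F a) \<and>
     F (gx q p) = q \<odot>\<^bsub>?A\<^esub> gx q p \<and> F (gy q p) = inverse q \<odot>\<^bsub>?A\<^esub> gy q p \<and> F (gz q p) = gz q p"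
    for F :: "(word \<Rightarrow>\<^sub>0 'k) set \<Rightarrow> (word \<Rightarrow>\<^sub>0 'k) set"
  define F where "F = (\<lambda>x\<in>carrier ?A. ab (nu (inv_into UNIV ab x)))"
  have F: "F (ab a) = ab (nu a)" for a
    by (simp add: F_def inj_abs)
  have "bij_betw F (carrier ?A) (carrier ?A)"
  proof (rule bij_betwI')
    show "F x = F y \<longleftrightarrow> x = y" if "x \<in> carrier ?A" "y \<in> carrier ?A" for x y
      using that bij_nu by (auto simp: carrier_A F bij_def inj_eq)
    show "F x \<in> carrier ?A" if "x \<in> carrier ?A" for x
      using that by (auto simp: carrier_A F)
    show "\<exists>x\<in>carrier ?A. y = F x" if y: "y \<in> carrier ?A" for y
    proof -
      obtain b where "y = ab b" using y by (auto simp: carrier_A)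
      moreover obtain a where "b = nu a" using bij_nu by (auto simp: bij_def surj_def)
      ultimately have "y = F (ab a)" by (simp add: F)
      then show ?thesis by (rule bexI) simp
    qed
  qed
  moreover have "F \<in> ring_hom ?A ?A"
    by (rule ring_hom_memI) (auto simp: carrier_A F abs_simps nu_mul nu_linear)
  ultimately have P: "P F"
    by (auto simp: P_def F_def carrier_A abs_smult nu_linear inj_abs gx_eq gy_eq gz_eq nu_Z)
  have "gnu q p = (THE F. P F)"
    by (simp add: gnu_def P_def)
  also have "\<dots> = F"
  proof (rule the_equality)
    fix F' assume P': "P F'"
    show "F' = F"
    proof
      fix x
      show "F' x = F x"
      proof (cases "x \<in> carrier ?A")
        case True
        then obtain a where "x = ab a" by (auto simp: carrier_A)
        then show ?thesis
          using gnu_unique[of F' a] P' by (simp add: F P_def)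
      next
        case False
        then show ?thesis using P P' by (auto simp: extensional_def P_def)
      qed
    qed
  qed (rule P)
  finally show ?thesis by (simp add: F)
qed

lemmas g_simps = gx_eq gy_eq gz_eq gscal_eq gpoly_eq gnu_ab abs_simps

end

section \<open>The small complexes\<close>

text \<open>Tuples are lists, and lists of varying length form no group. This notion of subgroup is
  what is needed to compare cosets of boundaries.\<close>

definition vsubgroup :: "nat \<Rightarrow> 'a::ab_group_add list set \<Rightarrow> bool" where
  "vsubgroup r B \<longleftrightarrow> (\<forall>b\<in>B. length b = r) \<and> B \<noteq> {} \<and> (\<forall>b\<in>B. \<forall>b'\<in>B. map2 (-) b b' \<in> B)"

definition vcoset :: "'a::ab_group_add list \<Rightarrow> 'a list set \<Rightarrow> 'a list set" where
  "vcoset v B = map2 (+) v ` B"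

lemma vsubgroup_diff: "vsubgroup r B \<Longrightarrow> b \<in> B \<Longrightarrow> b' \<in> B \<Longrightarrow> map2 (-) b b' \<in> B"
  and vsubgroup_length: "vsubgroup r B \<Longrightarrow> b \<in> B \<Longrightarrow> length b = r"
  by (auto simp: vsubgroup_def)

lemma map2_identities:
  fixes u v w :: "'a::ab_group_add list"
  shows "map2 (-) v v = replicate (length v) 0"
    and "length v = length w \<Longrightarrow> map2 (-) v (map2 (-) (replicate (length v) 0) w) = map2 (+) v w"
    and "length v = length w \<Longrightarrow> map2 (-) (replicate (length v) 0) (map2 (-) v w) = map2 (-) w v"
    and "length u = length v \<Longrightarrow> length v = length w \<Longrightarrow> map2 (+) v (map2 (+) (map2 (-) u v) w) = map2 (+) u w"
    and "map2 (+) v (replicate (length v) 0) = v"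
    and "length v = length w \<Longrightarrow> map2 (-) (map2 (+) v w) v = w"
proof -
  show "map2 (-) v v = replicate (length v) 0" "map2 (+) v (replicate (length v) 0) = v"
    by (induction v) simp_all
  show "length v = length w \<Longrightarrow> map2 (-) v (map2 (-) (replicate (length v) 0) w) = map2 (+) v w"
    "length v = length w \<Longrightarrow> map2 (-) (replicate (length v) 0) (map2 (-) v w) = map2 (-) w v"
    "length v = length w \<Longrightarrow> map2 (-) (map2 (+) v w) v = w"
    by (induction v w rule: list_induct2; simp)+
  show "length u = length v \<Longrightarrow> length v = length w \<Longrightarrow> map2 (+) v (map2 (+) (map2 (-) u v) w) = map2 (+) u w"
    by (induction u v w rule: list_induct3) simp_all
qed

lemma vsubgroup_zero:
  assumes B: "vsubgroup r B"
  shows "replicate r 0 \<in> B"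
proof -
  obtain b where b: "b \<in> B" using B by (auto simp: vsubgroup_def)
  then show ?thesis
    using vsubgroup_diff[OF B b b] by (simp only: map2_identities vsubgroup_length[OF B b])
qed

lemma vsubgroup_add:
  assumes B: "vsubgroup r B" and b: "b \<in> B" "b' \<in> B"
  shows "map2 (+) b b' \<in> B"
  using vsubgroup_diff[OF B b(1) vsubgroup_diff[OF B vsubgroup_zero[OF B] b(2)]]
    map2_identities(2)[of b b'] vsubgroup_length[OF B b(1)] vsubgroup_length[OF B b(2)] by simp

lemma vcoset_eqI:
  assumes B: "vsubgroup r B" and v: "length v = r" "length v' = r" and d: "map2 (-) v v' \<in> B"
  shows "vcoset v B = vcoset v' B"
proof -
  have *: "vcoset u B \<subseteq> vcoset u' B" if u: "length u = r" "length u' = r" "map2 (-) u u' \<in> B" for u u'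
  proof
    fix x assume "x \<in> vcoset u B"
    then obtain b where b: "b \<in> B" "x = map2 (+) u b" by (auto simp: vcoset_def)
    then have "x = map2 (+) u' (map2 (+) (map2 (-) u u') b)"
      using map2_identities(4)[of u u' b] u vsubgroup_length[OF B b(1)] by simp
    then show "x \<in> vcoset u' B"
      using vsubgroup_add[OF B u(3) b(1)] unfolding vcoset_def by blast
  qed
  have "map2 (-) v' v \<in> B"
    using vsubgroup_diff[OF B vsubgroup_zero[OF B] d] map2_identities(3)[of v v'] v by simp
  with * v d show ?thesis by blast
qed

lemma vcoset_self: "vsubgroup r B \<Longrightarrow> length v = r \<Longrightarrow> v \<in> vcoset v B"
proof -
  assume B: "vsubgroup r B" and v: "length v = r"
  have "v = map2 (+) v (replicate r 0)" using map2_identities(5)[of v] v by simp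
  then show ?thesis using vsubgroup_zero[OF B] unfolding vcoset_def by blast
qed

lemma vcoset_eqD:
  assumes B: "vsubgroup r B" and v: "length v = r" "length v' = r" and e: "vcoset v B = vcoset v' B"
  shows "map2 (-) v v' \<in> B"
proof -
  obtain b where b: "b \<in> B" "v = map2 (+) v' b"
    using vcoset_self[OF B v(1)] e by (auto simp: vcoset_def)
  then have "map2 (-) v v' = b"
    using map2_identities(6)[of v' b] v vsubgroup_length[OF B b(1)] by simp
  with b show ?thesis by simp
qed

lemma vsubgroupI:
  assumes "\<And>b. b \<in> B \<Longrightarrow> length b = r" "B \<noteq> {}" "\<And>b b'. b \<in> B \<Longrightarrow> b' \<in> B \<Longrightarrow> map2 (-) b b' \<in> B"
  shows "vsubgroup r B"
  using assms by (auto simp: vsubgroup_def)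

context gwa_plane
begin

lemma dd_p: "dd p = [([:c:], 1)]"
  by (simp add: dd_def p_eq upt_conv_Cons monom_0)

lemma sigma_const [simp]: "sigma q [:s:] = [:s:]" "sigma q 1 = 1"
  by (simp_all add: sigma_simps one_pCons)

lemma lsum_Nil: "lsum G [] = ab 0" and lsum_Cons: "lsum G (x # xs) = x \<oplus>\<^bsub>gwa q p\<^esub> lsum G xs"
  by (simp_all add: lsum_def abs_simps)

lemma emb_list [simp]: "emb f [ab a] = ab (f [a])" "emb f [ab a, ab b] = ab (f [a, b])"
  using emb_map[of f "[a]"] emb_map[of f "[a, b]"] by simp_all

lemma zp_linear: "zp [:0, s:] = s *s Z"
  by (simp add: zp_pCons mul_simps)

lemma nu_minus: "nu (- a) = - nu a"
  using nu_linear(2)[of "-1" a] by simp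

lemmas eval_simps = Fmat_def Let_def act_def ract_def mat_act_def lsum_Nil lsum_Cons g_simps dd_p
  zp_linear zp_const zp_one sigma_const Frank_def upt_rec nu_linear nu_minus nu_Z mul_simps

lemma vecs_eq: "vecs q p n = map ab ` {v. length v = Frank n}"
proof (intro equalityI subsetI)
  fix v assume v: "v \<in> vecs q p n"
  then have "v \<in> lists (carrier G)" by (auto simp: vecs_def)
  then obtain as where "v = map ab as" by (rule lists_carrierE)
  then show "v \<in> map ab ` {v. length v = Frank n}" using v by (auto simp: vecs_def)
qed (auto simp: vecs_def)

lemma length_eq_Frank:
  "{v. length v = Frank 0} = {[a] | a. True}"
  "{v. length v = Frank 1} = {[a, b, d] | a b d. True}"
  "{v. length v = Frank 2} = {[a, b, d, e] | a b d e. True}"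
  "{v. length v = Frank 3} = {[a, b, d, e] | a b d e. True}"
  by (auto simp: Frank_def length_Suc_conv numeral_eq_Suc)

text \<open>These six functions are the differentials of the small complexes for
  \<open>p = c z\<close>, out of degrees 0 and 1 of \<open>S\<close> and 1, 2, 3 of
  \<open>T\<close>. In \<open>T\<close> the left tensor factors of the matrix entries arrive on the
  right twisted by the Nakayama automorphism, whence the additional powers of
  \<open>q\<close>.\<close>

fun S0 :: "'k qp \<Rightarrow> 'k qp list" where
  "S0 a = [X \<cdot> a - a \<cdot> X, Y \<cdot> a - a \<cdot> Y, Z \<cdot> a - a \<cdot> Z]"

fun S1 :: "'k qp \<Rightarrow> 'k qp \<Rightarrow> 'k qp \<Rightarrow> 'k qp list" where
  "S1 a b e = [Y \<cdot> a + b \<cdot> X - c *s e, a \<cdot> Y + X \<cdot> b - (q * c) *s e,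
     q *s (Z \<cdot> a) - a \<cdot> Z + q *s (e \<cdot> X) - X \<cdot> e, Z \<cdot> b - q *s (b \<cdot> Z) + e \<cdot> Y - q *s (Y \<cdot> e)]"

fun T1 :: "'k qp \<Rightarrow> 'k qp \<Rightarrow> 'k qp \<Rightarrow> 'k qp list" where
  "T1 a b e = [q *s (a \<cdot> X) - X \<cdot> a + inverse q *s (b \<cdot> Y) - Y \<cdot> b + e \<cdot> Z - Z \<cdot> e]"

fun T2 :: "'k qp \<Rightarrow> 'k qp \<Rightarrow> 'k qp \<Rightarrow> 'k qp \<Rightarrow> 'k qp list" where
  "T2 a b d e = [inverse q *s (a \<cdot> Y) + Y \<cdot> b + q *s (d \<cdot> Z) - Z \<cdot> d,
     X \<cdot> a + q *s (b \<cdot> X) + e \<cdot> Z - q *s (Z \<cdot> e),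
     - (c *s a) - (q * c) *s b + q *s (X \<cdot> d) - q *s (d \<cdot> X) + Y \<cdot> e - e \<cdot> Y]"

fun T3 :: "'k qp \<Rightarrow> 'k qp \<Rightarrow> 'k qp \<Rightarrow> 'k qp \<Rightarrow> 'k qp list" where
  "T3 a b d e = [q *s (a \<cdot> X) - Y \<cdot> b + d \<cdot> Z - Z \<cdot> d,
     - (X \<cdot> a) + inverse q *s (b \<cdot> Y) + q *s (e \<cdot> Z) - q *s (Z \<cdot> e),
     - (c *s a) - inverse q *s (d \<cdot> Y) - Y \<cdot> e, - (c *s b) - X \<cdot> d - q *s (e \<cdot> X)]"

lemma S_d_0: "S_d q p 0 [ab a] = map ab (S0 a)"
  by (simp add: S_d_def eval_simps)

lemma S_d_1: "S_d q p 1 [ab a, ab b, ab e] = map ab (S1 a b e)"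
  by (simp add: S_d_def eval_simps algebra_simps)

lemma T_d_1: "T_d q p 1 [ab a, ab b, ab e] = map ab (T1 a b e)"
  by (simp add: T_d_def eval_simps algebra_simps)

lemma T_d_2: "T_d q p 2 [ab a, ab b, ab d, ab e] = map ab (T2 a b d e)"
  by (simp add: T_d_def eval_simps algebra_simps)

lemma T_d_3: "T_d q p 3 [ab a, ab b, ab d, ab e] = map ab (T3 a b d e)"
  by (simp add: T_d_def eval_simps algebra_simps)

definition SB :: "nat \<Rightarrow> 'k qp list set" where
  "SB n = (if n = 0 then {[0]} else if n = 1 then {S0 a | a. True} else {S1 a b e | a b e. True})"

definition TB :: "nat \<Rightarrow> 'k qp list set" where
  "TB n = (if n = 0 then {T1 a b e | a b e. True} else if n = 1 then {T2 a b d e | a b d e. True}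
     else {T3 a b d e | a b d e. True})"

lemma vsubgroup_SB:
  assumes "n \<le> 2"
  shows "vsubgroup (Frank n) (SB n)"
proof (rule vsubgroupI)
  fix b b' assume "b \<in> SB n" "b' \<in> SB n"
  moreover have "map2 (-) (S0 a) (S0 a') = S0 (a - a')" for a a'
    by (simp add: mul_simps algebra_simps)
  moreover have "map2 (-) (S1 a b d) (S1 a' b' d') = S1 (a - a') (b - b') (d - d')" for a b d a' b' d'
    by (simp add: mul_simps scale_simps algebra_simps)
  ultimately show "map2 (-) b b' \<in> SB n"
    by (auto simp: SB_def simp del: S0.simps S1.simps split: if_splits) blast+
next
  show "SB n \<noteq> {}"
    by (auto simp: SB_def simp del: S0.simps S1.simps)
qed (use assms in \<open>auto simp: SB_def Frank_def split: if_splits\<close>)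

lemma vsubgroup_TB:
  assumes "n \<le> 2"
  shows "vsubgroup (Frank n) (TB n)"
proof (rule vsubgroupI)
  fix b b' assume "b \<in> TB n" "b' \<in> TB n"
  moreover have "map2 (-) (T1 a b d) (T1 a' b' d') = T1 (a - a') (b - b') (d - d')" for a b d a' b' d'
    by (simp add: mul_simps scale_simps algebra_simps)
  moreover have "map2 (-) (T2 a b d e) (T2 a' b' d' e') = T2 (a - a') (b - b') (d - d') (e - e')" for a b d e a' b' d' e'
    by (simp add: mul_simps scale_simps algebra_simps)
  moreover have "map2 (-) (T3 a b d e) (T3 a' b' d' e') = T3 (a - a') (b - b') (d - d') (e - e')" for a b d e a' b' d' e'
    by (simp add: mul_simps scale_simps algebra_simps)
  ultimately show "map2 (-) b b' \<in> TB n"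
    by (auto simp: TB_def simp del: T1.simps T2.simps T3.simps split: if_splits) blast+
next
  show "TB n \<noteq> {}"
  proof -
    have "T1 0 0 0 \<in> TB 0" "T2 0 0 0 0 \<in> TB 1" "n \<noteq> 0 \<Longrightarrow> n \<noteq> 1 \<Longrightarrow> T3 0 0 0 0 \<in> TB n"
      unfolding TB_def by (simp_all del: T1.simps T2.simps T3.simps) blast+
    then show ?thesis by (metis empty_iff)
  qed
qed (use assms in \<open>auto simp: TB_def Frank_def split: if_splits\<close>)

lemma vcoset_ab: "(\<lambda>b. map2 (add G) (map ab v) b) ` map ab ` B = map ab ` vcoset v B"
proof -
  have "map2 (add G) (map ab v) (map ab b) = map ab (map2 (+) v b)" for b
    by (auto simp: list_eq_iff_nth_eq abs_simps)
  then show ?thesis by (simp add: vcoset_def image_image)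
qed

lemma S_bounds_eq: "n \<le> 2 \<Longrightarrow> S_bounds q p n = map ab ` SB n"
proof -
  assume "n \<le> 2"
  then consider "n = 0" | "n = 1" | "n = 2" by linarith
  then show ?thesis
  proof cases
    case 1
    then show ?thesis by (simp add: S_bounds_def SB_def vzero_def Frank_def abs_simps)
  next
    case 2
    have "S_d q p 0 ` vecs q p 0 = map ab ` {S0 a | a. True}"
      unfolding vecs_eq length_eq_Frank by (force simp: image_iff S_d_0 simp del: S0.simps)
    with 2 show ?thesis by (simp add: S_bounds_def SB_def)
  next
    case 3
    have "S_d q p 1 ` vecs q p 1 = map ab ` {S1 a b e | a b e. True}"
      unfolding vecs_eq length_eq_Frank by (force simp: image_iff S_d_1 simp del: S1.simps One_nat_def)
    with 3 show ?thesis by (simp add: S_bounds_def SB_def)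
  qed
qed

lemma T_bounds_eq: "n \<le> 2 \<Longrightarrow> T_d q p (n + 1) ` vecs q p (n + 1) = map ab ` TB n"
proof -
  assume "n \<le> 2"
  then consider "n = 0" | "n = 1" | "n = 2" by linarith
  then show ?thesis
  proof cases
    case 1
    have "T_d q p 1 ` vecs q p 1 = map ab ` {T1 a b e | a b e. True}"
      unfolding vecs_eq length_eq_Frank by (force simp: image_iff T_d_1 simp del: T1.simps One_nat_def)
    with 1 show ?thesis by (simp add: TB_def)
  next
    case 2
    have "T_d q p 2 ` vecs q p 2 = map ab ` {T2 a b d e | a b d e. True}"
      unfolding vecs_eq length_eq_Frank by (force simp: image_iff T_d_2 simp del: T2.simps)
    with 2 show ?thesis by (simp add: TB_def numeral_2_eq_2)
  next
    case 3
    have "T_d q p 3 ` vecs q p 3 = map ab ` {T3 a b d e | a b d e. True}"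
      unfolding vecs_eq length_eq_Frank by (force simp: image_iff T_d_3 simp del: T3.simps)
    with 3 show ?thesis by (simp add: TB_def)
  qed
qed

lemma S_class_eq: "n \<le> 2 \<Longrightarrow> S_class q p n (map ab v) = map ab ` vcoset v (SB n)"
  unfolding S_class_def S_bounds_eq vcoset_ab ..

lemma T_class_eq: "n \<le> 2 \<Longrightarrow> T_class q p n (map ab v) = map ab ` vcoset v (TB n)"
  unfolding T_class_def T_bounds_eq vcoset_ab ..

text \<open>Pullback along the comparison map. For \<open>p = c z\<close> the factor
  \<open>p1\<close> of \<open>d(p)\<close> is a scalar, so the terms \<open>[p1, z]\<close> vanish
  on normalized cochains.\<close>

definition etav :: "nat \<Rightarrow> ('k qp list \<Rightarrow> 'k qp) \<Rightarrow> 'k qp list" where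
  "etav n f = (if n = 0 then [f []] else if n = 1 then [f [X], f [Y], f [Z]]
     else [f [Y, X], f [X, Y], q *s f [Z, X] - f [X, Z], f [Z, Y] - q *s f [Y, Z]])"

lemma eta_cochain_emb:
  assumes "n \<le> 2" "mlin f"
  shows "eta_cochain q p n (emb f) = map ab (etav n f)"
proof -
  consider "n = 0" | "n = 1" | "n = 2" using assms(1) by linarith
  then show ?thesis
    by cases (simp_all add: eta_cochain_def eta_def etav_def eval_simps mlin_hd[OF assms(2)])
qed

lemma length_etav: "n \<le> 2 \<Longrightarrow> length (etav n f) = Frank n"
  by (simp add: etav_def Frank_def)

lemma etav_diff: "map2 (-) (etav n f) (etav n g) = etav n (\<lambda>as. f as - g as)"
  by (simp add: etav_def scale_simps)

lemma etav_delta: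
  assumes "n \<le> 2" "cochain g"
  shows "etav n (delta g) \<in> SB n"
proof -
  have m: "mlin g" using assms(2) by (simp add: cochain_def)
  \<comment> \<open>The coboundary on two generators involves \<open>g\<close> at their product. By
    the relations the contributions at \<open>x z\<close>, \<open>z x\<close> and at
    \<open>z y\<close>, \<open>y z\<close> cancel in pairs, while \<open>y x\<close> and
    \<open>x y\<close> leave multiples of \<open>g [Z]\<close>.\<close>
  have g: "g [Y \<cdot> X] = c *s g [Z]" "g [X \<cdot> Y] = (q * c) *s g [Z]"
    "g [Z \<cdot> X] = inverse q *s g [X \<cdot> Z]" "g [Z \<cdot> Y] = q *s g [Y \<cdot> Z]"
    unfolding YX XY XZ ZY by (simp_all add: mlin_hd[OF m])
  consider "n = 0" | "n = 1" | "n = 2" using assms(1) by linarith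
  then show ?thesis
  proof cases
    case 1
    then show ?thesis by (simp add: etav_def SB_def)
  next
    case 2
    then have "etav n (delta g) = S0 (g [])" by (simp add: etav_def)
    with 2 show ?thesis by (auto simp: SB_def)
  next
    case 3
    then have "etav n (delta g) = S1 (g [X]) (g [Y]) (g [Z])"
      by (simp add: etav_def g scale_simps mul_simps algebra_simps del: mo_X qmul_mo)
    with 3 show ?thesis by (auto simp: SB_def simp del: S1.simps)
  qed
qed

lemma HH_to_S_Theta:
  assumes n: "n \<le> 2" and w: "w \<in> h5_deg n"
  shows "HH_to_S q p n (Theta w) = map ab ` vcoset (etav n (rep w)) (SB n)"
proof -
  have "Theta w \<inter> HC_deg G n = emb ` {f. cocycle f \<and> psi f = w \<and> (\<forall>as. length as \<noteq> n \<longrightarrow> f as = 0)}"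
    by (auto simp: Theta_eq HC_deg_eq cocycle_def)
  moreover have "S_class q p n (eta_cochain q p n (emb f)) = map ab ` vcoset (etav n (rep w)) (SB n)"
    if f: "cocycle f" "psi f = w" for f
  proof -
    let ?d = "\<lambda>as. f as - rep w as"
    have "cocycle ?d" "psi ?d = 0"
      using f cocycle_rep[of w] by (simp_all add: cocycle_def cochain_diff delta_diff[abs_def] psi_diff psi_rep)
    then obtain g where "cochain g" "?d = delta g" by (rule psi_eq_0D)
    then have "map2 (-) (etav n f) (etav n (rep w)) \<in> SB n"
      using etav_delta[OF n] by (simp add: etav_diff)
    then have "vcoset (etav n f) (SB n) = vcoset (etav n (rep w)) (SB n)"
      using n by (intro vcoset_eqI[OF vsubgroup_SB]) (simp_all add: length_etav)
    then show ?thesis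
      using f n by (simp add: eta_cochain_emb cocycle_mlin S_class_eq)
  qed
  moreover have "\<exists>f. cocycle f \<and> psi f = w \<and> (\<forall>as. length as \<noteq> n \<longrightarrow> f as = 0)"
    using w by (intro exI[of _ "rep w"]) (auto simp: cocycle_rep psi_rep rep_homogeneous)
  ultimately show ?thesis
    unfolding HH_to_S_def by auto
qed

text \<open>The coordinates in degree \<open>n\<close> can be read off from \<open>etav n\<close>,
  and they vanish on boundaries of \<open>S\<close> for the same reason as on Hochschild
  coboundaries. This yields injectivity of \<open>HH_to_S\<close>.\<close>

lemma psi_eq_0_if_SB:
  assumes n: "n \<le> 2" and f: "etav n f \<in> SB n" "psi f \<in> h5_deg n"
  shows "psi f = 0"
proof -
  consider "n = 0" | "n = 1" | "n = 2" using assms(1) by linarith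
  then show ?thesis
  proof cases
    case 1
    then show ?thesis using f by (simp add: psi_def h5_deg_def SB_def etav_def)
  next
    case 2
    then obtain a where "f [X] = X \<cdot> a - a \<cdot> X" "f [Y] = Y \<cdot> a - a \<cdot> Y"
      using f(1) by (auto simp: SB_def etav_def)
    then show ?thesis using 2 f(2) by (simp add: psi_def h5_deg_def lookup_minus lookup_XY)
  next
    case 3
    then obtain a b e where "f [Y, X] = Y \<cdot> a + b \<cdot> X - c *s e" "f [X, Y] = a \<cdot> Y + X \<cdot> b - (q * c) *s e"
      using f(1) by (auto simp: SB_def etav_def)
    then have "rho f [] = a \<cdot> Y + X \<cdot> b - q *s (Y \<cdot> a + b \<cdot> X)"
      by (simp add: rho_def scale_simps)
    then show ?thesis using 3 f(2) relation_values[of a b] by (simp add: psi_def h5_deg_def)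
  qed
qed

lemma inj_HH_to_S: "n \<le> 2 \<Longrightarrow> inj_on (HH_to_S q p n) (HH_deg G n)"
proof (rule inj_onI)
  fix x y assume n: "n \<le> 2" and "x \<in> HH_deg G n" "y \<in> HH_deg G n" and e: "HH_to_S q p n x = HH_to_S q p n y"
  then obtain v w where v: "x = Theta v" "v \<in> h5_deg n" and w: "y = Theta w" "w \<in> h5_deg n"
    by (auto simp: HH_deg_eq)
  have "map ab ` vcoset (etav n (rep v)) (SB n) = map ab ` vcoset (etav n (rep w)) (SB n)"
    using e v w n by (simp add: HH_to_S_Theta)
  then have "vcoset (etav n (rep v)) (SB n) = vcoset (etav n (rep w)) (SB n)"
    using inj_abs by (simp add: inj_image_eq_iff)
  then have "etav n (\<lambda>as. rep v as - rep w as) \<in> SB n"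
    unfolding etav_diff[symmetric] using n by (intro vcoset_eqD[OF vsubgroup_SB]) (simp_all add: length_etav)
  moreover have "psi (\<lambda>as. rep v as - rep w as) \<in> h5_deg n"
    by (rule psi_homogeneous) (use v w in \<open>simp add: rep_homogeneous\<close>)
  ultimately have "psi (\<lambda>as. rep v as - rep w as) = 0"
    by (rule psi_eq_0_if_SB[OF n])
  then show "x = y" using v w by (simp add: psi_diff psi_rep)
qed

text \<open>Gives the cocycles named in the theorem their coordinates: each is compared, up to a
  boundary of \<open>S\<close>, with the image of the standard representative.\<close>

lemma HH_class_eq:
  assumes "n \<le> 2" "w \<in> h5_deg n" "length v = Frank n" "map2 (-) v (etav n (rep w)) \<in> SB n"
  shows "HH_class q p n (map ab v) = Theta w"
  unfolding HH_class_def
proof (rule inv_into_f_eq)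
  show "inj_on (HH_to_S q p n) (HH_deg G n)" by (rule inj_HH_to_S[OF assms(1)])
  show "Theta w \<in> HH_deg G n" using assms by (simp add: Theta_in_HH_deg)
  have "vcoset v (SB n) = vcoset (etav n (rep w)) (SB n)"
    using assms by (intro vcoset_eqI[OF vsubgroup_SB]) (simp_all add: length_etav)
  then show "HH_to_S q p n (Theta w) = S_class q p n (map ab v)"
    using assms by (simp add: HH_to_S_Theta S_class_eq)
qed

end

section \<open>Van den Bergh duality\<close>

locale gwa_duality = gwa_plane q c p for q c :: "'k::field" and p :: "'k poly" +
  fixes \<alpha> \<beta> :: "'k poly"
  assumes bezout: "\<alpha> * p + \<beta> * pderiv p = 1"
begin

abbreviation a0 :: "'k qp" where "a0 \<equiv> zp \<alpha>"
abbreviation a1 :: "'k qp" where "a1 \<equiv> zp (sigma q \<alpha>)"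

lemma pderiv_p: "pderiv p = [:c:]"
  by (simp add: p_eq pderiv_pCons)

text \<open>For \<open>p = c z\<close> the Bezout identity can be solved for \<open>\<beta>\<close>,
  which leaves \<open>\<alpha>\<close> as the only free parameter in the duality map.\<close>

lemma zp_beta: "zp \<beta> = inverse c *s mo 0 0 - Z \<cdot> a0"
proof -
  have "zp (\<alpha> * [:0, c:] + \<beta> * [:c:]) = mo 0 0"
    using bezout unfolding pderiv_p by (simp add: zp_one flip: p_eq)
  then have "c *s (Z \<cdot> a0) + c *s zp \<beta> = mo 0 0"
    unfolding zp_add zp_mult zp_linear zp_const by (simp add: mul_simps Z_zp)
  then have "inverse c *s (c *s (Z \<cdot> a0) + c *s zp \<beta>) = inverse c *s mo 0 0"
    by simp
  then show ?thesis by (simp add: scale_simps algebra_simps)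
qed

lemma zp_beta': "zp (sigma q \<beta>) = inverse c *s mo 0 0 - q *s (Z \<cdot> a1)"
proof -
  have "sigma q (\<alpha> * p + \<beta> * pderiv p) = 1"
    by (simp only: bezout sigma_const)
  then have "zp (sigma q \<alpha> * [:0, c * q:] + sigma q \<beta> * [:c:]) = mo 0 0"
    by (simp only: sigma_simps(3,4) sigma_p pderiv_p sigma_const zp_one)
  then have "(c * q) *s (Z \<cdot> a1) + c *s zp (sigma q \<beta>) = mo 0 0"
    unfolding zp_add zp_mult zp_linear zp_const by (simp add: mul_simps Z_zp)
  then have "inverse c *s ((c * q) *s (Z \<cdot> a1) + c *s zp (sigma q \<beta>)) = inverse c *s mo 0 0"
    by simp
  moreover have "inverse c * (c * q) = q" by simp
  ultimately have "q *s (Z \<cdot> a1) + zp (sigma q \<beta>) = inverse c *s mo 0 0"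
    by (simp only: scale_right_distrib scale_scale left_inverse[OF c_nonzero] scale_one)
  then show ?thesis by (simp add: algebra_simps)
qed

text \<open>Rewriting to a normal form for words in \<open>X\<close>, \<open>Y\<close>, \<open>Z\<close>, \<open>a0\<close> and \<open>a1\<close>.\<close>

lemma XY': "X \<cdot> Y = (q * c) *s Z" and YX': "Y \<cdot> X = c *s Z"
  by (simp_all only: XY YX scale_scale)

lemma word_rules:
  "X \<cdot> Y = (q * c) *s Z" "Y \<cdot> X = c *s Z" "X \<cdot> Z = q *s (Z \<cdot> X)" "Z \<cdot> Y = q *s (Y \<cdot> Z)"
  "X \<cdot> a0 = a1 \<cdot> X" "a0 \<cdot> Y = Y \<cdot> a1" "Z \<cdot> a0 = a0 \<cdot> Z" "Z \<cdot> a1 = a1 \<cdot> Z"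
  "X \<cdot> (Y \<cdot> r) = (q * c) *s (Z \<cdot> r)" "Y \<cdot> (X \<cdot> r) = c *s (Z \<cdot> r)" "X \<cdot> (Z \<cdot> r) = q *s (Z \<cdot> (X \<cdot> r))"
  "Z \<cdot> (Y \<cdot> r) = q *s (Y \<cdot> (Z \<cdot> r))" "X \<cdot> (a0 \<cdot> r) = a1 \<cdot> (X \<cdot> r)" "a0 \<cdot> (Y \<cdot> r) = Y \<cdot> (a1 \<cdot> r)"
  "Z \<cdot> (a0 \<cdot> r) = a0 \<cdot> (Z \<cdot> r)" "Z \<cdot> (a1 \<cdot> r) = a1 \<cdot> (Z \<cdot> r)"
  "Y \<cdot> (a1 \<cdot> X) = c *s (a0 \<cdot> Z)"
  by (simp_all only: XY' YX' XZ ZY X_zp zp_Y Z_zp mul_assoc[symmetric] scale_mul,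
      simp_all only: zp_Y[symmetric] mul_assoc YX' mul_scale)

text \<open>The duality map in the quantum plane. As \<open>p2 = 1\<close>, its derivative is zero,
  and the last entry of the middle matrix vanishes.\<close>

fun gv :: "nat \<Rightarrow> 'k qp list \<Rightarrow> 'k qp list" where
  "gv n [a] = [a \<cdot> zp \<beta>, - (inverse q *s (a \<cdot> zp (sigma q \<beta>))), inverse q *s (a \<cdot> (a0 \<cdot> Y)), 0]"
| "gv n [a, b, e] = [- (inverse q *s (b \<cdot> zp (sigma q \<beta>))) - inverse q *s (e \<cdot> (a0 \<cdot> Y)), a \<cdot> zp \<beta>, a \<cdot> (a0 \<cdot> Y)]"
| "gv n [a, b, e, d] = [- (a \<cdot> zp \<beta>) + inverse q *s (b \<cdot> zp (sigma q \<beta>)) - inverse q *s (e \<cdot> (a0 \<cdot> Y))]"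
| "gv n _ = []"

lemma gmat_0: "mat_act q p (gmat q p \<alpha> \<beta> 0) [ab a] = map ab (gv 0 [a])"
  by (simp add: gmat_def eval_simps)

lemma gmat_1: "mat_act q p (gmat q p \<alpha> \<beta> 1) [ab a, ab b, ab e] = map ab (gv 1 [a, b, e])"
  by (simp add: gmat_def eval_simps sigma_simps)

lemma gmat_2: "mat_act q p (gmat q p \<alpha> \<beta> 2) [ab a, ab b, ab e, ab d] = map ab (gv 2 [a, b, e, d])"
  by (simp add: gmat_def eval_simps)

lemma gmat_eq: "n \<le> 2 \<Longrightarrow> length v = Frank n \<Longrightarrow> mat_act q p (gmat q p \<alpha> \<beta> n) (map ab v) = map ab (gv n v)"
proof -
  assume "n \<le> 2" "length v = Frank n"
  then consider a where "n = 0" "v = [a]" | a b e where "n = 1" "v = [a, b, e]" | a b e d where "n = 2" "v = [a, b, e, d]"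
    by (auto simp: Frank_def le_Suc_eq numeral_2_eq_2 length_Suc_conv numeral_eq_Suc split: if_splits)
  then show ?thesis
    by cases (use gmat_0 gmat_1 gmat_2 in simp_all)
qed

lemma gv_add: "length v = Frank n \<Longrightarrow> length v' = Frank n \<Longrightarrow> gv n (map2 (-) v v') = map2 (-) (gv n v) (gv n v')"
  by (cases "n = 0"; cases "n = 1")
    (auto simp: Frank_def length_Suc_conv numeral_eq_Suc mul_simps scale_simps algebra_simps)

lemma length_gv: "n \<le> 2 \<Longrightarrow> length v = Frank n \<Longrightarrow> length (gv n v) = Frank (2 - n)"
  by (cases "n = 0"; cases "n = 1") (auto simp: Frank_def length_Suc_conv numeral_eq_Suc)

text \<open>The arguments of \<open>T2\<close> are the components of \<open>gv 0 [a]\<close>: the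
  duality map commutes with the differentials. The same holds for \<open>gv_S1\<close>, one degree
  higher.\<close>

lemma gv_S0: "gv 1 (S0 a) = T2 (a \<cdot> zp \<beta>) (- (inverse q *s (a \<cdot> zp (sigma q \<beta>)))) (inverse q *s (a \<cdot> (a0 \<cdot> Y))) 0"
  by (simp add: zp_beta zp_beta' mul_simps mul_assoc scale_simps word_rules del: qmul_mo)
    (simp add: field_simps)

lemma gv_S1: "gv 2 (S1 a b e) = T1 (- (inverse q *s (b \<cdot> zp (sigma q \<beta>))) - inverse q *s (e \<cdot> (a0 \<cdot> Y))) (a \<cdot> zp \<beta>) (a \<cdot> (a0 \<cdot> Y))"
  by (simp add: zp_beta zp_beta' mul_simps mul_assoc scale_simps word_rules del: qmul_mo)
    (simp add: field_simps)

lemma gv_SB: "n \<le> 2 \<Longrightarrow> b \<in> SB n \<Longrightarrow> gv n b \<in> TB (2 - n)"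
proof -
  assume n: "n \<le> 2" and b: "b \<in> SB n"
  consider "n = 0" | "n = 1" | "n = 2" using n by linarith
  then show ?thesis
  proof cases
    case 1
    then show ?thesis
      using b vsubgroup_zero[OF vsubgroup_TB[of 2]] by (simp add: SB_def Frank_def numeral_eq_Suc)
  next
    case 2
    then obtain a where "b = S0 a" using b by (auto simp: SB_def)
    then show ?thesis using 2 gv_S0[of a] by (auto simp: TB_def simp del: T2.simps S0.simps)
  next
    case 3
    then obtain a b' e where "b = S1 a b' e" using b by (auto simp: SB_def simp del: S1.simps)
    then show ?thesis using 3 gv_S1[of a b' e] by (auto simp: TB_def simp del: T1.simps S1.simps)
  qed
qed

lemma S_to_T_eq:
  assumes n: "n \<le> 2" and v: "length v = Frank n"
  shows "S_to_T q p \<alpha> \<beta> n (map ab ` vcoset v (SB n)) = map ab ` vcoset (gv n v) (TB (2 - n))"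
proof -
  have "T_class q p (2 - n) (mat_act q p (gmat q p \<alpha> \<beta> n) (map ab u)) = map ab ` vcoset (gv n v) (TB (2 - n))"
    if u: "u \<in> vcoset v (SB n)" for u
  proof -
    obtain b where b: "b \<in> SB n" "u = map2 (+) v b" using u by (auto simp: vcoset_def)
    have lb: "length b = Frank n" using vsubgroup_length[OF vsubgroup_SB[OF n] b(1)] .
    then have lu: "length u = Frank n" using v b by simp
    have "map2 (-) (gv n u) (gv n v) = gv n b"
      using gv_add[OF lu v] map2_identities(6)[of v b] v lb b by simp
    then have "map2 (-) (gv n u) (gv n v) \<in> TB (2 - n)" using gv_SB[OF n b(1)] by simp
    then have "vcoset (gv n u) (TB (2 - n)) = vcoset (gv n v) (TB (2 - n))"
      using n lu v by (intro vcoset_eqI[OF vsubgroup_TB]) (simp_all add: length_gv)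
    then show ?thesis using n lu by (simp add: gmat_eq T_class_eq)
  qed
  moreover have "vcoset v (SB n) \<noteq> {}"
    using vcoset_self[OF vsubgroup_SB[OF n] v] by blast
  ultimately show ?thesis by (auto simp: S_to_T_def)
qed

text \<open>Representatives of the dual classes that do not depend on \<open>\<alpha>\<close> and \<open>\<beta>\<close>.\<close>

fun dual :: "nat \<Rightarrow> 'k h5 \<Rightarrow> 'k qp list" where
  "dual n (w, wx, wy, wu, wv) = (if n = 0 then [(w / c) *s mo 0 0, (- w / (q * c)) *s mo 0 0, 0, 0]
     else if n = 1 then [(- wy / (q * c)) *s Y, (wx / c) *s X, 0]
     else [((1 - q) * wu / (q * c)) *s mo 0 0 + wv *s Z])"

lemma dZ: "dx Z = Z" "dy Z = Z" "d1 Z = inverse c *s Y" "d2 Z = inverse c *s X"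
  by (simp_all add: Z_def d_linear)

text \<open>The argument of \<open>T3\<close> is forced by the third component: there the left side
  is \<open>s / q\<close> times \<open>Y \<cdot> a1\<close>, and \<open>T3 a 0 0 0\<close> has
  \<open>- c a\<close>.\<close>

lemma dual_diff_0: "map2 (-) (gv 0 [s *s mo 0 0]) (dual 0 (s, 0, 0, 0, 0)) = T3 (- ((s * inverse q * inverse c) *s (Y \<cdot> a1))) 0 0 0"
  by (simp add: zp_beta zp_beta' mul_simps mul_assoc scale_simps word_rules del: qmul_mo)
    (simp add: field_simps)

text \<open>Again the third component determines the witness: the left side has
  \<open>s X a0 Y = s q c a1 Z\<close>, and \<open>T2 0 b 0 0\<close> has
  \<open>- q c b\<close>.\<close>

lemma dual_diff_1: "map2 (-) (gv 1 [s *s X, t *s Y, (s + t) *s Z]) (dual 1 (0, s, t, 0, 0)) = T2 0 (- (s *s (a1 \<cdot> Z))) 0 0"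
proof -
  have e: "(q * s + q * t) / q = s + t" by (simp add: field_simps)
  show ?thesis
  by (simp add: zp_beta zp_beta' mul_simps mul_assoc scale_simps word_rules del: qmul_mo)
    (simp add: field_simps e)
qed

lemma dual_2: "gv 2 (etav 2 (rep (0, 0, 0, s, t))) = dual 2 (0, 0, 0, s, t)"
  by (simp add: etav_def dZ zp_beta zp_beta' mul_simps mul_assoc scale_simps word_rules del: qmul_mo)
    (simp add: field_simps)

lemma dual_diff:
  assumes "n \<le> 2" "w \<in> h5_deg n"
  shows "map2 (-) (gv n (etav n (rep w))) (dual n w) \<in> TB (2 - n)"
proof -
  obtain w0 wx wy wu wv where w: "w = (w0, wx, wy, wu, wv)" by (cases w)
  consider "n = 0" | "n = 1" | "n = 2" using assms(1) by linarith
  then show ?thesis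
  proof cases
    case 1
    then have w: "w = (w0, 0, 0, 0, 0)" using assms w by (simp add: h5_deg_def)
    have "etav 0 (rep w) = [w0 *s mo 0 0]" by (simp add: etav_def w)
    then show ?thesis using dual_diff_0[of w0] 1 w by (auto simp: TB_def simp del: T3.simps dual.simps gv.simps)
  next
    case 2
    then have w: "w = (0, wx, wy, 0, 0)" using assms w by (simp add: h5_deg_def)
    have "etav 1 (rep w) = [wx *s X, wy *s Y, (wx + wy) *s Z]" by (simp add: etav_def w dZ scale_left_distrib)
    then show ?thesis using dual_diff_1[of wx wy] 2 w by (auto simp: TB_def simp del: T2.simps dual.simps gv.simps)
  next
    case 3
    then have w: "w = (0, 0, 0, wu, wv)" using assms w by (simp add: h5_deg_def)
    have "map2 (-) (dual 2 w) (dual 2 w) = [0]" by (simp add: w)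
    moreover have "[0] \<in> TB 0" using vsubgroup_zero[OF vsubgroup_TB[of 0]] by (simp add: Frank_def)
    ultimately show ?thesis using 3 by (simp add: w dual_2 del: dual.simps)
  qed
qed

lemma S_to_T_Theta:
  assumes "n \<le> 2" "w \<in> h5_deg n"
  shows "S_to_T q p \<alpha> \<beta> n (HH_to_S q p n (Theta w)) = map ab ` vcoset (dual n w) (TB (2 - n))"
proof -
  have "length (dual n w) = Frank (2 - n)"
    using assms(1) by (cases w) (auto simp: Frank_def)
  then have "vcoset (gv n (etav n (rep w))) (TB (2 - n)) = vcoset (dual n w) (TB (2 - n))"
    using assms dual_diff by (intro vcoset_eqI[OF vsubgroup_TB]) (simp_all add: length_gv length_etav)
  then show ?thesis
    using assms by (simp add: HH_to_S_Theta S_to_T_eq length_etav)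
qed

end

section \<open>Normalized chains\<close>

lemma lin_ext_eq_plift: "lin_ext F = plift F"
  by (simp add: fun_eq_iff lin_ext_def plift_def pscale_def)

lemma plift_uminus: "plift F (- c) = - plift F c"
  using plift_scale[of F "-1" c] by simp

lemma plift_diff: "plift F (c - d) = plift F c - plift F d"
  using plift_add[of F c "- d"] by (simp add: plift_uminus)

lemma plift_plift: "plift G (plift F c) = plift (\<lambda>m. plift G (F m)) c"
  by (rule pscale_linear_ext[of "\<lambda>c. plift G (plift F c)" "plift (\<lambda>m. plift G (F m))"]) (simp_all add: plift_add plift_scale)

context qplane_model
begin

abbreviation rp :: "'a \<Rightarrow> 'k qp" where "rp \<equiv> inv_into UNIV abs"

lemma rp_abs [simp]: "rp (abs a) = a"
  by (simp add: inj_abs)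

lemma map_rp_abs [simp]: "map rp (map abs as) = as"
  by (simp add: o_def)

text \<open>A functional on lists, extended linearly to formal chains. The one-point index type lets
  \<open>plift\<close> serve for scalar values.\<close>

definition ext :: "('k qp list \<Rightarrow> 'k) \<Rightarrow> ('a list \<Rightarrow>\<^sub>0 'k) \<Rightarrow> 'k" where
  "ext \<phi> c = lookup (plift (\<lambda>l. single () (\<phi> (map rp l))) c) ()"

lemma ext_simps [simp]:
  "ext \<phi> 0 = 0" "ext \<phi> (c + d) = ext \<phi> c + ext \<phi> d" "ext \<phi> (c - d) = ext \<phi> c - ext \<phi> d" "ext \<phi> (- c) = - ext \<phi> c"
  "ext \<phi> (pscale s c) = s * ext \<phi> c" "ext \<phi> (single l s) = s * \<phi> (map rp l)"
  by (simp_all add: ext_def plift_add plift_diff plift_uminus plift_scale lookup_add lookup_minus)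

lemma ext_eq_sum: "ext \<phi> c = (\<Sum>l\<in>keys c. lookup c l * \<phi> (map rp l))"
  by (simp add: ext_def plift_def lookup_sum)

lemma ext_cong: "(\<And>l. l \<in> keys c \<Longrightarrow> \<phi> (map rp l) = \<psi> (map rp l)) \<Longrightarrow> ext \<phi> c = ext \<psi> c"
  by (simp add: ext_eq_sum)

lemma ext_plift: "ext \<phi> (plift F c) = (\<Sum>l\<in>keys c. lookup c l * ext \<phi> (F l))"
proof -
  have "ext \<phi> (\<Sum>l\<in>S. pscale (lookup c l) (F l)) = (\<Sum>l\<in>S. lookup c l * ext \<phi> (F l))" if "finite S" for S
    using that by (induction S rule: finite_induct) simp_all
  then show ?thesis by (simp add: plift_def)
qed

text \<open>The condition under which a functional descends to the normalized chains; the first slot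
  is the coefficient and is not reduced modulo scalars.\<close>

definition multi :: "('k qp list \<Rightarrow> 'k) \<Rightarrow> bool" where
  "multi \<phi> \<longleftrightarrow> (\<forall>as bs a b s. \<phi> (as @ (a + b) # bs) = \<phi> (as @ a # bs) + \<phi> (as @ b # bs) \<and>
     \<phi> (as @ (s *s a) # bs) = s * \<phi> (as @ a # bs) \<and> (as \<noteq> [] \<longrightarrow> \<phi> (as @ mo 0 0 # bs) = 0))"

lemma ext_tensor_rels:
  assumes "multi \<phi>" "r \<in> tensor_rels A"
  shows "ext \<phi> r = 0"
  using assms(2)
proof (induction rule: tensor_rels.induct)
  case (additive as bs a b s)
  then obtain as' bs' a' b' where "as = map abs as'" "bs = map abs bs'" "a = abs a'" "b = abs b'"
    by (metis lists_carrierE carrierE)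
  then show ?case
    using assms(1) by (simp add: abs_simps o_def multi_def algebra_simps)
next
  case (scalar as bs a e s)
  then obtain as' bs' a' where "as = map abs as'" "bs = map abs bs'" "a = abs a'"
    by (metis lists_carrierE carrierE)
  then show ?case
    using assms(1) by (simp add: abs_simps o_def multi_def)
next
  case (normalized as bs s)
  then obtain as' bs' where "as = map abs as'" "bs = map abs bs'"
    by (metis lists_carrierE)
  then show ?case
    using assms(1) normalized by (simp add: abs_simps o_def multi_def)
qed simp_all

lemma tensor_rels_scale: "r \<in> tensor_rels A \<Longrightarrow> pscale s r \<in> tensor_rels A"
proof (induction rule: tensor_rels.induct)
  case zero
  then show ?case using tensor_rels.zero by simp
next
  case (add r r')
  then show ?case by (simp add: pscale.scale_right_distrib tensor_rels.add)
next
  case (additive as bs a b d)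
  from tensor_rels.additive[OF additive, of "s * d"] show ?case
    by (simp add: pscale.scale_right_diff_distrib pscale_single)
next
  case (scalar as bs a e d)
  from tensor_rels.scalar[OF scalar, of e "s * d"] show ?case
    by (simp add: pscale.scale_right_diff_distrib pscale_single mult.assoc)
next
  case (normalized as bs d)
  from tensor_rels.normalized[OF normalized, of "s * d"] show ?case
    by (simp add: pscale_single)
qed

definition chain_eq :: "('a list \<Rightarrow>\<^sub>0 'k) \<Rightarrow> ('a list \<Rightarrow>\<^sub>0 'k) \<Rightarrow> bool" (infix "\<approx>" 50) where
  "c \<approx> d \<longleftrightarrow> c - d \<in> tensor_rels A"

lemma chain_eq_refl: "c \<approx> c"
  by (simp add: chain_eq_def tensor_rels.zero)

lemma chain_eq_trans [trans]: "c \<approx> d \<Longrightarrow> d \<approx> e \<Longrightarrow> c \<approx> e"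
  unfolding chain_eq_def by (drule (1) tensor_rels.add) simp

lemma chain_eq_add: "c \<approx> d \<Longrightarrow> c' \<approx> d' \<Longrightarrow> c + c' \<approx> d + d'"
  unfolding chain_eq_def by (drule (1) tensor_rels.add) (simp add: algebra_simps)

lemma chain_eq_scale: "c \<approx> d \<Longrightarrow> pscale s c \<approx> pscale s d"
  unfolding chain_eq_def by (drule tensor_rels_scale[of _ s]) (simp add: pscale.scale_right_diff_distrib)

lemma chain_eq_plift:
  assumes "\<And>m. m \<in> keys a \<Longrightarrow> F m \<approx> G m"
  shows "plift F a \<approx> plift G a"
proof -
  have "(\<Sum>m\<in>S. pscale (lookup a m) (F m)) \<approx> (\<Sum>m\<in>S. pscale (lookup a m) (G m))"
    if "finite S" "S \<subseteq> keys a" for S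
    using that by (induction S rule: finite_induct) (simp_all add: chain_eq_refl chain_eq_add chain_eq_scale assms)
  then show ?thesis by (simp add: plift_def)
qed

abbreviation mon :: "nat \<times> nat \<Rightarrow> 'a" where "mon m \<equiv> abs (mo (fst m) (snd m))"

lemma expand_slot:
  assumes "xs \<in> lists (carrier A)" "ys \<in> lists (carrier A)"
  shows "single (xs @ abs a # ys) 1 \<approx> plift (\<lambda>m. single (xs @ mon m # ys) 1) a"
proof -
  have lin: "single (xs @ abs (a + b) # ys) 1
      \<approx> single (xs @ abs a # ys) 1 + single (xs @ abs b # ys) 1" for a b
    using tensor_rels.additive[OF assms, of "abs a" "abs b" 1] by (simp add: chain_eq_def abs_simps algebra_simps)
  have sc: "single (xs @ abs (s *s a) # ys) 1 \<approx> pscale s (single (xs @ abs a # ys) 1)" for a s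
    using tensor_rels.scalar[OF assms, of "abs a" s 1] by (simp add: chain_eq_def abs_simps pscale_single)
  have *: "single (xs @ abs (\<Sum>m\<in>S. lookup a m *s mo (fst m) (snd m)) # ys) 1
      \<approx> (\<Sum>m\<in>S. pscale (lookup a m) (single (xs @ mon m # ys) 1))" if "finite S" for S
    using that
  proof (induction S rule: finite_induct)
    case empty
    show ?case using sc[of 0 0] by simp
  next
    case (insert m S)
    show ?case
      using chain_eq_trans[OF lin chain_eq_add[OF sc insert.IH]] insert.hyps by simp
  qed
  have "(\<Sum>m\<in>keys a. lookup a m *s mo (fst m) (snd m)) = a"
    by (simp add: mo_def pscale_single poly_mapping_sum_singles)
  then show ?thesis
    using *[OF finite_keys[of a]] by (simp add: plift_def)
qed

text \<open>The coordinates of a pure tensor with respect to the tensors of monomials.\<close>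

fun tens :: "'k qp list \<Rightarrow> ((nat \<times> nat) list \<Rightarrow>\<^sub>0 'k)" where
  "tens [] = single [] 1"
| "tens (a # as) = plift (\<lambda>m. plift (\<lambda>ms. single (m # ms) 1) (tens as)) a"

lemma lookup_plift_Cons:
  fixes t :: "(nat \<times> nat) list \<Rightarrow>\<^sub>0 'k"
  shows "lookup (plift (\<lambda>ms. single (m # ms) 1) t) l
    = (case l of [] \<Rightarrow> 0 | m' # ms \<Rightarrow> if m' = m then lookup t ms else 0)"
proof (rule linear_ext[of "(*)" "\<lambda>t. lookup (plift (\<lambda>ms. single (m # ms) 1) t) l"
      "\<lambda>t. case l of [] \<Rightarrow> 0 | m' # ms \<Rightarrow> if m' = m then lookup t ms else 0"])
  show "vector_space ((*) :: 'k \<Rightarrow> 'k \<Rightarrow> 'k)" by standard (simp_all add: algebra_simps)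
qed (auto simp: plift_add plift_scale lookup_add lookup_single when_def split: list.splits)

lemma lookup_tens_simps [simp]:
  "lookup (tens []) ms = (if ms = [] then 1 else 0)" "lookup (tens (a # as)) [] = 0"
  "lookup (tens (a # as)) (m # ms) = lookup a m * lookup (tens as) ms"
proof -
  show "lookup (tens []) ms = (if ms = [] then 1 else 0)"
    by (auto simp: lookup_single when_def)
  show "lookup (tens (a # as)) [] = 0"
    by (simp add: plift_def lookup_sum lookup_single when_def)
  have "lookup (tens (a # as)) (m # ms) = (\<Sum>m'\<in>keys a. lookup a m' * (if m = m' then lookup (tens as) ms else 0))"
    by (subst tens.simps, subst plift_def) (simp add: lookup_sum lookup_plift_Cons)
  also have "\<dots> = (\<Sum>m'\<in>keys a. if m = m' then lookup a m * lookup (tens as) ms else 0)"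
    by (intro sum.cong) auto
  finally show "lookup (tens (a # as)) (m # ms) = lookup a m * lookup (tens as) ms"
    by (simp add: in_keys_iff)
qed

declare tens.simps [simp del]

lemma lookup_tens_length: "lookup (tens as) ms \<noteq> 0 \<Longrightarrow> length ms = length as"
proof (induction as arbitrary: ms)
  case (Cons a as)
  then show ?case by (cases ms) auto
qed (simp split: if_splits)

definition E :: "((nat \<times> nat) list \<Rightarrow>\<^sub>0 'k) \<Rightarrow> ('a list \<Rightarrow>\<^sub>0 'k)" where
  "E = plift (\<lambda>ms. single (map mon ms) 1)"

definition N :: "('a list \<Rightarrow>\<^sub>0 'k) \<Rightarrow> ((nat \<times> nat) list \<Rightarrow>\<^sub>0 'k)" where
  "N = plift (\<lambda>l. tens (map rp l))"

lemma single_expand: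
  "xs \<in> lists (carrier A) \<Longrightarrow> single (xs @ map abs as) 1
    \<approx> plift (\<lambda>ms. single (xs @ map mon ms) 1) (tens as)"
proof (induction as arbitrary: xs)
  case Nil
  then show ?case by (simp add: chain_eq_refl tens.simps(1))
next
  case (Cons a as)
  have "single (xs @ map abs (a # as)) 1 \<approx> plift (\<lambda>m. single (xs @ mon m # map abs as) 1) a"
    using expand_slot[OF Cons.prems map_abs_lists, of a as] by simp
  also have "\<dots> \<approx> plift (\<lambda>m. plift (\<lambda>ms. single (xs @ mon m # map mon ms) 1) (tens as)) a"
  proof (rule chain_eq_plift)
    fix m
    have "xs @ [mon m] \<in> lists (carrier A)" using Cons.prems by auto
    from Cons.IH[OF this] show "single (xs @ mon m # map abs as) 1
        \<approx> plift (\<lambda>ms. single (xs @ mon m # map mon ms) 1) (tens as)" by simp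
  qed
  also have "\<dots> = plift (\<lambda>ms. single (xs @ map mon ms) 1) (tens (a # as))"
    by (simp add: plift_plift tens.simps(2))
  finally show ?case .
qed

text \<open>Expanding every slot in monomials only uses the relations. So a chain is known modulo
  relations from its coordinates \<open>N c\<close>, which \<open>E\<close> turns back into a
  chain.\<close>

lemma chain_eq_E_N:
  assumes "\<And>l. l \<in> keys c \<Longrightarrow> l \<in> lists (carrier A)"
  shows "c \<approx> E (N c)"
proof -
  have "c = plift (\<lambda>l. single l 1) c"
    by (simp add: plift_def pscale_single poly_mapping_sum_singles)
  also have "\<dots> \<approx> plift (\<lambda>l. E (tens (map rp l))) c"
  proof (rule chain_eq_plift)
    fix l assume "l \<in> keys c"
    then obtain as where "l = map abs as" using assms lists_carrierE by metis
    then show "single l 1 \<approx> E (tens (map rp l))"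
      using single_expand[of "[]" as] by (simp add: E_def o_def)
  qed
  also have "\<dots> = E (N c)"
    by (simp add: E_def N_def plift_plift)
  finally show ?thesis .
qed

abbreviation K :: "(nat \<times> nat) list \<Rightarrow> ('a list \<Rightarrow>\<^sub>0 'k) \<Rightarrow> 'k" where
  "K ms \<equiv> ext (\<lambda>as. lookup (tens as) ms)"

lemma K_eq: "K ms c = lookup (N c) ms"
  by (simp add: ext_eq_sum N_def plift_def lookup_sum)

lemma hchainsD: "c \<in> hchains A n \<Longrightarrow> l \<in> keys c \<Longrightarrow> l \<in> lists (carrier A) \<and> length l = Suc n"
  by (auto simp: hchains_def)

text \<open>The relations are the common kernel of the functionals \<open>K ms\<close> with \<open>ms\<close> nondegenerate.\<close>

definition nondeg :: "(nat \<times> nat) list \<Rightarrow> bool" where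
  "nondeg ms \<longleftrightarrow> (0, 0) \<notin> set (tl ms)"

lemma tensor_relsI:
  assumes c: "c \<in> hchains A n" and K: "\<And>ms. length ms = Suc n \<Longrightarrow> nondeg ms \<Longrightarrow> K ms c = 0"
  shows "c \<in> tensor_rels A"
proof -
  have "plift (\<lambda>ms. single (map mon ms) 1) (N c) \<approx> plift (\<lambda>ms. 0) (N c)"
  proof (rule chain_eq_plift)
    fix ms assume "ms \<in> keys (N c)"
    then have nz: "K ms c \<noteq> 0" by (simp add: K_eq in_keys_iff)
    have "length ms = Suc n"
    proof (rule ccontr)
      assume "length ms \<noteq> Suc n"
      then have "K ms c = ext (\<lambda>_. 0) c"
        by (intro ext_cong) (use hchainsD[OF c] lookup_tens_length in fastforce)
      with nz show False by (simp add: ext_eq_sum)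
    qed
    \<comment> \<open>A monomial tensor with nonzero coefficient must be degenerate, that is, it has
      the unit in a reduced slot and is itself a relation.\<close>
    with K nz have "(0, 0) \<in> set (tl ms)" "ms \<noteq> []" by (auto simp: nondeg_def)
    then obtain m us vs where "ms = m # us @ (0, 0) # vs"
      by (metis list.exhaust_sel split_list)
    moreover have "mon m # map mon us \<in> lists (carrier A)" "map mon vs \<in> lists (carrier A)" for m us vs
      by auto
    ultimately have "single (map mon ms) 1 \<in> tensor_rels A"
      using tensor_rels.normalized[of "mon m # map mon us" A "map mon vs" 1] by (simp add: abs_simps)
    then show "single (map mon ms) 1 \<approx> 0" by (simp add: chain_eq_def)
  qed
  then have "E (N c) \<approx> 0" by (simp add: E_def)
  moreover have "c \<approx> E (N c)"
    using hchainsD[OF c] by (intro chain_eq_E_N) blast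
  ultimately have "c \<approx> 0" by (rule chain_eq_trans[rotated])
  then show ?thesis by (simp add: chain_eq_def)
qed

lemma multi_K: "nondeg ms \<Longrightarrow> multi (\<lambda>as. lookup (tens as) ms)"
proof -
  have "lookup (tens (as @ (a + b) # bs)) ms = lookup (tens (as @ a # bs)) ms + lookup (tens (as @ b # bs)) ms \<and>
     lookup (tens (as @ (s *s a) # bs)) ms = s * lookup (tens (as @ a # bs)) ms" for as bs a b s ms
  proof (induction as arbitrary: ms)
    case Nil
    then show ?case by (cases ms) (simp_all add: lookup_add algebra_simps)
  next
    case (Cons d as)
    then show ?case by (cases ms) (simp_all add: algebra_simps)
  qed
  moreover have "lookup (tens (as @ mo 0 0 # bs)) ms = 0" if "(0, 0) \<notin> set ms" for as bs ms
    using that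
  proof (induction as arbitrary: ms)
    case Nil
    then show ?case by (cases ms) (auto simp: lookup_mo)
  next
    case (Cons d as)
    then show ?case by (cases ms) auto
  qed
  then have "lookup (tens (as @ mo 0 0 # bs)) ms = 0" if "nondeg ms" "as \<noteq> []" for as bs ms
    using that by (cases as; cases ms) (auto simp: nondeg_def)
  ultimately show ?thesis if "nondeg ms" using that by (simp add: multi_def)
qed

lemma hchains_closed:
  "0 \<in> hchains A n" "c \<in> hchains A n \<Longrightarrow> d \<in> hchains A n \<Longrightarrow> c + d \<in> hchains A n"
  "c \<in> hchains A n \<Longrightarrow> d \<in> hchains A n \<Longrightarrow> c - d \<in> hchains A n"
  "c \<in> hchains A n \<Longrightarrow> - c \<in> hchains A n" "c \<in> hchains A n \<Longrightarrow> pscale s c \<in> hchains A n"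
proof -
  show "0 \<in> hchains A n" by (simp add: hchains_def)
  show *: "c \<in> hchains A n \<Longrightarrow> d \<in> hchains A n \<Longrightarrow> c + d \<in> hchains A n" for c d
    using Poly_Mapping.keys_add[of c d] by (auto simp: hchains_def)
  show m: "c \<in> hchains A n \<Longrightarrow> - c \<in> hchains A n" for c
    by (simp add: hchains_def)
  show "c \<in> hchains A n \<Longrightarrow> d \<in> hchains A n \<Longrightarrow> c - d \<in> hchains A n"
    using *[of c "- d"] m[of d] by simp
  show "c \<in> hchains A n \<Longrightarrow> pscale s c \<in> hchains A n"
    by (auto simp: hchains_def in_keys_iff)
qed

lemma single_hchains: "length as = Suc n \<Longrightarrow> single (map abs as) s \<in> hchains A n"
  by (auto simp: hchains_def)

lemma single_hchains' [simp]:
  "single [abs a] s \<in> hchains A 0" "single [abs a, abs b] s \<in> hchains A 1"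
  "single [abs a, abs b] s \<in> hchains A (Suc 0)"
  "single [abs a, abs b, abs d] s \<in> hchains A 2"
  "single [abs a, abs b, abs d, abs e] s \<in> hchains A 3"
  using single_hchains[of "[a]" 0] single_hchains[of "[a, b]" 1] single_hchains[of "[a, b, d]" 2]
    single_hchains[of "[a, b, d, e]" 3] by simp_all

lemma plift_hchains: "c \<in> hchains A m \<Longrightarrow> (\<And>l. l \<in> lists (carrier A) \<Longrightarrow> length l = Suc m \<Longrightarrow> F l \<in> hchains A n) \<Longrightarrow> plift F c \<in> hchains A n"
proof -
  assume c: "c \<in> hchains A m" and F: "\<And>l. l \<in> lists (carrier A) \<Longrightarrow> length l = Suc m \<Longrightarrow> F l \<in> hchains A n"
  have "(\<Sum>l\<in>S. pscale (lookup c l) (F l)) \<in> hchains A n" if "finite S" "S \<subseteq> keys c" for S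
    using that by (induction S rule: finite_induct) (use F hchainsD[OF c] in \<open>simp_all add: hchains_closed\<close>)
  then show ?thesis by (simp add: plift_def)
qed

fun fun1 :: "('k qp \<Rightarrow> 'k) \<Rightarrow> 'k qp list \<Rightarrow> 'k" where
  "fun1 g [a] = g a" | "fun1 g _ = 0"

fun fun2 :: "('k qp \<Rightarrow> 'k qp \<Rightarrow> 'k) \<Rightarrow> 'k qp list \<Rightarrow> 'k" where
  "fun2 g [a, b] = g a b" | "fun2 g _ = 0"

fun fun3 :: "('k qp \<Rightarrow> 'k qp \<Rightarrow> 'k qp \<Rightarrow> 'k) \<Rightarrow> 'k qp list \<Rightarrow> 'k" where
  "fun3 g [a, b, d] = g a b d" | "fun3 g _ = 0"

lemma multi_fun1:
  assumes "\<And>a b. g (a + b) = g a + g b" "\<And>a s. g (s *s a) = s * g a"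
  shows "multi (fun1 g)"
  unfolding multi_def
proof (intro allI)
  fix as bs a b s
  show "fun1 g (as @ (a + b) # bs) = fun1 g (as @ a # bs) + fun1 g (as @ b # bs) \<and>
     fun1 g (as @ (s *s a) # bs) = s * fun1 g (as @ a # bs) \<and> (as \<noteq> [] \<longrightarrow> fun1 g (as @ mo 0 0 # bs) = 0)"
    by (cases as; cases "tl as"; cases bs) (simp_all add: assms)
qed

lemma multi_fun2:
  assumes "\<And>a b d. g (a + b) d = g a d + g b d" "\<And>a s d. g (s *s a) d = s * g a d"
    and "\<And>a b d. g d (a + b) = g d a + g d b" "\<And>a s d. g d (s *s a) = s * g d a" "\<And>a. g a (mo 0 0) = 0"
  shows "multi (fun2 g)"
  unfolding multi_def
proof (intro allI)
  fix as bs a b s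
  show "fun2 g (as @ (a + b) # bs) = fun2 g (as @ a # bs) + fun2 g (as @ b # bs) \<and>
     fun2 g (as @ (s *s a) # bs) = s * fun2 g (as @ a # bs) \<and> (as \<noteq> [] \<longrightarrow> fun2 g (as @ mo 0 0 # bs) = 0)"
    by (cases as; cases "tl as"; cases "tl (tl as)"; cases bs; cases "tl bs") (simp_all add: assms)
qed

lemma multi_fun3:
  assumes "\<And>a b d e. g (a + b) d e = g a d e + g b d e" "\<And>a s d e. g (s *s a) d e = s * g a d e"
    and "\<And>a b d e. g d (a + b) e = g d a e + g d b e" "\<And>a s d e. g d (s *s a) e = s * g d a e"
    and "\<And>a b d e. g d e (a + b) = g d e a + g d e b" "\<And>a s d e. g d e (s *s a) = s * g d e a"
    and "\<And>a d. g a (mo 0 0) d = 0" "\<And>a d. g a d (mo 0 0) = 0"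
  shows "multi (fun3 g)"
  unfolding multi_def
proof (intro allI)
  fix as bs a b s
  show "fun3 g (as @ (a + b) # bs) = fun3 g (as @ a # bs) + fun3 g (as @ b # bs) \<and>
     fun3 g (as @ (s *s a) # bs) = s * fun3 g (as @ a # bs) \<and> (as \<noteq> [] \<longrightarrow> fun3 g (as @ mo 0 0 # bs) = 0)"
    by (cases as; cases "tl as"; cases "tl (tl as)"; cases "tl (tl (tl as))"; cases bs; cases "tl bs"; cases "tl (tl bs)")
      (simp_all add: assms)
qed

end

section \<open>Twisted homology and the Connes operator\<close>

context gwa_plane
begin

abbreviation HBD :: "((word \<Rightarrow>\<^sub>0 'k) set list \<Rightarrow>\<^sub>0 'k) \<Rightarrow> ((word \<Rightarrow>\<^sub>0 'k) set list \<Rightarrow>\<^sub>0 'k)" where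
  "HBD \<equiv> hbd G \<nu>"

abbreviation CON :: "((word \<Rightarrow>\<^sub>0 'k) set list \<Rightarrow>\<^sub>0 'k) \<Rightarrow> ((word \<Rightarrow>\<^sub>0 'k) set list \<Rightarrow>\<^sub>0 'k)" where
  "CON \<equiv> lin_ext (connes_basis G \<nu>)"

lemma hbd_basis_simps [simp]:
  "hbd_basis G \<nu> [ab m, ab a] = single [ab (m \<cdot> nu a)] 1 + single [ab (a \<cdot> m)] (- 1)"
  "hbd_basis G \<nu> [ab m, ab a, ab b] = single [ab (m \<cdot> nu a), ab b] 1
     + single [ab m, ab (a \<cdot> b)] (- 1) + single [ab (b \<cdot> m), ab a] 1"
  "hbd_basis G \<nu> [ab m, ab a, ab b, ab d] = single [ab (m \<cdot> nu a), ab b, ab d] 1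
     + single [ab m, ab (a \<cdot> b), ab d] (- 1) + single [ab m, ab a, ab (b \<cdot> d)] 1
     + single [ab (d \<cdot> m), ab a, ab b] (- 1)"
  by (simp_all add: hbd_basis_def contract_def gnu_ab abs_simps numeral_eq_Suc atLeastLessThanSuc Let_def)

lemma connes_basis_simps [simp]:
  "connes_basis G \<nu> [ab a] = single [ab (mo 0 0), ab a] 1"
  "connes_basis G \<nu> [ab a, ab b] = single [ab (mo 0 0), ab a, ab (nu b)] 1
     + single [ab (mo 0 0), ab b, ab a] (- 1)"
  "connes_basis G \<nu> [ab a, ab b, ab d] = single [ab (mo 0 0), ab a, ab (nu b), ab (nu d)] 1
     + single [ab (mo 0 0), ab b, ab d, ab a] 1 + single [ab (mo 0 0), ab d, ab a, ab (nu b)] 1"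
  by (simp_all add: connes_basis_def gnu_ab abs_simps Let_def numeral_eq_Suc atLeastAtMostSuc_conv add_ac)

lemma lin_simps:
  "HBD (u + d) = HBD u + HBD d" "HBD (u - d) = HBD u - HBD d" "HBD (pscale s u) = pscale s (HBD u)" "HBD 0 = 0"
  "CON (u + d) = CON u + CON d" "CON (u - d) = CON u - CON d" "CON (pscale s u) = pscale s (CON u)" "CON 0 = 0"
  "HBD (single l s) = pscale s (hbd_basis G \<nu> l)"
  "CON (single l s) = pscale s (connes_basis G \<nu> l)"
  by (simp_all add: hbd_def lin_ext_eq_plift plift_add plift_diff plift_scale)

lemma length_conv:
  "length as = 1 \<longleftrightarrow> (\<exists>a. as = [a])" "length as = 2 \<longleftrightarrow> (\<exists>a b. as = [a, b])"
  "length as = 3 \<longleftrightarrow> (\<exists>a b d. as = [a, b, d])" "length as = 4 \<longleftrightarrow> (\<exists>a b d e. as = [a, b, d, e])"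
  by (auto simp: numeral_eq_Suc length_Suc_conv)

lemma HBD_hchains: "n \<le> 2 \<Longrightarrow> u \<in> hchains G (Suc n) \<Longrightarrow> HBD u \<in> hchains G n"
  unfolding hbd_def lin_ext_eq_plift
proof (erule plift_hchains)
  fix l assume n: "n \<le> 2" and l: "l \<in> lists (carrier G)" "length l = Suc (Suc n)"
  then obtain as where as: "l = map ab as" "length as = n + 2" by (metis lists_carrierE length_map add_2_eq_Suc')
  consider "n = 0" | "n = 1" | "n = 2" using n by linarith
  then show "hbd_basis G \<nu> l \<in> hchains G n"
  proof cases
    case 1
    then show ?thesis using as length_conv(2)[of as] by (auto intro!: hchains_closed)
  next
    case 2
    then show ?thesis using as length_conv(3)[of as] by (auto intro!: hchains_closed)
  next
    case 3
    then show ?thesis using as length_conv(4)[of as] by (auto intro!: hchains_closed)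
  qed
qed

lemma CON_hchains: "n \<le> 2 \<Longrightarrow> u \<in> hchains G n \<Longrightarrow> CON u \<in> hchains G (Suc n)"
  unfolding lin_ext_eq_plift
proof (erule plift_hchains)
  fix l assume n: "n \<le> 2" and l: "l \<in> lists (carrier G)" "length l = Suc n"
  then obtain as where as: "l = map ab as" "length as = n + 1" by (metis lists_carrierE length_map Suc_eq_plus1)
  consider "n = 0" | "n = 1" | "n = 2" using n by linarith
  then show "connes_basis G \<nu> l \<in> hchains G (Suc n)"
  proof cases
    case 1
    then show ?thesis using as length_conv(1)[of as] by (auto intro!: hchains_closed)
  next
    case 2
    then show ?thesis using as length_conv(2)[of as] by (auto intro!: hchains_closed simp: numeral_2_eq_2[symmetric])
  next
    case 3
    then show ?thesis using as length_conv(3)[of as] by (auto intro!: hchains_closed simp: numeral_3_eq_3[symmetric])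
  qed
qed

abbreviation TWB :: "nat \<Rightarrow> ((word \<Rightarrow>\<^sub>0 'k) set list \<Rightarrow>\<^sub>0 'k) set" where
  "TWB \<equiv> tw_bounds G \<nu>"

lemma TWB_scale: "b \<in> TWB n \<Longrightarrow> pscale s b \<in> TWB n"
proof -
  assume "b \<in> TWB n"
  then obtain u r where "b = HBD u + r" "u \<in> hchains G (Suc n)" "r \<in> tensor_rels G \<inter> hchains G n"
    unfolding tw_bounds_def by blast
  then have "pscale s b = HBD (pscale s u) + pscale s r" "pscale s u \<in> hchains G (Suc n)"
    "pscale s r \<in> tensor_rels G \<inter> hchains G n"
    by (simp_all add: lin_simps pscale.scale_right_distrib hchains_closed tensor_rels_scale)
  then show ?thesis unfolding tw_bounds_def by blast
qed

lemma TWB_add: "b \<in> TWB n \<Longrightarrow> b' \<in> TWB n \<Longrightarrow> b + b' \<in> TWB n"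
proof -
  assume "b \<in> TWB n" "b' \<in> TWB n"
  then obtain u r u' r' where "b = HBD u + r" "u \<in> hchains G (Suc n)" "r \<in> tensor_rels G \<inter> hchains G n"
    "b' = HBD u' + r'" "u' \<in> hchains G (Suc n)" "r' \<in> tensor_rels G \<inter> hchains G n"
    unfolding tw_bounds_def by blast
  then have "b + b' = HBD (u + u') + (r + r')" "u + u' \<in> hchains G (Suc n)"
    "r + r' \<in> tensor_rels G \<inter> hchains G n"
    by (simp_all add: lin_simps hchains_closed tensor_rels.add)
  then show ?thesis unfolding tw_bounds_def by blast
qed

lemma TWB_diff: "b \<in> TWB n \<Longrightarrow> b' \<in> TWB n \<Longrightarrow> b - b' \<in> TWB n"
  using TWB_add[of b n "pscale (-1) b'"] TWB_scale[of b' n "-1"] by simp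

lemma TWB_zero: "0 \<in> TWB n"
  unfolding tw_bounds_def using tensor_rels.zero hchains_closed(1) by (auto simp: lin_simps intro!: exI[of _ 0])

text \<open>A bounding chain is correct only up to relations, and by \<open>tensor_relsI\<close>
  these are detected by nondegenerate coordinates. So it can be verified by comparing
  coefficients.\<close>

lemma TWB_I:
  assumes n: "n \<le> 2" and u: "u \<in> hchains G n" "e \<in> hchains G (Suc n)"
    and K: "\<And>ms. length ms = Suc n \<Longrightarrow> nondeg ms \<Longrightarrow> K ms u = K ms (HBD e)"
  shows "u \<in> TWB n"
proof -
  have h: "HBD e \<in> hchains G n" by (rule HBD_hchains[OF n u(2)])
  have "u - HBD e \<in> tensor_rels G"
    by (rule tensor_relsI[of _ n]) (use u h K in \<open>simp_all add: hchains_closed\<close>)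
  moreover have "u - HBD e \<in> hchains G n" using u h by (simp add: hchains_closed)
  moreover have "u = HBD e + (u - HBD e)" by simp
  ultimately show ?thesis
    unfolding tw_bounds_def using u(2) by blast
qed

lemma TWB_I0:
  assumes "n \<le> 2" "u \<in> hchains G n" "\<And>ms. length ms = Suc n \<Longrightarrow> nondeg ms \<Longrightarrow> K ms u = 0"
  shows "u \<in> TWB n"
  by (rule TWB_I[of n u 0]) (use assms in \<open>simp_all add: hchains_closed lin_simps\<close>)

lemma tw_class_eqI: "u - d \<in> TWB n \<Longrightarrow> tw_class G \<nu> n u = tw_class G \<nu> n d"
proof -
  have *: "tw_class G \<nu> n u \<subseteq> tw_class G \<nu> n d" if "u - d \<in> TWB n" for u d
  proof
    fix x assume "x \<in> tw_class G \<nu> n u"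
    then obtain b where b: "b \<in> TWB n" "x = u + b" by (auto simp: tw_class_def)
    then have "x = d + (u - d + b)" by simp
    then show "x \<in> tw_class G \<nu> n d"
      using TWB_add[OF that b(1)] unfolding tw_class_def b(2) by (intro image_eqI[of _ _ "u - d + b"]) simp_all
  qed
  assume "u - d \<in> TWB n"
  moreover from this have "d - u \<in> TWB n" using TWB_diff[OF TWB_zero] by fastforce
  ultimately show ?thesis using * by blast
qed

lemma tw_class_self: "u \<in> tw_class G \<nu> n u"
  using TWB_zero[of n] by (auto simp: tw_class_def intro!: image_eqI[of _ _ 0])

lemma tw_class_eqD: "tw_class G \<nu> n u = tw_class G \<nu> n d \<Longrightarrow> u - d \<in> TWB n"
proof -
  assume "tw_class G \<nu> n u = tw_class G \<nu> n d"
  then have "u \<in> tw_class G \<nu> n d" using tw_class_self by blast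
  then show ?thesis by (auto simp: tw_class_def)
qed

lemma eta_chain_simps:
  "eta_chain q p 0 [ab a] = single [ab a] 1"
  "eta_chain q p 1 [ab a, ab b, ab d] = single [ab a, ab X] 1 + single [ab b, ab Y] 1
     + single [ab d, ab Z] 1"
  "eta_chain q p 2 [ab a, ab b, ab d, ab e] = single [ab a, ab Y, ab X] 1
     + single [ab (- a), ab (c *s mo 0 0), ab Z] 1
     + single [ab b, ab X, ab Y] 1 + single [ab (- b), ab (c *s mo 0 0), ab (q *s Z)] 1
     + single [ab (q *s d), ab Z, ab X] 1 + single [ab (- d), ab X, ab Z] 1
     + single [ab e, ab Z, ab Y] 1 + single [ab (- (q *s e)), ab Y, ab Z] 1"
  by (simp_all add: eta_chain_def eta_def eval_simps algebra_simps)

lemma eta_chain_hchains: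
  assumes "n \<le> 2" "length v = Frank n"
  shows "eta_chain q p n (map ab v) \<in> hchains G n"
proof -
  consider a where "n = 0" "v = [a]" | a b e where "n = 1" "v = [a, b, e]" | a b e d where "n = 2" "v = [a, b, e, d]"
    using assms by (auto simp: Frank_def le_Suc_eq numeral_2_eq_2 length_Suc_conv numeral_eq_Suc split: if_splits)
  then show ?thesis
    by cases (simp_all add: eta_chain_simps[simplified] eta_chain_simps hchains_closed)
qed

lemma nondeg_simps [simp]: "nondeg [m] = True" "nondeg [m, m1] = (m1 \<noteq> (0, 0))"
  "nondeg [m, m1, m2] = (m1 \<noteq> (0, 0) \<and> m2 \<noteq> (0, 0))"
  by (auto simp: nondeg_def)

lemma K_eta_chain_diff:
  assumes "n \<le> 2" "length v = Frank n" "length w = Frank n"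
  shows "K ms (eta_chain q p n (map ab (map2 (+) v w))) = K ms (eta_chain q p n (map ab v)) + K ms (eta_chain q p n (map ab w))"
proof -
  consider a b where "n = 0" "v = [a]" "w = [b]" | a b e a' b' e' where "n = 1" "v = [a, b, e]" "w = [a', b', e']"
    | a b e d a' b' e' d' where "n = 2" "v = [a, b, e, d]" "w = [a', b', e', d']"
    using assms by (auto simp: Frank_def le_Suc_eq numeral_2_eq_2 length_Suc_conv numeral_eq_Suc split: if_splits)
  then show ?thesis
    by cases (cases ms; simp add: eta_chain_simps[simplified] eta_chain_simps lookup_add lookup_minus algebra_simps)+
qed

lemma gen_rules: "X \<cdot> Y = (q * c) *s Z" "Y \<cdot> X = c *s Z" "X \<cdot> Z = q *s (Z \<cdot> X)" "Z \<cdot> Y = q *s (Y \<cdot> Z)"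
  "nu X = q *s X" "nu Y = inverse q *s Y" "nu (mo 0 0) = mo 0 0"
  by (simp_all add: Z_def mul_simps)

lemma eta_chain_TB:
  assumes "n \<le> 2" "b \<in> TB n"
  shows "eta_chain q p n (map ab b) \<in> TWB n"
proof -
  have len: "length b = Frank n" using vsubgroup_length[OF vsubgroup_TB] assms by blast
  note h = eta_chain_hchains[OF assms(1) len]
  consider "n = 0" | "n = 1" | "n = 2" using assms(1) by linarith
  then show ?thesis
  proof cases
    case 1
    then obtain a b' d where b: "b = T1 a b' d" using assms(2) by (auto simp: TB_def)
    show ?thesis
    proof (rule TWB_I[OF assms(1) h, of "eta_chain q p 1 [ab a, ab b', ab d]"])
      show "eta_chain q p 1 [ab a, ab b', ab d] \<in> hchains G (Suc n)"
        using eta_chain_hchains[of 1 "[a, b', d]"] 1 by (simp add: Frank_def)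
      fix ms :: "(nat \<times> nat) list" assume "length ms = Suc n"
      then obtain m where "ms = [m]" using 1 by (auto simp: length_Suc_conv)
      then show "K ms (eta_chain q p n (map ab b)) = K ms (HBD (eta_chain q p 1 [ab a, ab b', ab d]))"
        using 1 b by (simp add: eta_chain_simps[simplified] lin_simps lookup_add lookup_minus gen_rules mul_simps nu_Z algebra_simps del: qmul_mo nu_mo)
    qed
  next
    case 2
    then obtain a b' d e where b: "b = T2 a b' d e" using assms(2) by (auto simp: TB_def simp del: T2.simps)
    show ?thesis
    proof (rule TWB_I[OF assms(1) h, of "eta_chain q p 2 [ab a, ab b', ab d, ab e]"])
      show "eta_chain q p 2 [ab a, ab b', ab d, ab e] \<in> hchains G (Suc n)"
        using eta_chain_hchains[of 2 "[a, b', d, e]"] 2 by (simp add: Frank_def numeral_2_eq_2)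
      fix ms :: "(nat \<times> nat) list" assume "length ms = Suc n" "nondeg ms"
      then obtain m m' where "ms = [m, m']" "m' \<noteq> (0, 0)" using 2 by (auto simp: length_Suc_conv)
      then show "K ms (eta_chain q p n (map ab b)) = K ms (HBD (eta_chain q p 2 [ab a, ab b', ab d, ab e]))"
        using 2 b by (simp add: eta_chain_simps[simplified] eta_chain_simps lin_simps lookup_add lookup_minus gen_rules mul_simps nu_Z
            nu_linear lookup_mo algebra_simps del: qmul_mo nu_mo)
    qed
  next
    case 3
    then obtain a b' d e where b: "b = T3 a b' d e" using assms(2) by (auto simp: TB_def simp del: T3.simps)
    \<comment> \<open>The comparison map in degree 3, which \<open>eta\<close> does not provide:
      \<open>[x, y, x]\<close>, \<open>[y, x, y]\<close>, and the signed shuffles of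
      \<open>z\<close> into \<open>[y, x]\<close> and \<open>[x, y]\<close>, weighted by the powers
      of \<open>q\<close> from commuting \<open>z\<close> with the letters (times \<open>q\<close>
      for the second).\<close>
    define \<eta> where "\<eta> = single [ab a, ab X, ab Y, ab X] 1 + single [ab b', ab Y, ab X, ab Y] 1
      + single [ab d, ab Z, ab Y, ab X] 1 + single [ab d, ab Y, ab Z, ab X] (- q)
      + single [ab d, ab Y, ab X, ab Z] 1 + single [ab e, ab Z, ab X, ab Y] q
      + single [ab e, ab X, ab Z, ab Y] (- 1) + single [ab e, ab X, ab Y, ab Z] q"
    show ?thesis
    proof (rule TWB_I[OF assms(1) h, of \<eta>])
      show "\<eta> \<in> hchains G (Suc n)"
        using 3 by (simp add: \<eta>_def hchains_closed numeral_3_eq_3[symmetric])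
      fix ms :: "(nat \<times> nat) list" assume "length ms = Suc n" "nondeg ms"
      then obtain m m' m'' where "ms = [m, m', m'']" "m' \<noteq> (0, 0)" "m'' \<noteq> (0, 0)" using 3 by (auto simp: length_Suc_conv numeral_2_eq_2)
      then show "K ms (eta_chain q p n (map ab b)) = K ms (HBD \<eta>)"
        using 3 b by (simp add: \<eta>_def eta_chain_simps lin_simps lookup_add lookup_minus gen_rules mul_simps nu_Z
            nu_linear lookup_mo algebra_simps del: qmul_mo nu_mo)
    qed
  qed
qed

lemma T_to_tw_eq:
  assumes n: "n \<le> 2" and v: "length v = Frank n"
  shows "T_to_tw q p n (map ab ` vcoset v (TB n)) = tw_class G \<nu> n (eta_chain q p n (map ab v))"
proof -
  have "tw_class G \<nu> n (eta_chain q p n (map ab u)) = tw_class G \<nu> n (eta_chain q p n (map ab v))"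
    if u: "u \<in> vcoset v (TB n)" for u
  proof (rule tw_class_eqI)
    obtain b where b: "b \<in> TB n" "u = map2 (+) v b" using u by (auto simp: vcoset_def)
    have lb: "length b = Frank n" using vsubgroup_length[OF vsubgroup_TB[OF n] b(1)] .
    let ?d = "eta_chain q p n (map ab u) - eta_chain q p n (map ab v)"
    have "?d - eta_chain q p n (map ab b) \<in> TWB n"
      by (rule TWB_I0[OF n]) (use n v lb b(2) in \<open>simp_all add: hchains_closed eta_chain_hchains K_eta_chain_diff del: map_map\<close>)
    from TWB_add[OF this eta_chain_TB[OF n b(1)]] show "?d \<in> TWB n" by simp
  qed
  moreover have "vcoset v (TB n) \<noteq> {}" using vcoset_self[OF vsubgroup_TB[OF n] v] by blast
  ultimately show ?thesis by (auto simp: T_to_tw_def)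
qed

abbreviation TWC where "TWC \<equiv> tw_class G \<nu>"

text \<open>
  On chains of total degree \<open>0\<close> the operator anticommutes with the differential, because \<open>\<nu>\<close> acts
  by a scalar on each degree and the scalars multiply to \<open>1\<close>. A boundary of total degree \<open>0\<close> bounds a
  chain of total degree \<open>0\<close>, as is seen by expanding chains in monomials.
\<close>

abbreviation sdeg :: "(nat \<times> nat) list \<Rightarrow> int" where "sdeg ms \<equiv> sum_list (map qdeg ms)"

lemma deg0_K:
  assumes u: "u \<in> deg0_chains G (gwa_deg q p) n" and ms: "sdeg ms \<noteq> 0"
  shows "K ms u = 0"
proof -
  have *: "lookup (tens (map rp l)) ms \<noteq> 0 \<Longrightarrow> list_all2 (\<lambda>a d. a \<in> gwa_deg q p d) l ds \<Longrightarrow> sdeg ms = sum_list ds" for l ds ms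
  proof (induction l arbitrary: ds ms)
    case Nil
    then show ?case by (auto split: if_splits)
  next
    case (Cons x l)
    from Cons.prems obtain m ms' d ds' where e: "ms = m # ms'" "ds = d # ds'" "x \<in> gwa_deg q p d"
        "list_all2 (\<lambda>a d. a \<in> gwa_deg q p d) l ds'" "lookup (rp x) m \<noteq> 0" "lookup (tens (map rp l)) ms' \<noteq> 0"
      by (cases ms; cases ds) auto
    then have "qdeg m = d" by (cases m) (auto simp: gwa_deg_eq homogeneous_def)
    then show ?case using Cons.IH[OF e(6,4)] e by simp
  qed
  have "lookup (tens (map rp l)) ms = 0" if "l \<in> keys u" for l
  proof -
    obtain ds where "list_all2 (\<lambda>a d. a \<in> gwa_deg q p d) l ds" "sum_list ds = 0"
      using u \<open>l \<in> keys u\<close> unfolding deg0_chains_def by blast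
    with *[of l ms ds] ms show ?thesis by auto
  qed
  then have "K ms u = ext (\<lambda>_. 0) u" by (intro ext_cong) simp
  then show ?thesis by (simp add: ext_eq_sum)
qed

lemma ext_plift_eq:
  assumes "u \<in> hchains G n" "\<And>as. length as = Suc n \<Longrightarrow> ext \<phi> (F (map ab as)) = \<psi> as"
  shows "ext \<phi> (plift F u) = ext \<psi> u"
  unfolding ext_plift ext_eq_sum[of \<psi>]
proof (rule sum.cong)
  fix l assume "l \<in> keys u"
  then have "l \<in> lists (carrier G)" "length l = Suc n" using hchainsD[OF assms(1)] by blast+
  then obtain as where "l = map ab as" "length as = Suc n" by (metis lists_carrierE length_map)
  then show "lookup u l * ext \<phi> (F l) = lookup u l * \<psi> (map rp l)"
    using assms(2)[of as] by (simp del: map_map)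
qed simp

text \<open>A coordinate of the boundary is again a normalized multilinear functional of the chain,
  so it kills the relations. In other words, the boundary descends to normalized chains;
  \<open>CON_functional\<close> does the same for the Connes operator.\<close>

lemma HBD_functional:
  assumes n: "n \<le> 1" and ms: "length ms = Suc n" "nondeg ms"
  obtains \<psi> where "multi \<psi>" "\<And>as. length as = Suc (Suc n) \<Longrightarrow> K ms (hbd_basis G \<nu> (map ab as)) = \<psi> as"
proof -
  consider "n = 0" | "n = 1" using n by linarith
  then show ?thesis
  proof cases
    case 1
    then obtain m where m: "ms = [m]" using ms by (auto simp: length_Suc_conv)
    let ?\<psi> = "fun2 (\<lambda>a b. lookup (a \<cdot> nu b - b \<cdot> a) m)"
    have "multi ?\<psi>"
      by (rule multi_fun2) (simp_all add: mul_simps nu_linear lookup_add lookup_minus algebra_simps)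
    moreover have "K ms (hbd_basis G \<nu> (map ab as)) = ?\<psi> as" if "length as = Suc (Suc n)" for as
      using that 1 length_conv(2)[of as] by (auto simp: m lookup_minus)
    ultimately show ?thesis by (rule that)
  next
    case 2
    then obtain m m' where m: "ms = [m, m']" "m' \<noteq> (0, 0)" using ms by (auto simp: length_Suc_conv)
    let ?\<psi> = "fun3 (\<lambda>a b d. lookup (a \<cdot> nu b) m * lookup d m' - lookup a m * lookup (b \<cdot> d) m' + lookup (d \<cdot> a) m * lookup b m')"
    have "multi ?\<psi>"
      by (rule multi_fun3) (use m(2) in \<open>simp_all add: mul_simps nu_linear lookup_add lookup_mo algebra_simps\<close>)
    moreover have "K ms (hbd_basis G \<nu> (map ab as)) = ?\<psi> as" if "length as = Suc (Suc n)" for as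
      using that 2 length_conv(3)[of as] by (auto simp: m)
    ultimately show ?thesis by (rule that)
  qed
qed

lemma CON_functional:
  assumes n: "n \<le> 1" and ms: "length ms = Suc (Suc n)" "nondeg ms"
  obtains \<psi> where "multi \<psi>" "\<And>as. length as = Suc n \<Longrightarrow> K ms (connes_basis G \<nu> (map ab as)) = \<psi> as"
proof -
  consider "n = 0" | "n = 1" using n by linarith
  then show ?thesis
  proof cases
    case 1
    then obtain m m' where m: "ms = [m, m']" "m' \<noteq> (0, 0)" using ms by (auto simp: length_Suc_conv)
    let ?\<psi> = "fun1 (\<lambda>a. lookup (mo 0 0) m * lookup a m')"
    have "multi ?\<psi>"
      by (rule multi_fun1) (simp_all add: lookup_add algebra_simps)
    moreover have "K ms (connes_basis G \<nu> (map ab as)) = ?\<psi> as" if "length as = Suc n" for as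
      using that 1 length_conv(1)[of as] by (auto simp: m)
    ultimately show ?thesis by (rule that)
  next
    case 2
    then obtain m m' m'' where m: "ms = [m, m', m'']" "m' \<noteq> (0, 0)" "m'' \<noteq> (0, 0)" using ms by (auto simp: length_Suc_conv)
    let ?\<psi> = "fun2 (\<lambda>a b. lookup (mo 0 0) m * (lookup a m' * lookup (nu b) m'' - lookup b m' * lookup a m''))"
    have "multi ?\<psi>"
      by (rule multi_fun2) (use m(2,3) in \<open>simp_all add: nu_linear lookup_add lookup_mo algebra_simps\<close>)
    moreover have "K ms (connes_basis G \<nu> (map ab as)) = ?\<psi> as" if "length as = Suc n" for as
      using that 2 length_conv(2)[of as] by (auto simp: m algebra_simps)
    ultimately show ?thesis by (rule that)
  qed
qed

text \<open>Every face of a monomial tensor has the same total degree. This allows a bounding chain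
  to be cut down to its part of total degree 0.\<close>

lemma K_hbd_basis_mon:
  assumes n: "n \<le> 1" and ms: "length ms' = Suc n" "length ms = Suc (Suc n)" "sdeg ms \<noteq> sdeg ms'"
  shows "K ms' (hbd_basis G \<nu> (map mon ms)) = 0"
proof -
  consider "n = 0" | "n = 1" using n by linarith
  then show ?thesis
  proof cases
    case 1
    then obtain m a b where "ms' = [m]" "ms = [a, b]" using ms by (auto simp: length_Suc_conv)
    moreover from this have "m \<noteq> (fst a + fst b, snd a + snd b)" "m \<noteq> (fst b + fst a, snd b + snd a)"
      using ms(3) by (auto simp: qdeg_def)
    ultimately show ?thesis by (simp add: lookup_mo qmul_scale_right)
  next
    case 2
    then obtain m m' a b d where e: "ms' = [m, m']" "ms = [a, b, d]" using ms by (auto simp: length_Suc_conv)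
    have pair: "lookup (mo i j) m * lookup (mo k l) m' = (0::'k)" if "qdeg (i, j) + qdeg (k, l) \<noteq> qdeg m + qdeg m'" for i j k l
      using that by (auto simp: lookup_mo)
    have pairs: "lookup (mo (fst a + fst b) (snd a + snd b)) m * lookup (mo (fst d) (snd d)) m' = (0::'k)"
      "lookup (mo (fst a) (snd a)) m * lookup (mo (fst b + fst d) (snd b + snd d)) m' = (0::'k)"
      "lookup (mo (fst d + fst a) (snd d + snd a)) m * lookup (mo (fst b) (snd b)) m' = (0::'k)"
      using ms(3) by (intro pair; simp add: e qdeg_def)+
    have "K ms' (hbd_basis G \<nu> (map mon ms)) =
      q ^ snd b * inverse q ^ fst b * q ^ (snd a * fst b) *
        (lookup (mo (fst a + fst b) (snd a + snd b)) m * lookup (mo (fst d) (snd d)) m')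
      - q ^ (snd b * fst d) * (lookup (mo (fst a) (snd a)) m * lookup (mo (fst b + fst d) (snd b + snd d)) m')
      + q ^ (snd d * fst a) * (lookup (mo (fst d + fst a) (snd d + snd a)) m * lookup (mo (fst b) (snd b)) m')"
      by (simp add: e mul_simps ac_simps)
    then show ?thesis by (simp only: pairs) simp
  qed
qed

lemma CON_HBD_basis:
  assumes nu: "nu a = r *s a" "nu b = s *s b" "r * s = 1" and ms: "length ms = 2" "nondeg ms"
  shows "K ms (CON (hbd_basis G \<nu> [ab a, ab b])) + K ms (HBD (connes_basis G \<nu> [ab a, ab b])) = 0"
proof -
  obtain m m' where m: "ms = [m, m']" "m' \<noteq> (0, 0)" using ms by (auto simp: numeral_2_eq_2 length_Suc_conv)
  have "r * (s * z) = z" for z using nu(3) by (simp flip: mult.assoc)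
  then show ?thesis
    by (simp add: m nu lin_simps nu_mul gen_rules mul_simps algebra_simps)
qed

lemma CON_HBD_basis3:
  assumes nu: "nu a = r *s a" "nu b = s *s b" "nu d = t *s d" "r * (s * t) = 1" and ms: "length ms = 3" "nondeg ms"
  shows "K ms (CON (hbd_basis G \<nu> [ab a, ab b, ab d])) + K ms (HBD (connes_basis G \<nu> [ab a, ab b, ab d])) = 0"
proof -
  obtain m m' m'' where m: "ms = [m, m', m'']" "m' \<noteq> (0, 0)" "m'' \<noteq> (0, 0)" using ms by (auto simp: numeral_3_eq_3 length_Suc_conv)
  have "r * (s * (t * z)) = z" for z using nu(4) by (simp flip: mult.assoc)
  then show ?thesis
    by (simp add: m nu lin_simps nu_mul gen_rules mul_simps algebra_simps)
qed

lemma CON_HBD_mon: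
  assumes n: "n \<le> 1" and ms: "length ms = Suc (Suc n)" "sdeg ms = 0" and ms': "length ms' = Suc (Suc n)" "nondeg ms'"
  shows "K ms' (CON (hbd_basis G \<nu> (map mon ms))) + K ms' (HBD (connes_basis G \<nu> (map mon ms))) = 0"
proof -
  have inv: "q ^ i * inverse q ^ j = 1" if "i = j" for i j
    using that by (simp flip: power_mult_distrib)
  consider "n = 0" | "n = 1" using n by linarith
  then show ?thesis
  proof cases
    case 1
    then obtain a b where e: "ms = [a, b]" using ms by (auto simp: length_Suc_conv)
    then have "snd a + snd b = fst a + fst b" using ms(2) by (simp add: qdeg_def)
    from inv[OF this] have "q ^ snd a * inverse q ^ fst a * (q ^ snd b * inverse q ^ fst b) = 1"
      by (simp add: power_add ac_simps)
    from CON_HBD_basis[OF nu_mo nu_mo this] show ?thesis using e 1 ms' by simp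
  next
    case 2
    then obtain a b d where e: "ms = [a, b, d]" using ms by (auto simp: length_Suc_conv)
    then have "snd a + (snd b + snd d) = fst a + (fst b + fst d)" using ms(2) by (simp add: qdeg_def)
    from inv[OF this] have "q ^ snd a * inverse q ^ fst a * (q ^ snd b * inverse q ^ fst b * (q ^ snd d * inverse q ^ fst d)) = 1"
      by (simp add: power_add ac_simps)
    from CON_HBD_basis3[OF nu_mo nu_mo nu_mo this] show ?thesis using e 2 ms' by simp
  qed
qed

lemma CON_TWB:
  assumes n: "n \<le> 1" and b: "b \<in> TWB n" "\<And>ms. sdeg ms \<noteq> 0 \<Longrightarrow> K ms b = 0"
  shows "CON b \<in> TWB (Suc n)"
proof -
  let ?A = "gwa q p"
  obtain e r where er: "b = HBD e + r" "e \<in> hchains ?A (Suc n)" "r \<in> tensor_rels ?A" "r \<in> hchains ?A n"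
    using b(1) unfolding tw_bounds_def by blast
  define t where "t = N e"
  have keys_t: "length ms = Suc (Suc n)" if "ms \<in> keys t" for ms
  proof (rule ccontr)
    assume l: "length ms \<noteq> Suc (Suc n)"
    have "K ms e = ext (\<lambda>_. 0) e"
      by (intro ext_cong) (use hchainsD[OF er(2)] lookup_tens_length l in fastforce)
    with that show False by (simp add: t_def in_keys_iff ext_eq_sum flip: K_eq)
  qed
  \<comment> \<open>\<open>e0\<close> is the part of total degree 0 of the bounding chain
    \<open>e\<close>, taken in monomial coordinates.\<close>
  define F where "F = (\<lambda>ms. if sdeg ms = 0 then single (map mon ms) 1 else (0 :: (word \<Rightarrow>\<^sub>0 'k) set list \<Rightarrow>\<^sub>0 'k))"
  define e0 where "e0 = plift F t"
  have hc: "(\<Sum>ms\<in>S. pscale (lookup t ms) (G ms)) \<in> hchains ?A m"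
    if "finite S" "\<And>ms. ms \<in> S \<Longrightarrow> G ms \<in> hchains ?A m" for S G m
    using that by (induction S rule: finite_induct) (simp_all add: hchains_closed)
  have mon_hc: "single (map mon ms) 1 \<in> hchains ?A (Suc n)" if "ms \<in> keys t" for ms
    using keys_t[OF that] by (auto simp: hchains_def)
  have e0: "e0 \<in> hchains ?A (Suc n)"
    unfolding e0_def plift_def by (rule hc) (auto simp: F_def mon_hc hchains_closed)
  have Et: "E t \<in> hchains ?A (Suc n)"
    unfolding E_def plift_def by (rule hc) (auto simp: mon_hc)
  have eEt: "e - E t \<in> tensor_rels ?A"
    using chain_eq_E_N[of e] hchainsD[OF er(2)] by (auto simp: chain_eq_def t_def)
  have bh: "b \<in> hchains ?A n" "HBD e0 \<in> hchains ?A n"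
    using HBD_hchains[of n] n er e0 by (simp_all add: hchains_closed)
  \<comment> \<open>In total degree 0 the discarded monomials do not contribute to the boundary. In
    other degrees the left side is 0 by assumption and the right side because only monomials of
    degree 0 were kept.\<close>
  have "K ms b = K ms (HBD e0)" if ms: "length ms = Suc n" "nondeg ms" for ms
  proof -
    obtain \<psi> where \<psi>: "multi \<psi>" "\<And>as. length as = Suc (Suc n) \<Longrightarrow> K ms (hbd_basis ?A \<nu> (map ab as)) = \<psi> as"
      using HBD_functional[OF n ms] by blast
    have H: "K ms (HBD u) = ext \<psi> u" if "u \<in> hchains ?A (Suc n)" for u
      unfolding hbd_def lin_ext_eq_plift by (rule ext_plift_eq[OF that]) (rule \<psi>(2))
    have "K ms b = ext \<psi> e"
      using ext_tensor_rels[OF multi_K[OF ms(2)] er(3)] H[OF er(2)] by (simp add: er(1))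
    also have "\<dots> = ext \<psi> (E t)"
      using ext_tensor_rels[OF \<psi>(1) eEt] by simp
    finally have Kb: "K ms b = ext \<psi> (E t)" .
    have \<psi>0: "ext \<psi> (single (map mon l) 1) = 0" if "l \<in> keys t" "sdeg l \<noteq> sdeg ms" for l
      using K_hbd_basis_mon[OF n ms(1) keys_t[OF that(1)] that(2)] \<psi>(2)[of "map (\<lambda>m. mo (fst m) (snd m)) l"] keys_t[OF that(1)]
      by (simp add: o_def)
    show ?thesis
    proof (cases "sdeg ms = 0")
      case True
      have "ext \<psi> (E t) = ext \<psi> e0"
        unfolding E_def e0_def ext_plift using \<psi>0 True by (intro sum.cong refl) (auto simp: F_def)
      then show ?thesis using Kb H[OF e0] by simp
    next
      case False
      have "ext \<psi> e0 = 0"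
        unfolding e0_def ext_plift using \<psi>0 False by (intro sum.neutral) (auto simp: F_def)
      then show ?thesis using b(2)[OF False] H[OF e0] by simp
    qed
  qed
  then have rel: "b - HBD e0 \<in> tensor_rels ?A"
    using bh by (intro tensor_relsI[of _ n]) (simp_all add: hchains_closed)
  show ?thesis
  proof (rule TWB_I)
    show "CON b \<in> hchains ?A (Suc n)" using CON_hchains[of n b] n bh(1) by simp
    have "CON e0 \<in> hchains ?A (Suc (Suc n))" using CON_hchains[of "Suc n" e0] n e0 by simp
    \<comment> \<open>By anticommutation, the Connes operator applied to the boundary of
      \<open>e0\<close> gives the boundary of \<open>- CON e0\<close>.\<close>
    then show "- CON e0 \<in> hchains ?A (Suc (Suc n))" by (rule hchains_closed)
    fix ms assume ms: "length ms = Suc (Suc n)" "nondeg ms"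
    obtain \<psi> where \<psi>: "multi \<psi>" "\<And>as. length as = Suc n \<Longrightarrow> K ms (connes_basis ?A \<nu> (map ab as)) = \<psi> as"
      using CON_functional[OF n ms] by blast
    have "K ms (CON (b - HBD e0)) = ext \<psi> (b - HBD e0)"
      unfolding lin_ext_eq_plift by (rule ext_plift_eq[of _ n]) (use bh \<psi>(2) in \<open>simp_all add: hchains_closed\<close>)
    also have "\<dots> = 0" by (rule ext_tensor_rels[OF \<psi>(1) rel])
    finally have 1: "K ms (CON b) = K ms (CON (HBD e0))" by (simp add: lin_simps)
    have "K ms (CON (HBD e0)) + K ms (HBD (CON e0)) =
        (\<Sum>l\<in>keys t. lookup t l * (K ms (CON (HBD (F l))) + K ms (HBD (CON (F l)))))"
      unfolding e0_def hbd_def lin_ext_eq_plift plift_plift ext_plift by (simp add: sum.distrib algebra_simps)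
    also have "\<dots> = 0"
    proof (rule sum.neutral, rule ballI)
      fix l assume l: "l \<in> keys t"
      have "K ms (CON (HBD (F l))) + K ms (HBD (CON (F l))) = 0"
        using CON_HBD_mon[OF n keys_t[OF l] _ ms] by (simp add: F_def lin_simps)
      then show "lookup t l * (K ms (CON (HBD (F l))) + K ms (HBD (CON (F l)))) = 0" by simp
    qed
    finally show "K ms (CON b) = K ms (HBD (- CON e0))"
      unfolding 1 by (simp add: hbd_def lin_ext_eq_plift plift_uminus eq_neg_iff_add_eq_0)
  qed (use n in simp)
qed

lemma connes_eq:
  assumes n: "n \<le> 1" and u0: "u0 \<in> deg0_chains G (gwa_deg q p) n"
  shows "connes G \<nu> (gwa_deg q p) n (TWC n u0) = TWC (Suc n) (CON u0)"
proof -
  have "TWC (Suc n) (CON u) = TWC (Suc n) (CON u0)"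
    if u: "u \<in> TWC n u0 \<inter> deg0_chains G (gwa_deg q p) n" for u
  proof (rule tw_class_eqI)
    obtain b where b: "b \<in> TWB n" "u = u0 + b" using u by (auto simp: tw_class_def)
    then have "b = u - u0" by simp
    then have "CON b \<in> TWB (Suc n)"
      using u u0 deg0_K by (intro CON_TWB[OF n b(1)]) auto
    then show "CON u - CON u0 \<in> TWB (Suc n)" by (simp add: b(2) lin_simps)
  qed
  then show ?thesis
    unfolding connes_def using tw_class_self[of u0 n] u0 by blast
qed

text \<open>
  The coefficient of \<open>y x\<close> is a trace twisted by \<open>\<nu>\<close>; composing it with derivations gives functionals
  on chains that vanish on boundaries.
\<close>

lemma twisted_trace: "lookup (a \<cdot> b) (Suc 0, Suc 0) = lookup (b \<cdot> nu a) (Suc 0, Suc 0)"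
  by (simp add: lookup_mul_1 lookup_nu algebra_simps)

lemma ext_TWB:
  assumes "multi \<phi>" "b \<in> TWB n"
    and "\<And>as. length as = Suc (Suc n) \<Longrightarrow> ext \<phi> (hbd_basis G \<nu> (map ab as)) = 0"
  shows "ext \<phi> b = 0"
proof -
  obtain e r where er: "b = HBD e + r" "e \<in> hchains G (Suc n)" "r \<in> tensor_rels G"
    using assms(2) unfolding tw_bounds_def by blast
  have "ext \<phi> (HBD e) = ext (\<lambda>_. 0) e"
    unfolding hbd_def lin_ext_eq_plift by (rule ext_plift_eq[OF er(2)]) (rule assms(3))
  then show ?thesis
    using er(1) ext_tensor_rels[OF assms(1) er(3)] by (simp add: ext_eq_sum[of "\<lambda>_. 0"])
qed

definition tr1 :: "('k qp \<Rightarrow> 'k qp) \<Rightarrow> 'k qp list \<Rightarrow> 'k" where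
  "tr1 d = fun2 (\<lambda>a b. lookup (a \<cdot> nu (d b)) (Suc 0, Suc 0))"

definition tr2 :: "'k qp list \<Rightarrow> 'k" where
  "tr2 = fun3 (\<lambda>a b d. lookup (a \<cdot> nu (dy b \<cdot> dx d)) (Suc 0, Suc 0))"

text \<open>Moves the factor that the last face puts in front of the coefficient to the right end,
  where it cancels against a term of the Leibniz rule.\<close>

lemma trace_rotate: "lookup (b \<cdot> (a \<cdot> d)) (Suc 0, Suc 0) = lookup (a \<cdot> (d \<cdot> nu b)) (Suc 0, Suc 0)"
  using twisted_trace[of b "a \<cdot> d"] by (simp add: mul_assoc)

lemma tr1_TWB:
  assumes d: "d = dx \<or> d = dy" and b: "b \<in> TWB 1"
  shows "ext (tr1 d) b = 0"
proof (rule ext_TWB[OF _ b])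
  show "multi (tr1 d)"
    unfolding tr1_def by (rule multi_fun2) (use d in \<open>auto simp: mul_simps d_linear nu_linear lookup_add\<close>)
  have der: "d (a \<cdot> b) = d a \<cdot> b + a \<cdot> d b" for a b
    using d dx_mul dy_mul by auto
  show "ext (tr1 d) (hbd_basis G \<nu> (map ab as)) = 0" if l: "length as = Suc (Suc 1)" for as
  proof -
    obtain x y z where "as = [x, y, z]" using l length_conv(3)[of as] by auto
    then show ?thesis
      by (simp add: tr1_def der nu_mul nu_linear mul_simps mul_assoc lookup_add trace_rotate[of z x])
  qed
qed

lemma tr2_TWB:
  assumes b: "b \<in> TWB 2"
  shows "ext tr2 b = 0"
proof (rule ext_TWB[OF _ b])
  show "multi tr2"
    unfolding tr2_def by (rule multi_fun3) (simp_all add: mul_simps d_linear nu_linear lookup_add)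
  show "ext tr2 (hbd_basis G \<nu> (map ab as)) = 0" if l: "length as = Suc (Suc 2)" for as
  proof -
    obtain x y z w where "as = [x, y, z, w]" using l length_conv(4)[of as] by auto
    then show ?thesis
      by (simp add: tr2_def dx_mul dy_mul nu_mul nu_linear mul_simps mul_assoc lookup_add trace_rotate[of w x])
  qed
qed

end

context gwa_duality
begin

section \<open>The duality in coordinates and the values of the operator\<close>

abbreviation VDB where "VDB \<equiv> vdb q p \<alpha> \<beta>"

lemma length_dual: "n \<le> 2 \<Longrightarrow> length (dual n w) = Frank (2 - n)"
  by (cases w) (auto simp: Frank_def)

lemma vdb_Theta:
  assumes "n \<le> 2" "w \<in> h5_deg n"
  shows "VDB n (Theta w) = TWC (2 - n) (eta_chain q p (2 - n) (map ab (dual n w)))"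
  unfolding vdb_def S_to_T_Theta[OF assms] using assms by (intro T_to_tw_eq) (simp_all add: length_dual)

lemma eta_dual:
  "eta_chain q p 0 (map ab (dual 2 (0, 0, 0, s, t))) = single [ab (((1 - q) * s / (q * c)) *s mo 0 0 + t *s Z)] 1"
  "eta_chain q p 1 (map ab (dual 1 (0, s, t, 0, 0))) = single [ab ((- t / (q * c)) *s Y), ab X] 1
     + single [ab ((s / c) *s X), ab Y] 1 + single [ab 0, ab Z] 1"
  by (simp_all add: eta_chain_simps eta_chain_simps[simplified])

lemma lookup_Z: "lookup Z (Suc 0, Suc 0) = inverse c"
  by (simp add: Z_def lookup_mo)

lemma inj_vdb_1: "inj_on (VDB 1) (HH_deg G 1)"
proof (rule inj_onI)
  fix x y assume "x \<in> HH_deg G 1" "y \<in> HH_deg G 1" and e: "VDB 1 x = VDB 1 y"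
  then obtain v w where v: "x = Theta v" "v \<in> h5_deg 1" and w: "y = Theta w" "w \<in> h5_deg 1"
    by (auto simp: HH_deg_eq)
  obtain s t s' t' where st: "v = (0, s, t, 0, 0)" "w = (0, s', t', 0, 0)"
    using v(2) w(2) by (auto simp: h5_deg_def)
  let ?C = "\<lambda>u. eta_chain q p 1 (map ab (dual 1 u))"
  have "TWC 1 (?C v) = TWC 1 (?C w)"
    using e v w vdb_Theta[of 1] by simp
  then have b: "?C v - ?C w \<in> TWB 1" by (rule tw_class_eqD)
  \<comment> \<open>\<open>dx\<close> kills \<open>y\<close> and \<open>dy\<close> kills
    \<open>x\<close>, so each of the two traces isolates one coordinate.\<close>
  have val: "ext (tr1 dx) (?C (0, s, t, 0, 0)) = - t / c" "ext (tr1 dy) (?C (0, s, t, 0, 0)) = s / c" for s t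
    unfolding eta_dual by (simp_all add: tr1_def gen_rules nu_linear mul_simps lookup_Z lookup_mo field_simps)
  have "t = t'" "s = s'"
    using tr1_TWB[OF _ b, of dx] tr1_TWB[OF _ b, of dy] unfolding st ext_simps val by simp_all
  then show "x = y" by (simp add: v w st)
qed

lemma inj_vdb_0: "inj_on (VDB 0) (HH_deg G 0)"
proof (rule inj_onI)
  fix x y assume "x \<in> HH_deg G 0" "y \<in> HH_deg G 0" and e: "VDB 0 x = VDB 0 y"
  then obtain v w where v: "x = Theta v" "v \<in> h5_deg 0" and w: "y = Theta w" "w \<in> h5_deg 0"
    by (auto simp: HH_deg_eq)
  obtain s s' where st: "v = (s, 0, 0, 0, 0)" "w = (s', 0, 0, 0, 0)"
    using v(2) w(2) by (auto simp: h5_deg_def)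
  let ?C = "\<lambda>u. eta_chain q p 2 (map ab (dual 0 u))"
  have "TWC 2 (?C v) = TWC 2 (?C w)"
    using e v w vdb_Theta[of 0] by simp
  then have b: "?C v - ?C w \<in> TWB 2" by (rule tw_class_eqD)
  \<comment> \<open>Among the terms of the dual chain only \<open>[y, x]\<close> contributes:
    \<open>dy\<close> kills both \<open>x\<close> and the scalars.\<close>
  have val: "ext tr2 (?C (s, 0, 0, 0, 0)) = s / c" for s
    by (simp add: eta_chain_simps tr2_def gen_rules nu_linear nu_mul mul_simps d_linear lookup_mo)
  have "s = s'"
    using tr2_TWB[OF b] unfolding st ext_simps val by simp
  then show "x = y" by (simp add: v w st)
qed

lemma deg0_single:
  assumes "list_all2 (\<lambda>a d. a \<in> homogeneous d) as ds" "sum_list ds = 0" "length as = Suc n"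
  shows "single (map ab as) s \<in> deg0_chains G (gwa_deg q p) n"
proof -
  have "list_all2 (\<lambda>a d. a \<in> gwa_deg q p d) (map ab as) ds"
    using assms(1) by (auto simp: list_all2_conv_all_nth gwa_deg_eq)
  then show ?thesis
    using assms single_hchains[OF assms(3), of s] unfolding deg0_chains_def by auto
qed

lemma deg0_add: "u \<in> deg0_chains G (gwa_deg q p) n \<Longrightarrow> v \<in> deg0_chains G (gwa_deg q p) n
    \<Longrightarrow> u + v \<in> deg0_chains G (gwa_deg q p) n"
  using Poly_Mapping.keys_add[of u v] unfolding deg0_chains_def by (auto simp: hchains_closed)

lemma homogeneous_minus: "a \<in> homogeneous d \<Longrightarrow> - a \<in> homogeneous d"
  using homogeneous_closed(3)[of a d "-1"] by simp

lemma homogeneous_gens: "X \<in> homogeneous 1" "Y \<in> homogeneous (- 1)" "Z \<in> homogeneous 0" "mo 0 0 \<in> homogeneous 0"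
  using homogeneous_mo[of 0 1] homogeneous_mo[of 1 0] homogeneous_mo[of 0 0] homogeneous_closed(3)[OF homogeneous_mo[of 1 1]]
  by (simp_all add: Z_def)

lemma BV_Delta_2: "BV_Delta_deg q p \<alpha> \<beta> 2 (Theta (0, 0, 0, s, t)) = Theta (0, t, - t, 0, 0)"
proof -
  let ?m = "((1 - q) * s / (q * c)) *s mo 0 0 + t *s Z"
  have "VDB 2 (Theta (0, 0, 0, s, t)) = TWC 0 (single [ab ?m] 1)"
    using vdb_Theta[of 2 "(0, 0, 0, s, t)"] by (simp add: h5_deg_def eta_dual del: dual.simps)
  moreover have "single [ab ?m] 1 \<in> deg0_chains G (gwa_deg q p) 0"
    using deg0_single[of "[?m]" "[0]" 0 1] homogeneous_gens by (simp add: homogeneous_closed)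
  ultimately have "connes G \<nu> (gwa_deg q p) 0 (VDB 2 (Theta (0, 0, 0, s, t)))
      = TWC 1 (single [ab (mo 0 0), ab ?m] 1)"
    using connes_eq[of 0 "single [ab ?m] 1"] by (simp add: lin_simps)
  also have "\<dots> = TWC 1 (eta_chain q p 1 (map ab (dual 1 (0, t, - t, 0, 0))))"
    unfolding eta_dual
  proof (rule tw_class_eqI, rule TWB_I)
    \<comment> \<open>The boundary of \<open>1[y, x]\<close> is
      \<open>q^-1 y[x] - c 1[z] + x[y]\<close>, because \<open>y x = c z\<close>; the factor
      \<open>- t / c\<close> makes the middle term \<open>t 1[z]\<close>. The part of
      \<open>?m\<close> coming from \<open>u\<close> is a scalar and vanishes in a reduced
      slot.\<close>
    show "single [ab ((- t / c) *s mo 0 0), ab Y, ab X] 1 \<in> hchains G (Suc 1)"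
      by (simp flip: numeral_2_eq_2)
    fix ms assume "length ms = Suc 1" "nondeg ms"
    then obtain m m' where ms: "ms = [m, m']" "m' \<noteq> (0, 0)" by (auto simp: length_Suc_conv)
    then show "K ms (single [ab (mo 0 0), ab ?m] 1 - (single [ab ((- (- t) / (q * c)) *s Y), ab X] 1
       + single [ab ((t / c) *s X), ab Y] 1 + single [ab 0, ab Z] 1))
       = K ms (HBD (single [ab ((- t / c) *s mo 0 0), ab Y, ab X] 1))"
      by (simp add: lin_simps gen_rules mul_simps lookup_add lookup_mo[of 0 0 m'] field_simps del: qmul_mo nu_mo)
  qed (simp_all add: hchains_closed)
  also have "\<dots> = VDB 1 (Theta (0, t, - t, 0, 0))"
    using vdb_Theta[of 1 "(0, t, - t, 0, 0)"] by (simp add: h5_deg_def del: dual.simps)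
  finally have "BV_Delta_deg q p \<alpha> \<beta> 2 (Theta (0, 0, 0, s, t))
      = inv_into (HH_deg G 1) (VDB 1) (VDB 1 (Theta (0, t, - t, 0, 0)))"
    by (simp add: BV_Delta_deg_def)
  also have "\<dots> = Theta (0, t, - t, 0, 0)"
    by (rule inv_into_f_f[OF inj_vdb_1]) (simp add: Theta_in_HH_deg h5_deg_def)
  finally show ?thesis .
qed

lemma BV_Delta_1: "BV_Delta_deg q p \<alpha> \<beta> 1 (Theta (0, s, t, 0, 0)) = Theta (- (s + t), 0, 0, 0, 0)"
proof -
  let ?C = "single [ab ((- t / (q * c)) *s Y), ab X] 1 + single [ab ((s / c) *s X), ab Y] 1
    + single [ab 0, ab Z] (1 :: 'k)"
  have "VDB 1 (Theta (0, s, t, 0, 0)) = TWC 1 ?C"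
  proof -
    have "(2::nat) - 1 = 1" by simp
    then show ?thesis
      using vdb_Theta[of 1 "(0, s, t, 0, 0)"] by (simp only: eta_dual) (simp add: h5_deg_def)
  qed
  moreover have C0: "?C \<in> deg0_chains G (gwa_deg q p) 1"
    using deg0_single[of "[(- t / (q * c)) *s Y, X]" "[- 1, 1]" 1 1] deg0_single[of "[(s / c) *s X, Y]" "[1, - 1]" 1 1]
      deg0_single[of "[0, Z]" "[0, 0]" 1 1] homogeneous_gens
    by (intro deg0_add) (simp_all add: homogeneous_closed homogeneous_minus)
  ultimately have "connes G \<nu> (gwa_deg q p) 1 (VDB 1 (Theta (0, s, t, 0, 0))) = TWC 2 (CON ?C)"
    using connes_eq[OF _ C0] by (simp add: numeral_2_eq_2)
  also have "\<dots> = TWC 2 (eta_chain q p 2 (map ab (dual 0 (- (s + t), 0, 0, 0, 0))))"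
  \<comment> \<open>Here both sides already agree modulo relations. The operator sends
    \<open>m[a]\<close> to \<open>1[m, nu a] - 1[a, m]\<close>, and collecting
    \<open>1[y, x]\<close> and \<open>1[x, y]\<close> gives \<open>- (s + t)\<close> times the chain
    dual to \<open>1\<close>; its remaining terms have a scalar in a reduced slot.\<close>
  proof (rule tw_class_eqI, rule TWB_I0)
    have "CON ?C \<in> hchains G 2"
      using CON_hchains[of 1 ?C] by (simp add: hchains_closed numeral_2_eq_2)
    then show "CON ?C - eta_chain q p 2 (map ab (dual 0 (- (s + t), 0, 0, 0, 0))) \<in> hchains G 2"
      by (intro hchains_closed eta_chain_hchains) (simp_all add: Frank_def)
    fix ms assume "length ms = Suc 2" "nondeg ms"
    then obtain m m' m'' where ms: "ms = [m, m', m'']" "m' \<noteq> (0, 0)" "m'' \<noteq> (0, 0)" by (auto simp: length_Suc_conv numeral_2_eq_2)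
    then show "K ms (CON ?C - eta_chain q p 2 (map ab (dual 0 (- (s + t), 0, 0, 0, 0)))) = 0"
      by (simp add: eta_chain_simps lin_simps gen_rules nu_linear nu_Z lookup_mo[of 0 0 m'] lookup_mo[of 0 0 m''] field_simps del: nu_mo)
  qed simp
  also have "\<dots> = VDB 0 (Theta (- (s + t), 0, 0, 0, 0))"
    using vdb_Theta[of 0 "(- (s + t), 0, 0, 0, 0)"] by (simp add: h5_deg_def del: dual.simps)
  finally have "BV_Delta_deg q p \<alpha> \<beta> 1 (Theta (0, s, t, 0, 0))
      = inv_into (HH_deg G 0) (VDB 0) (VDB 0 (Theta (- (s + t), 0, 0, 0, 0)))"
    by (simp add: BV_Delta_deg_def)
  also have "\<dots> = Theta (- (s + t), 0, 0, 0, 0)"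
    by (rule inv_into_f_f[OF inj_vdb_0]) (simp add: Theta_in_HH_deg h5_deg_def)
  finally show ?thesis .
qed

lemma BV_Delta_Theta: "BV_Delta q p \<alpha> \<beta> (Theta w) = Theta (h5_Delta w)"
proof -
  obtain a b d e f where w: "w = (a, b, d, e, f)" by (cases w)
  have "BV_Delta_deg q p \<alpha> \<beta> n (HH_comp G n (Theta w))
      = Theta (if n = 1 then (- (b + d), 0, 0, 0, 0) else (0, f, - f, 0, 0))" if "n \<in> {1, 2}" for n
    using that BV_Delta_1[of b d] BV_Delta_2[of e f] by (auto simp: HH_comp_Theta h5_proj_def w)
  then have "BV_Delta q p \<alpha> \<beta> (Theta w)
      = (\<Oplus>\<^bsub>HH G\<^esub>n\<in>{1, 2}. Theta (if n = (1::nat) then (- (b + d), 0, 0, 0, 0) else (0, f, - f, 0, 0)))"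
    unfolding BV_Delta_def
    by (intro abelian_monoid.finsum_cong'[OF abelian_group.axioms(1)[OF HH.abelian_group_A]]) (auto simp: HH.carrier_A)
  also have "\<dots> = Theta (h5_Delta w)"
    by (simp add: HH.abs_finsum w h5_Delta_def)
  finally show ?thesis .
qed

end

lemma (in alg_model) k_basis_abs:
  assumes "\<And>b. \<exists>s. b = (\<Sum>i<length bs. s i *s (bs ! i))"
    and "\<And>s. (\<Sum>i<length bs. s i *s (bs ! i)) = 0 \<Longrightarrow> \<forall>i<length bs. s i = 0"
  shows "k_basis A (map abs bs)"
proof -
  have "(\<Oplus>\<^bsub>A\<^esub>i\<in>{..<length (map abs bs)}. s i \<odot>\<^bsub>A\<^esub> (map abs bs ! i)) = abs (\<Sum>i<length bs. s i *s (bs ! i))" for s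
  proof -
    have "(\<Oplus>\<^bsub>A\<^esub>i\<in>{..<length (map abs bs)}. s i \<odot>\<^bsub>A\<^esub> (map abs bs ! i)) = (\<Oplus>\<^bsub>A\<^esub>i\<in>{..<length bs}. abs (s i *s (bs ! i)))"
      by (intro abelian_monoid.finsum_cong'[OF abelian_group.axioms(1)[OF abelian_group_A]]) (auto simp: abs_smult)
    then show ?thesis by (simp add: abs_finsum)
  qed
  then show ?thesis
    unfolding k_basis_def using assms by (auto simp: ball_carrier abs_zero)
qed

theorem theorem4:
  fixes q c :: "'k::field" and p \<alpha> \<beta> :: "'k poly"
  assumes char: "(2::'k) \<noteq> 0"
    and q: "q \<noteq> 0" "\<And>n::nat. n > 0 \<Longrightarrow> q ^ n \<noteq> 1"
    and p: "c \<noteq> 0" "p = [:0, c:]"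
    and bezout: "\<alpha> * p + \<beta> * pderiv p = 1"
  shows "let A = gwa q p; x = gx q p; y = gy q p; z = gz q p;
             H = HH A; \<Delta> = BV_Delta q p \<alpha> \<beta>;
             e = HH_class q p 0 [\<one>\<^bsub>A\<^esub>];
             s = HH_class q p 1 [x, \<ominus>\<^bsub>A\<^esub> y, \<zero>\<^bsub>A\<^esub>];
             t = HH_class q p 1 [x, y, 2 \<odot>\<^bsub>A\<^esub> z];
             u = HH_class q p 2 [\<one>\<^bsub>A\<^esub>, \<one>\<^bsub>A\<^esub>, \<zero>\<^bsub>A\<^esub>, \<zero>\<^bsub>A\<^esub>];
             v = HH_class q p 2 [\<zero>\<^bsub>A\<^esub>, gpoly q p (sigma q p), \<ominus>\<^bsub>A\<^esub> (x \<otimes>\<^bsub>A\<^esub> z), z \<otimes>\<^bsub>A\<^esub> y]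
         in BV_algebra H (HH_deg A) \<Delta> \<and>
            k_basis H [e, s, t, u, v] \<and>
            e \<in> HH_deg A 0 \<and> s \<in> HH_deg A 1 \<and> t \<in> HH_deg A 1 \<and> u \<in> HH_deg A 2 \<and> v \<in> HH_deg A 2 \<and>
            (\<forall>h\<in>carrier H. e \<otimes>\<^bsub>H\<^esub> h = h \<and> h \<otimes>\<^bsub>H\<^esub> e = h) \<and>
            s \<otimes>\<^bsub>H\<^esub> t = \<ominus>\<^bsub>H\<^esub> (t \<otimes>\<^bsub>H\<^esub> s) \<and> s \<otimes>\<^bsub>H\<^esub> t = (-2) \<odot>\<^bsub>H\<^esub> v \<and>
            (\<forall>a\<in>{s, t, u, v}. \<forall>b\<in>{s, t, u, v}.
               (a, b) \<noteq> (s, t) \<and> (a, b) \<noteq> (t, s) \<longrightarrow> a \<otimes>\<^bsub>H\<^esub> b = \<zero>\<^bsub>H\<^esub>) \<and>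
            \<Delta> v = s \<and> \<Delta> t = (-2) \<odot>\<^bsub>H\<^esub> e \<and> \<Delta> e = \<zero>\<^bsub>H\<^esub> \<and> \<Delta> s = \<zero>\<^bsub>H\<^esub> \<and> \<Delta> u = \<zero>\<^bsub>H\<^esub>"
proof -
  interpret gwa_duality q c p \<alpha> \<beta>
    by unfold_locales (use q p bezout in auto)
  have S0: "[0, 0, 0] \<in> SB 1" "[0, 0, 0, 0] \<in> SB 2" "[0] \<in> SB 0"
    using vsubgroup_zero[OF vsubgroup_SB[of 0]] vsubgroup_zero[OF vsubgroup_SB[of 1]] vsubgroup_zero[OF vsubgroup_SB[of 2]]
    by (simp_all add: Frank_def numeral_eq_Suc)
  have e: "HH_class q p 0 [\<one>\<^bsub>G\<^esub>] = Theta (1, 0, 0, 0, 0)"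
    using HH_class_eq[of 0 "(1, 0, 0, 0, 0)" "[mo 0 0]"] S0 by (simp add: h5_deg_def Frank_def etav_def abs_simps)
  have s: "HH_class q p 1 [gx q p, \<ominus>\<^bsub>G\<^esub> gy q p, \<zero>\<^bsub>G\<^esub>] = Theta (0, 1, - 1, 0, 0)"
    using HH_class_eq[of 1 "(0, 1, - 1, 0, 0)" "[X, - Y, 0]"] S0 by (simp add: h5_deg_def Frank_def etav_def g_simps dZ)
  have two: "2 *s Z = Z + Z"
    using pscale.scale_left_distrib[of 1 1 Z] by simp
  have t: "HH_class q p 1 [gx q p, gy q p, 2 \<odot>\<^bsub>G\<^esub> gz q p] = Theta (0, 1, 1, 0, 0)"
    using HH_class_eq[of 1 "(0, 1, 1, 0, 0)" "[X, Y, 2 *s Z]"] S0 by (simp add: h5_deg_def Frank_def etav_def g_simps dZ two)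
  have u: "HH_class q p 2 [\<one>\<^bsub>G\<^esub>, \<one>\<^bsub>G\<^esub>, \<zero>\<^bsub>G\<^esub>, \<zero>\<^bsub>G\<^esub>] = Theta (0, 0, 0, 1, 0)"
  proof -
    \<comment> \<open>The standard representative vanishes at \<open>[y, x]\<close>, so the first
      component of the difference is \<open>1\<close>; as \<open>S1 0 0 e\<close> has
      \<open>- c e\<close> there, \<open>e\<close> must be \<open>- 1 / c\<close>.\<close>
    have "map2 (-) [mo 0 0, mo 0 0, 0, 0] (etav 2 (rep (0, 0, 0, 1, 0))) = S1 0 0 (- (inverse c *s mo 0 0))"
      by (simp add: etav_def dZ mul_simps scale_simps algebra_simps)
    then have "map2 (-) [mo 0 0, mo 0 0, 0, 0] (etav 2 (rep (0, 0, 0, 1, 0))) \<in> SB 2"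
      by (auto simp: SB_def simp del: S1.simps)
    then show ?thesis
      using HH_class_eq[of 2 "(0, 0, 0, 1, 0)" "[mo 0 0, mo 0 0, 0, 0]"] by (simp add: h5_deg_def Frank_def abs_simps)
  qed
  have v: "HH_class q p 2 [\<zero>\<^bsub>G\<^esub>, gpoly q p (sigma q p), \<ominus>\<^bsub>G\<^esub> (gx q p \<otimes>\<^bsub>G\<^esub> gz q p), gz q p \<otimes>\<^bsub>G\<^esub> gy q p]
      = Theta (0, 0, 0, 0, 1)"
  proof -
    have "etav 2 (rep (0, 0, 0, 0, 1)) = [0, (c * q) *s Z, - (X \<cdot> Z), Z \<cdot> Y]"
      by (simp add: etav_def dZ gen_rules mult.commute del: qmul_mo)
    then show ?thesis
      using HH_class_eq[of 2 "(0, 0, 0, 0, 1)" "[0, (c * q) *s Z, - (X \<cdot> Z), Z \<cdot> Y]"] S0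
      by (simp add: h5_deg_def Frank_def g_simps sigma_p zp_linear)
  qed
  let ?bs = "[(1, 0, 0, 0, 0), (0, 1, - 1, 0, 0), (0, 1, 1, 0, 0), (0, 0, 0, 1, 0), (0, 0, 0, 0, 1)] :: 'k h5 list"
  have sum_bs: "(\<Sum>i<length ?bs. h5_scale (r i) (?bs ! i)) = (r 0, r 1 + r 2, r 2 - r 1, r 3, r 4)" for r :: "nat \<Rightarrow> 'k"
    by (simp add: h5_scale_def numeral_eq_Suc zero_prod_def)
  have "k_basis (HH G) (map Theta ?bs)"
  proof (rule HH.k_basis_abs)
    fix w :: "'k h5"
    obtain a b d f g where w: "w = (a, b, d, f, g)" by (cases w)
    \<comment> \<open>The classes \<open>s\<close> and \<open>t\<close> are the difference and the
      sum of the two Euler derivations. Recovering these takes half sums and half differences, which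
      is where the characteristic enters.\<close>
    define r where "r = (\<lambda>i::nat. if i = 0 then a else if i = 1 then (b - d) / 2 else if i = 2 then (b + d) / 2 else if i = 3 then f else g)"
    have "(b - d) / 2 + (b + d) / 2 = (2 * b) / 2" "(b + d) / 2 - (b - d) / 2 = (2 * d) / 2"
      unfolding add_divide_distrib[symmetric] diff_divide_distrib[symmetric] by simp_all
    then have "(b - d) / 2 + (b + d) / 2 = b" "(b + d) / 2 - (b - d) / 2 = d"
      using char by simp_all
    then have "w = (\<Sum>i<length ?bs. h5_scale (r i) (?bs ! i))"
      unfolding sum_bs by (simp add: w r_def)
    then show "\<exists>r. w = (\<Sum>i<length ?bs. h5_scale (r i) (?bs ! i))"
      by (rule exI[of _ r])
  next
    fix r :: "nat \<Rightarrow> 'k" assume "(\<Sum>i<length ?bs. h5_scale (r i) (?bs ! i)) = 0"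
    then have "r 0 = 0 \<and> r 1 + r 2 = 0 \<and> r 2 - r 1 = 0 \<and> r 3 = 0 \<and> r 4 = 0"
      unfolding sum_bs h5_eq_0_iff .
    then have z: "r 0 = 0" "r 1 + r 2 = 0" "r 2 - r 1 = 0" "r 3 = 0" "r 4 = 0"
      by blast+
    have "2 * r 2 = (r 1 + r 2) + (r 2 - r 1)" by simp
    then have "2 * r 2 = 0" unfolding z by simp
    then have r2: "r 2 = 0" using char by simp
    then have "r 1 = 0" using z(2) by simp
    with z r2 show "\<forall>i<length ?bs. r i = 0"
      by (auto simp: less_Suc_eq numeral_eq_Suc)
  qed
  moreover have "BV_algebra (HH G) (HH_deg G) (BV_Delta q p \<alpha> \<beta>)"
    by (rule BV_algebra_HH) (rule BV_Delta_Theta)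
  ultimately show ?thesis
    unfolding Let_def e s t u v HH.ball_carrier
    by (simp add: Theta_in_HH_deg h5_deg_def HH.abs_simps h5_mul_def h5_scale_def BV_Delta_Theta h5_Delta_def split: prod.splits)
qed

end
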